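(* Consider the problem $\min_{x\in\mathbb{R}^n} f(x)+r(x)$ with $r(x)=\sum_{i=1}^{n_{\mathcal G}}\lambda_i\|[x]_{\mathcal G_i}\|_2$, and let Algorithm A (described in the context) be run from $x_0$, producing infinite sequences $\{x_k\},\{\alpha_k\},\{\chi^{\mathrm{cg}}_k\},\{\chi^{\mathrm{pg}}_k\}$. Suppose: (1) $f$ is convex and continuously differentiable; on $\mathcal L:=\{x: f(x)+r(x)\le f(x_0)+r(x_0)\}$ the gradient $\nabla f$ is bounded in norm by a constant $L_f$ and Lipschitz continuous with constant $L$; $f+r$ is bounded below; (2) $\max\{\chi^{\mathrm{cg}}_k,\chi^{\mathrm{pg}}_k\}>0$ for all $k\in\mathbb N$; (3) there are constants $0<\mu_{\min}\le\mu_{\max}<\infty$ with $\mu_{\min}\|v\|_2^2\le v^TH_kv\le\mu_{\max}\|v\|_2^2$ for all $k\in\mathcal K^{\mathrm{cg}}$ and $v\in\mathbb{R}^{|\mathcal I_k|}$; (4) $f$ is twice continuously differentiable and strongly convex, so the problem has a unique solution $x_*$; with $\mathcal S_*:=\{i:[x_*]_{\mathcal G_i}\ne0\}$, $\nabla^2f$ is Lipschitz continuous in a neighborhood of $x_*$ and $\|[\nabla f(x_* )]_{\mathcal G_i}\|_2<\lambda_i$ for all $i\notin\mathcal S_*$; (5) $\eta\in(0,1/2)$; for all sufficiently large $k$, $\mathcal I_k=\mathcal I^{\mathrm{cg}}_k$ if $k\in\mathcal K^{\mathrm{cg}}$ and $\mathcal I_k=\mathcal I^{\mathrm{pg}}_k$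 if $k\in\mathcal K^{\mathrm{pg}}$; and for all sufficiently large $k\in\mathcal K^{\mathrm{cg}}$, $H_k=\nabla^2_{\mathcal I_k\mathcal I_k}(f+r)(x_k)$. If in the CG direction computation either $q\in(1,2]$, or $q=1$ and $\mu_k\to0$, then $\{x_k\}\to x_*$ at a superlinear rate, i.e. $\|x_{k+1}-x_*\|_2=o(\|x_k-x_*\|_2)$. In particular, if $q=2$, then the rate of convergence is quadratic, i.e. $\|x_{k+1}-x_*\|_2=O(\|x_k-x_*\|_2^2)$.
   Context: Notation. $\mathbb N=\{0,1,2,\dots\}$. The groups $\mathcal G_1,\dots,\mathcal G_{n_{\mathcal G}}$ form a partition of $\{1,\dots,n\}$, and $\lambda_i>0$. $[x]_{\mathcal I}$ is the subvector of $x$ indexed by $\mathcal I$ (with $\|[\cdot]_\emptyset\|_2=0$); $P_{\mathcal I}(x)\in\mathbb R^n$ agrees with $x$ on $\mathcal I$ and is $0$ elsewhere; $\nabla_{\mathcal I}$, $\nabla^2_{\mathcal I\mathcal I}$ are the gradient and Hessian with respect to the variables in $\mathcal I$. $F:=f+r$ is differentiable with respect to the variables of $\mathcal G_i$ wherever $[x]_{\mathcal G_i}\ne0$. The proximal gradient (PG) update is $T(x,\alpha):=\arg\min_{y}\{\frac1{2\alpha}\|y-(x-\alpha\nabla f(x))\|_2^2+r(y)\}$ and the PG step is $s(x,\alpha):=T(x,\alpha)-x$. Algorithm A. Constants: $\varphi,\xi,\eta,\zeta\in(0,1)$, $\kappa_1,\kappa_2,p\in(0,\infty)$, $\theta\in(0,\pi/2)$,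 $q\in[1,2]$; initial $x_0\in\mathbb R^n$, $\alpha_0\in(0,1]$. For $k=0,1,2,\dots$: 1. $s_k:=s(x_k,\alpha_k)$. 2. $\bar{\mathcal I}^{\mathrm{cg}}_k$ := union of all $\mathcal G_i$ with $[x_k]_{\mathcal G_i}\ne0$, $[x_k+s_k]_{\mathcal G_i}\neq0$ and $\|[x_k]_{\mathcal G_i}\|_2\ge\kappa_1\|\nabla_{\mathcal G_i}F(x_k)\|_2$. $\mathcal I^{\mathrm{small}}_k$ := union of all $\mathcal G_i\subseteq\bar{\mathcal I}^{\mathrm{cg}}_k$ with $\|[x_k]_{\mathcal G_i}\|_2<\kappa_2\|\nabla_{\bar{\mathcal I}^{\mathrm{cg}}_k}F(x_k)\|_2^p$. $\mathcal I^{\mathrm{cg}}_k:=\bar{\mathcal I}^{\mathrm{cg}}_k\setminus\mathcal I^{\mathrm{small}}_k$, $\mathcal I^{\mathrm{pg}}_k:=\{1,\dots,n\}\setminus\mathcal I^{\mathrm{cg}}_k$, $\chi^{\mathrm{cg}}_k:=\|[s_k]_{\mathcal I^{\mathrm{cg}}_k}\|_2$, $\chi^{\mathrm{pg}}_k:=\|[s_k]_{\mathcal I^{\mathrm{pg}}_k}\|_2$. 3. If $\chi^{\mathrm{pg}}_k\le\chi^{\mathrm{cg}}_k$ (we write $k\in\mathcal K^{\mathrm{cg}}$): choose any $\mathcal I_k\subseteq\mathcal I^{\mathrm{cg}}_k$ that is a union of groups with $\|[s_k]_{\mathcal I_k}\|_2\ge\varphi\chi^{\mathrm{cg}}_k$;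 set $g_k:=\nabla_{\mathcal I_k}F(x_k)$; pick a symmetric positive-definite $H_k\in\mathbb R^{|\mathcal I_k|\times|\mathcal I_k|}$. CG direction: with $m_k(d):=g_k^Td+\frac12d^TH_kd$, $\beta_k:=\|g_k\|_2^2/(g_k^TH_kg_k)$, $d_k^R:=-\beta_kg_k$ and a chosen $\mu_k\in(0,1]$, compute any $\bar d_k$ with $g_k^T\bar d_k\le g_k^Td_k^R$, $m_k(\bar d_k)\le m_k(0)$, $\|H_k\bar d_k+g_k\|_2\le\mu_k\|g_k\|_2^q$. Set $[d_k]_{\mathcal I_k}:=\bar d_k$ and $d_k:=0$ elsewhere. CG search: for each $\mathcal G_i\subseteq\mathcal I_k$ let $\rho_{k,i}:=\max\{\kappa_1\|\nabla_{\mathcal G_i}F(x_k)\|_2,\kappa_2\|\nabla_{\mathcal I^{\mathrm{cg}}_k}F(x_k)\|_2^p\}$, $\bar\rho_{k,i}:=\min\{\rho_{k,i},\sin(\theta)\|[x_k]_{\mathcal G_i}\|_2\}$, and let $\tau_{k,i}$ be the smallest positive root $\tau$ of $\|[x_k+\tau d_k]_{\mathcal G_i}\|_2=\bar\rho_{k,i}$, or $\infty$ if the ray $\{[x_k+\tau d_k]_{\mathcal G_i}:\tau\ge0\}$ does not meet the closed ball of radius $\bar\rho_{k,i}$ about $0$; $\tau_k:=\min_i\tau_{k,i}$. For $j=0,1,2,\dots$ as long as $\xi^j\ge\tau_k$: let $y_j$ agree with $x_k$ outside $\mathcal I_k$, and for $\mathcal G_i\subseteq\mathcal I_k$ set $[y_j]_{\mathcal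 G_i}=[x_k+\xi^jd_k]_{\mathcal G_i}$ if $\xi^j<\tau_{k,i}$ and $[y_j]_{\mathcal G_i}=0$ if $\xi^j\ge\tau_{k,i}$; if $F(y_j)\le F(x_k)$, return $x_{k+1}:=y_j$ (then $k\in\mathcal K^{\mathrm{cg}}_0$). If this did not return, continue increasing $j$ (now $\xi^j<\tau_k$), with $y_j:=x_k+\xi^jd_k$, until $F(y_j)\le F(x_k)+\eta\xi^jg_k^T[d_k]_{\mathcal I_k}$, and return $x_{k+1}:=y_j$ (then $k\in\mathcal K^{\mathrm{cg}}_{\mathrm{sd}}$). Set $\alpha_{k+1}:=\alpha_k$. 4. Otherwise (we write $k\in\mathcal K^{\mathrm{pg}}$): choose any $\mathcal I_k\subseteq\mathcal I^{\mathrm{pg}}_k$ that is a union of groups with $\|[s_k]_{\mathcal I_k}\|_2\ge\varphi\chi^{\mathrm{pg}}_k$. PG search: let $j\ge0$ be the smallest integer such that $y_j:=x_k+\xi^jP_{\mathcal I_k}(s_k)$ satisfies $F(y_j)\le F(x_k)-\eta\xi^j\frac1{\alpha_k}\|P_{\mathcal I_k}(s_k)\|_2^2$; set $x_{k+1}:=y_j$. If $j=0$ (then $k\in\mathcal K^{\mathrm{pg}}_{\rightarrow}$) set $\alpha_{k+1}:=\alpha_k$; if $j>0$ (then $k\in\mathcal K^{\mathrm{pg}}_{\downarrow}$) set $\alpha_{k+1}:=\zeta\alpha_k$. *)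

theory Defs
  imports "HOL-Analysis.Analysis" "HOL-Library.Landau_Symbols"
begin

section \<open>Calculus\<close>

definition grad :: "(real^'n \<Rightarrow> real) \<Rightarrow> real^'n \<Rightarrow> real^'n" where
  "grad f x = (THE D. GDERIV f x :> D)"

definition hess :: "(real^'n \<Rightarrow> real) \<Rightarrow> real^'n \<Rightarrow> real^'n^'n" where
  "hess f x = jacobian (grad f) (at x)"

definition strongly_convex :: "(real^'n \<Rightarrow> real) \<Rightarrow> bool" where
  "strongly_convex f \<longleftrightarrow> (\<exists>m>0. \<forall>x y. \<forall>t\<in>{0..1}.
     f ((1 - t) *\<^sub>R x + t *\<^sub>R y)
       \<le> (1 - t) * f x + t * f y - m / 2 * t * (1 - t) * (norm (x - y))\<^sup>2)"

text \<open>
  A vector indexed by a subset \<open>I\<close> of the coordinates is represented throughout by its extension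
  by zero to the full space; \<open>proj I x\<close> thus plays the role both of the subvector of \<open>x\<close> indexed
  by \<open>I\<close> and of its embedding.  Norms and inner products of subvectors are not affected.
  Matrices indexed by \<open>I \<times> I\<close> are likewise extended by zero.
\<close>

definition proj :: "'n set \<Rightarrow> real^'n \<Rightarrow> real^'n" where
  "proj I x = (\<chi> c. if c \<in> I then x $ c else 0)"

text \<open>
  Derivatives with respect to the variables in \<open>I\<close>: the other variables are frozen at their
  values in \<open>x\<close>.  The results vanish outside \<open>I\<close> and \<open>I \<times> I\<close>, respectively.
\<close>

definition grad_on :: "'n set \<Rightarrow> (real^'n \<Rightarrow> real) \<Rightarrow> real^'n \<Rightarrow> real^'n" where
  "grad_on I F x = grad (\<lambda>y. F (proj (- I) x + proj I y)) x"

definition hess_on :: "'n set \<Rightarrow> (real^'n \<Rightarrow> real) \<Rightarrow> real^'n \<Rightarrow> real^'n^'n" where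
  "hess_on I F x = hess (\<lambda>y. F (proj (- I) x + proj I y)) x"

definition spd_on :: "'n set \<Rightarrow> real^'n^'n \<Rightarrow> bool" where
  "spd_on I H \<longleftrightarrow>
     (\<forall>i j. i \<notin> I \<or> j \<notin> I \<longrightarrow> H $ i $ j = 0) \<and>
     transpose H = H \<and>
     (\<forall>v. proj I v = v \<and> v \<noteq> 0 \<longrightarrow> v \<bullet> (H *v v) > 0)"


section \<open>Problem data and proximal gradient step\<close>

definition is_grouping :: "('g::finite \<Rightarrow> 'n set) \<Rightarrow> bool" where
  "is_grouping G \<longleftrightarrow> (\<forall>i. G i \<noteq> {}) \<and> disjoint_family G \<and> (\<Union>i. G i) = UNIV"

definition union_of_groups :: "('g::finite \<Rightarrow> 'n set) \<Rightarrow> 'n set \<Rightarrow> bool" where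
  "union_of_groups G I \<longleftrightarrow> (\<exists>J. I = (\<Union>i\<in>J. G i))"

definition group_reg :: "('g::finite \<Rightarrow> 'n set) \<Rightarrow> ('g \<Rightarrow> real) \<Rightarrow> real^'n \<Rightarrow> real" where
  "group_reg G lam x = (\<Sum>i\<in>UNIV. lam i * norm (proj (G i) x))"

definition pg_update ::
  "(real^'n \<Rightarrow> real) \<Rightarrow> (real^'n \<Rightarrow> real) \<Rightarrow> real^'n \<Rightarrow> real \<Rightarrow> real^'n" where
  "pg_update f r x \<alpha> =
     arg_min (\<lambda>y. 1 / (2 * \<alpha>) * (norm (y - (x - \<alpha> *\<^sub>R grad f x)))\<^sup>2 + r y) (\<lambda>_. True)"

definition pg_step ::
  "(real^'n \<Rightarrow> real) \<Rightarrow> (real^'n \<Rightarrow> real) \<Rightarrow> real^'n \<Rightarrow> real \<Rightarrow> real^'n" where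
  "pg_step f r x \<alpha> = pg_update f r x \<alpha> - x"


section \<open>The algorithm\<close>

record algo_params =
  phi :: real
  xi :: real
  eta :: real
  zeta :: real
  kappa1 :: real
  kappa2 :: real
  pexp :: real
  theta :: real
  qexp :: real

definition valid_params :: "algo_params \<Rightarrow> bool" where
  "valid_params C \<longleftrightarrow>
     phi C \<in> {0<..<1} \<and> xi C \<in> {0<..<1} \<and> eta C \<in> {0<..<1} \<and> zeta C \<in> {0<..<1} \<and>
     kappa1 C > 0 \<and> kappa2 C > 0 \<and> pexp C > 0 \<and>
     theta C \<in> {0<..<pi / 2} \<and> qexp C \<in> {1..2}"

text \<open>In the following definitions \<open>F\<close> is the full objective, \<open>x\<close> the current iterate and
  \<open>s\<close> the proximal gradient step at \<open>x\<close>.\<close>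

definition cg_bar_set ::
  "algo_params \<Rightarrow> ('g::finite \<Rightarrow> 'n set) \<Rightarrow> (real^'n \<Rightarrow> real) \<Rightarrow> real^'n \<Rightarrow> real^'n \<Rightarrow> 'n set" where
  "cg_bar_set C G F x s =
     \<Union>{G i | i. proj (G i) x \<noteq> 0 \<and> proj (G i) (x + s) \<noteq> 0 \<and>
                 norm (proj (G i) x) \<ge> kappa1 C * norm (grad_on (G i) F x)}"

definition small_set ::
  "algo_params \<Rightarrow> ('g::finite \<Rightarrow> 'n set) \<Rightarrow> (real^'n \<Rightarrow> real) \<Rightarrow> real^'n \<Rightarrow> real^'n \<Rightarrow> 'n set" where
  "small_set C G F x s =
     \<Union>{G i | i. G i \<subseteq> cg_bar_set C G F x s \<and>
                 norm (proj (G i) x)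
                   < kappa2 C * norm (grad_on (cg_bar_set C G F x s) F x) powr pexp C}"

definition cg_set ::
  "algo_params \<Rightarrow> ('g::finite \<Rightarrow> 'n set) \<Rightarrow> (real^'n \<Rightarrow> real) \<Rightarrow> real^'n \<Rightarrow> real^'n \<Rightarrow> 'n set" where
  "cg_set C G F x s = cg_bar_set C G F x s - small_set C G F x s"

definition pg_set ::
  "algo_params \<Rightarrow> ('g::finite \<Rightarrow> 'n set) \<Rightarrow> (real^'n \<Rightarrow> real) \<Rightarrow> real^'n \<Rightarrow> real^'n \<Rightarrow> 'n set" where
  "pg_set C G F x s = - cg_set C G F x s"

definition chi_cg ::
  "algo_params \<Rightarrow> ('g::finite \<Rightarrow> 'n set) \<Rightarrow> (real^'n \<Rightarrow> real) \<Rightarrow> real^'n \<Rightarrow> real^'n \<Rightarrow> real" where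
  "chi_cg C G F x s = norm (proj (cg_set C G F x s) s)"

definition chi_pg ::
  "algo_params \<Rightarrow> ('g::finite \<Rightarrow> 'n set) \<Rightarrow> (real^'n \<Rightarrow> real) \<Rightarrow> real^'n \<Rightarrow> real^'n \<Rightarrow> real" where
  "chi_pg C G F x s = norm (proj (pg_set C G F x s) s)"

definition quad_model :: "real^'n \<Rightarrow> real^'n^'n \<Rightarrow> real^'n \<Rightarrow> real" where
  "quad_model g H d = g \<bullet> d + 1 / 2 * (d \<bullet> (H *v d))"

definition reference_direction :: "real^'n \<Rightarrow> real^'n^'n \<Rightarrow> real^'n" where
  "reference_direction g H = - ((norm g)\<^sup>2 / (g \<bullet> (H *v g))) *\<^sub>R g"

definition cg_direction ::
  "algo_params \<Rightarrow> 'n set \<Rightarrow> real^'n \<Rightarrow> real^'n^'n \<Rightarrow> real \<Rightarrow> real^'n \<Rightarrow> bool" where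
  "cg_direction C I g H \<mu> d \<longleftrightarrow>
     proj I d = d \<and>
     g \<bullet> d \<le> g \<bullet> reference_direction g H \<and>
     quad_model g H d \<le> quad_model g H 0 \<and>
     norm (H *v d + g) \<le> \<mu> * norm g powr qexp C"

definition radius ::
  "algo_params \<Rightarrow> ('g::finite \<Rightarrow> 'n set) \<Rightarrow> (real^'n \<Rightarrow> real) \<Rightarrow> 'n set \<Rightarrow> real^'n \<Rightarrow> 'g \<Rightarrow> real" where
  "radius C G F Icg x i =
     min (max (kappa1 C * norm (grad_on (G i) F x))
              (kappa2 C * norm (grad_on Icg F x) powr pexp C))
         (sin (theta C) * norm (proj (G i) x))"

definition group_tau ::
  "algo_params \<Rightarrow> ('g::finite \<Rightarrow> 'n set) \<Rightarrow> (real^'n \<Rightarrow> real) \<Rightarrow> 'n set \<Rightarrow> real^'n \<Rightarrow> real^'n \<Rightarrow> 'g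
     \<Rightarrow> ereal" where
  "group_tau C G F Icg x d i =
     (if \<exists>t\<ge>0. norm (proj (G i) (x + t *\<^sub>R d)) \<le> radius C G F Icg x i
      then ereal (LEAST t. t > 0 \<and> norm (proj (G i) (x + t *\<^sub>R d)) = radius C G F Icg x i)
      else \<infinity>)"

definition min_tau ::
  "algo_params \<Rightarrow> ('g::finite \<Rightarrow> 'n set) \<Rightarrow> (real^'n \<Rightarrow> real) \<Rightarrow> 'n set \<Rightarrow> 'n set \<Rightarrow> real^'n \<Rightarrow> real^'n
     \<Rightarrow> ereal" where
  "min_tau C G F Icg I x d = (INF i\<in>{i. G i \<subseteq> I}. group_tau C G F Icg x d i)"

text \<open>The trial point for step size \<open>t\<close> before the threshold \<open>min_tau\<close> is passed: groups in \<open>I\<close>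
  that have reached their ball are set to zero.  The direction \<open>d\<close> vanishes outside \<open>I\<close>.\<close>

definition cut_point ::
  "algo_params \<Rightarrow> ('g::finite \<Rightarrow> 'n set) \<Rightarrow> (real^'n \<Rightarrow> real) \<Rightarrow> 'n set \<Rightarrow> 'n set \<Rightarrow> real^'n \<Rightarrow> real^'n
     \<Rightarrow> real \<Rightarrow> real^'n" where
  "cut_point C G F Icg I x d t =
     proj (- \<Union>{G i | i. G i \<subseteq> I \<and> ereal t \<ge> group_tau C G F Icg x d i}) (x + t *\<^sub>R d)"

text \<open>Acceptance test of the CG search at backtracking index \<open>j\<close> and the corresponding trial point;
  the search returns the trial point at the first accepted index.\<close>

definition cg_accept ::
  "algo_params \<Rightarrow> ('g::finite \<Rightarrow> 'n set) \<Rightarrow> (real^'n \<Rightarrow> real) \<Rightarrow> 'n set \<Rightarrow> 'n set \<Rightarrow> real^'n \<Rightarrow> real^'n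
     \<Rightarrow> nat \<Rightarrow> bool" where
  "cg_accept C G F Icg I x d j \<longleftrightarrow>
     (if ereal (xi C ^ j) \<ge> min_tau C G F Icg I x d
      then F (cut_point C G F Icg I x d (xi C ^ j)) \<le> F x
      else F (x + xi C ^ j *\<^sub>R d) \<le> F x + eta C * xi C ^ j * (grad_on I F x \<bullet> d))"

definition cg_trial ::
  "algo_params \<Rightarrow> ('g::finite \<Rightarrow> 'n set) \<Rightarrow> (real^'n \<Rightarrow> real) \<Rightarrow> 'n set \<Rightarrow> 'n set \<Rightarrow> real^'n \<Rightarrow> real^'n
     \<Rightarrow> nat \<Rightarrow> real^'n" where
  "cg_trial C G F Icg I x d j =
     (if ereal (xi C ^ j) \<ge> min_tau C G F Icg I x d
      then cut_point C G F Icg I x d (xi C ^ j)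
      else x + xi C ^ j *\<^sub>R d)"

definition cg_search ::
  "algo_params \<Rightarrow> ('g::finite \<Rightarrow> 'n set) \<Rightarrow> (real^'n \<Rightarrow> real) \<Rightarrow> 'n set \<Rightarrow> 'n set \<Rightarrow> real^'n \<Rightarrow> real^'n
     \<Rightarrow> real^'n \<Rightarrow> bool" where
  "cg_search C G F Icg I x d x' \<longleftrightarrow>
     (\<exists>j. cg_accept C G F Icg I x d j \<and> (\<forall>i<j. \<not> cg_accept C G F Icg I x d i) \<and>
          x' = cg_trial C G F Icg I x d j)"

definition cg_iteration ::
  "algo_params \<Rightarrow> ('g::finite \<Rightarrow> 'n set) \<Rightarrow> (real^'n \<Rightarrow> real) \<Rightarrow> real^'n \<Rightarrow> real^'n \<Rightarrow> real
     \<Rightarrow> 'n set \<Rightarrow> real^'n^'n \<Rightarrow> real \<Rightarrow> real^'n \<Rightarrow> real^'n \<Rightarrow> real \<Rightarrow> bool" where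
  "cg_iteration C G F x s \<alpha> I H \<mu> d x' \<alpha>' \<longleftrightarrow>
     I \<subseteq> cg_set C G F x s \<and> union_of_groups G I \<and>
     norm (proj I s) \<ge> phi C * chi_cg C G F x s \<and>
     spd_on I H \<and> 0 < \<mu> \<and> \<mu> \<le> 1 \<and>
     cg_direction C I (grad_on I F x) H \<mu> d \<and>
     cg_search C G F (cg_set C G F x s) I x d x' \<and>
     \<alpha>' = \<alpha>"

definition pg_accept ::
  "algo_params \<Rightarrow> (real^'n \<Rightarrow> real) \<Rightarrow> 'n set \<Rightarrow> real^'n \<Rightarrow> real^'n \<Rightarrow> real \<Rightarrow> nat \<Rightarrow> bool" where
  "pg_accept C F I x s \<alpha> j \<longleftrightarrow>
     F (x + xi C ^ j *\<^sub>R proj I s)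
       \<le> F x - eta C * xi C ^ j * (1 / \<alpha>) * (norm (proj I s))\<^sup>2"

definition pg_iteration ::
  "algo_params \<Rightarrow> ('g::finite \<Rightarrow> 'n set) \<Rightarrow> (real^'n \<Rightarrow> real) \<Rightarrow> real^'n \<Rightarrow> real^'n \<Rightarrow> real
     \<Rightarrow> 'n set \<Rightarrow> real^'n \<Rightarrow> real \<Rightarrow> bool" where
  "pg_iteration C G F x s \<alpha> I x' \<alpha>' \<longleftrightarrow>
     I \<subseteq> pg_set C G F x s \<and> union_of_groups G I \<and>
     norm (proj I s) \<ge> phi C * chi_pg C G F x s \<and>
     (\<exists>j. pg_accept C F I x s \<alpha> j \<and> (\<forall>i<j. \<not> pg_accept C F I x s \<alpha> i) \<and>
          x' = x + xi C ^ j *\<^sub>R proj I s \<and>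
          \<alpha>' = (if j = 0 then \<alpha> else zeta C * \<alpha>))"

text \<open>
  The sequences \<open>x\<close>, \<open>\<alpha>\<close>, together with the choices \<open>I\<close>, \<open>H\<close>, \<open>\<mu>\<close>, \<open>d\<close>, form an infinite run for
  the problem of minimizing \<open>f + r\<close>.  The entries of \<open>H\<close>, \<open>\<mu>\<close>, \<open>d\<close> at PG iterations are irrelevant.
\<close>

definition algorithm_run ::
  "algo_params \<Rightarrow> ('g::finite \<Rightarrow> 'n set) \<Rightarrow> (real^'n \<Rightarrow> real) \<Rightarrow> (real^'n \<Rightarrow> real)
     \<Rightarrow> (nat \<Rightarrow> real^'n) \<Rightarrow> (nat \<Rightarrow> real) \<Rightarrow> (nat \<Rightarrow> 'n set) \<Rightarrow> (nat \<Rightarrow> real^'n^'n) \<Rightarrow> (nat \<Rightarrow> real)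
     \<Rightarrow> (nat \<Rightarrow> real^'n) \<Rightarrow> bool" where
  "algorithm_run C G f r x \<alpha> I H \<mu> d \<longleftrightarrow>
     0 < \<alpha> 0 \<and> \<alpha> 0 \<le> 1 \<and>
     (\<forall>k. let F = (\<lambda>z. f z + r z); s = pg_step f r (x k) (\<alpha> k) in
        if chi_pg C G F (x k) s \<le> chi_cg C G F (x k) s
        then cg_iteration C G F (x k) s (\<alpha> k) (I k) (H k) (\<mu> k) (d k) (x (Suc k)) (\<alpha> (Suc k))
        else pg_iteration C G F (x k) s (\<alpha> k) (I k) (x (Suc k)) (\<alpha> (Suc k)))"

end

theory Submission
  imports Defs
begin

text \<open>
  Global convergence is a descent argument.  The gap \<open>F x - F x_star\<close> is at most a constant times
  the length of the proximal gradient step, so if it stayed above a positive level, then every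
  iteration would either decrease \<open>F\<close> by a fixed amount or, in a CG iteration, set one more group
  to zero without reviving any; both can happen only finitely often in a row.

  Near \<open>x_star\<close> strict complementarity makes the proximal step annihilate exactly the groups that
  vanish at \<open>x_star\<close>, so the CG index set becomes the support of \<open>x_star\<close>.  A single PG iteration
  then puts the iterate into the subspace of vectors with this support, CG iterations never leave it,
  and on it \<open>chi_pg\<close> vanishes; hence eventually all iterations are CG iterations in a fixed subspace,
  where \<open>F\<close> is smooth.  There the method is an inexact Newton method: since \<open>eta < 1/2\<close> the unit step
  is accepted, and the rate is governed by the residual of the Newton system.
\<close>

section \<open>Gradients, projections and Taylor bounds\<close>

text \<open>The obstacle is that \<open>F\<close> has no gradient where a group vanishes, so no
  smooth descent lemma applies to a CG trial ray, which may pass close to the origin of a group. The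
  estimate used instead is one-sided: the norm lies below a parabola touching it at the current
  point, with curvature governed by the distance of that point alone from the origin. The rule that
  discards small groups supplies this distance: with the gradient bounded below by \<epsilon>, every
  CG group has norm at least \<open>kappa2 C * \<epsilon> powr pexp C\<close>. This yields a fixed
  range of accepted step sizes. Cutting a group to zero guarantees no quantitative decrease of
  \<open>F\<close>, which is why nonzero groups have to be counted as well. The bound on the gap
  contains \<open>1 / \<alpha>\<close>, so it is of use only once \<alpha> is shown to change
  finitely often. In the local phase \<open>F\<close> is composed with the projection onto the
  support of \<open>x_star\<close>; this composition is smooth on a full neighborhood of
  \<open>x_star\<close>, so ordinary calculus on balls applies, and the lower bound on
  \<open>H\<close> converts a small \<open>H k *v v\<close> into a small \<open>v\<close>.\<close>

lemma grad_unique: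
  assumes "GDERIV f z :> D"
  shows "grad f z = D"
  unfolding grad_def
proof (rule the_equality)
  show "GDERIV f z :> D" by fact
  fix E assume "GDERIV f z :> E"
  with assms have "(\<lambda>h. h \<bullet> D) = (\<lambda>h. h \<bullet> E)"
    unfolding gderiv_def by (rule has_derivative_unique)
  then show "E = D"
    by (metis vector_eq_ldot)
qed

text \<open>A real-valued derivative is a linear functional; its adjoint evaluated at 1 is the
  vector representing it.\<close>

lemma GDERIV_grad:
  fixes f :: "real^'n \<Rightarrow> real"
  assumes "f differentiable (at z)"
  shows "GDERIV f z :> grad f z"
proof -
  obtain f' where f': "(f has_derivative f') (at z)"
    using assms unfolding differentiable_def by blast
  then have "linear f'"
    by (rule has_derivative_linear)
  then have "f' h = h \<bullet> adjoint f' 1" for h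
    using adjoint_works[of f' h 1] by simp
  then have "GDERIV f z :> adjoint f' 1"
    using f' unfolding gderiv_def by (metis (no_types, lifting) ext)
  then show ?thesis
    using grad_unique by metis
qed

section \<open>Coordinate projections\<close>

lemma proj_nth [simp]: "proj I x $ c = (if c \<in> I then x $ c else 0)"
  by (simp add: proj_def)

lemma proj_add: "proj I (x + y) = proj I x + proj I y"
  by (simp add: vec_eq_iff)

lemma proj_diff: "proj I (x - y) = proj I x - proj I y"
  by (simp add: vec_eq_iff)

lemma proj_minus: "proj I (- x) = - proj I x"
  by (simp add: vec_eq_iff)

lemma proj_scaleR: "proj I (a *\<^sub>R x) = a *\<^sub>R proj I x"
  by (simp add: vec_eq_iff)

lemma proj_zero [simp]: "proj I 0 = 0"
  by (simp add: vec_eq_iff)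

lemma proj_empty [simp]: "proj {} x = 0"
  by (simp add: vec_eq_iff)

lemma proj_proj [simp]: "proj I (proj J x) = proj (I \<inter> J) x"
  by (simp add: vec_eq_iff)

lemma proj_decomp: "proj (- I) x + proj I x = x"
  by (simp add: vec_eq_iff)

lemma inner_proj_left: "proj I x \<bullet> y = proj I x \<bullet> proj I y"
  unfolding inner_vec_def by (intro sum.cong) auto

lemma inner_proj_swap: "proj I x \<bullet> y = x \<bullet> proj I y"
  unfolding inner_vec_def by (intro sum.cong) auto

lemma norm_proj_le: "norm (proj I x) \<le> norm x"
  by (intro norm_le_componentwise_cart) auto

lemma bounded_linear_proj: "bounded_linear (proj I)"
  by (rule bounded_linear_intro[where K = 1])
     (simp_all add: proj_add proj_scaleR norm_proj_le)

lemmas tendsto_proj [tendsto_intros] = bounded_linear.tendsto[OF bounded_linear_proj]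

text \<open>Row-wise Cauchy-Schwarz: \<open>norm A\<close> is the Frobenius norm, since a matrix is
  a vector of rows. This is the norm in which the Lipschitz hypothesis on \<open>hess f\<close> is
  stated.\<close>

lemma norm_matrix_vector_mult_le:
  fixes A :: "real^'n^'m"
  shows "norm (A *v x) \<le> norm A * norm x"
proof (rule power2_le_imp_le)
  have "(norm (A *v x))\<^sup>2 = (\<Sum>i\<in>UNIV. (A $ i \<bullet> x)\<^sup>2)"
    unfolding power2_norm_eq_inner inner_vec_def[of "A *v x"]
    by (simp add: matrix_vector_mul_component power2_eq_square)
  also have "\<dots> \<le> (\<Sum>i\<in>UNIV. (norm (A $ i) * norm x)\<^sup>2)"
    by (intro sum_mono) (metis Cauchy_Schwarz_ineq2 abs_ge_zero power2_abs power_mono)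
  also have "\<dots> = (norm A * norm x)\<^sup>2"
    by (simp add: norm_vec_def L2_set_def power_mult_distrib sum_distrib_right real_sqrt_pow2 sum_nonneg)
  finally show "(norm (A *v x))\<^sup>2 \<le> (norm A * norm x)\<^sup>2" .
qed simp

section \<open>Mean value and Taylor bounds along segments\<close>

lemma segment_mvt:
  fixes f :: "'a::real_inner \<Rightarrow> real"
  assumes "\<And>t. t \<in> {0..1} \<Longrightarrow> GDERIV f (x + t *\<^sub>R v) :> g (x + t *\<^sub>R v)"
  obtains t where "0 < t" "t < 1" "f (x + v) - f x = g (x + t *\<^sub>R v) \<bullet> v"
proof -
  let ?c = "\<lambda>t::real. x + t *\<^sub>R v"
  have *: "((\<lambda>t. f (?c t)) has_derivative (\<lambda>h. (h *\<^sub>R v) \<bullet> g (?c t))) (at t within {0..1})"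
    if "t \<in> {0..1}" for t
  proof (rule has_derivative_compose[of ?c "\<lambda>h. h *\<^sub>R v", where g = f and g' = "\<lambda>h. h \<bullet> g (?c t)"])
    show "(?c has_derivative (\<lambda>h. h *\<^sub>R v)) (at t within {0..1})"
      by (auto intro!: derivative_eq_intros)
    show "(f has_derivative (\<lambda>h. h \<bullet> g (?c t))) (at (?c t))"
      using assms[OF that] unfolding gderiv_def .
  qed
  have "\<exists>t\<in>{0<..<1}. f (?c 1) - f (?c 0) = ((1 - 0) *\<^sub>R v) \<bullet> g (?c t)"
    by (rule mvt_simple[of 0 1 "\<lambda>t. f (?c t)" "\<lambda>t h. (h *\<^sub>R v) \<bullet> g (?c t)"]) (use * in auto)
  then show thesis
    using that by (auto simp: inner_commute)
qed

text \<open>The Hessian is bounded on the compact ball, so the gradient is Lipschitz there, and the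
  mean value theorem gives the bound with \<open>M\<close> in place of the sharp
  \<open>M / 2\<close>. The radius is free, so one ball can later hold all iterates and trial
  points.\<close>

lemma quadratic_upper_bound_on_cball:
  fixes f :: "real^'n \<Rightarrow> real"
  assumes f: "\<And>z. GDERIV f z :> g z"
    and g: "\<And>z. (g has_derivative (\<lambda>h. A z *v h)) (at z)"
    and A: "continuous_on UNIV A"
  obtains M where "M > 0"
    "\<And>x v. norm x \<le> R \<Longrightarrow> norm (x + v) \<le> R \<Longrightarrow> f (x + v) \<le> f x + g x \<bullet> v + M * (norm v)\<^sup>2"
proof -
  have "bounded (A ` cball 0 R)"
    by (intro compact_imp_bounded compact_continuous_image continuous_on_subset[OF A]) auto
  then obtain M where M: "M > 0" "\<And>z. norm z \<le> R \<Longrightarrow> norm (A z) \<le> M"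
    unfolding bounded_pos by auto
  have lip: "norm (g y - g z) \<le> M * norm (y - z)" if "norm y \<le> R" "norm z \<le> R" for y z
  proof (rule differentiable_bound[of "cball 0 R" g "\<lambda>z h. A z *v h"])
    fix w :: "real^'n" assume "w \<in> cball 0 R"
    then show "onorm (\<lambda>h. A w *v h) \<le> M"
      by (intro onorm_le order_trans[OF norm_matrix_vector_mult_le] mult_right_mono) (auto simp: M)
  qed (use that has_derivative_at_withinI[OF g] in auto)
  show thesis
  proof (rule that[OF M(1)])
    fix x v :: "real^'n" assume R: "norm x \<le> R" "norm (x + v) \<le> R"
    obtain t where t: "0 < t" "t < 1" "f (x + v) - f x = g (x + t *\<^sub>R v) \<bullet> v"
      using segment_mvt[of f x v g] f by blast
    have "x + t *\<^sub>R v = (1 - t) *\<^sub>R x + t *\<^sub>R (x + v)"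
      by (simp add: algebra_simps)
    then have "x + t *\<^sub>R v \<in> cball 0 R"
      using convexD_alt[OF convex_cball, of x 0 R "x + v" t] R t by simp
    then have "norm (g (x + t *\<^sub>R v) - g x) \<le> M * norm (t *\<^sub>R v)"
      using lip[of "x + t *\<^sub>R v" x] R by simp
    also have "\<dots> \<le> M * norm v"
      using t M(1) by (intro mult_left_mono) (auto intro: mult_left_le_one_le)
    finally have "(g (x + t *\<^sub>R v) - g x) \<bullet> v \<le> M * norm v * norm v"
      by (meson norm_cauchy_schwarz norm_ge_zero mult_right_mono order_trans)
    then show "f (x + v) \<le> f x + g x \<bullet> v + M * (norm v)\<^sup>2"
      using t(3) by (simp add: inner_diff_left power2_eq_square)
  qed
qed

text \<open>Along the segment the derivative stays within \<open>M * norm (y - z)\<close> of its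
  value at \<open>z\<close>, which bounds the deviation from linearity. The Lipschitz condition is
  tested on vectors \<open>v\<close>, since \<open>A z\<close> is a function and not a
  matrix.\<close>

lemma gradient_linearization:
  fixes g :: "'a::real_inner \<Rightarrow> 'a"
  assumes g: "\<And>z. z \<in> ball a \<epsilon> \<Longrightarrow> (g has_derivative A z) (at z)"
    and A: "\<And>y z v. y \<in> ball a \<epsilon> \<Longrightarrow> z \<in> ball a \<epsilon> \<Longrightarrow>
      norm (A y v - A z v) \<le> M * norm (y - z) * norm v"
    and M: "M \<ge> 0" and y: "y \<in> ball a \<epsilon>" and z: "z \<in> ball a \<epsilon>"
  shows "norm (g y - g z - A z (y - z)) \<le> M * (norm (y - z))\<^sup>2"
proof -
  have seg: "closed_segment z y \<subseteq> ball a \<epsilon>"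
    using y z by (simp add: closed_segment_subset)
  have "norm (g y - g z - A z (y - z)) \<le> norm (y - z) * (M * norm (y - z))"
  proof (rule differentiable_bound_linearization[of z y "closed_segment z y" g A z])
    fix w assume w: "w \<in> closed_segment z y"
    then show "(g has_derivative A w) (at w within closed_segment z y)"
      using g seg by (blast intro: has_derivative_at_withinI)
    have "norm (w - z) \<le> norm (y - z)"
      using segment_bound(1)[OF w] by simp
    have "norm ((A w - A z) v) \<le> M * norm (y - z) * norm v" for v
    proof -
      have "norm ((A w - A z) v) \<le> M * norm (w - z) * norm v"
        using A[of w z v] w seg z by auto
      also have "\<dots> \<le> M * norm (y - z) * norm v"
        using \<open>norm (w - z) \<le> norm (y - z)\<close> M by (intro mult_right_mono mult_left_mono) auto
      finally show ?thesis .
    qed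
    then show "onorm (A w - A z) \<le> M * norm (y - z)"
      using M by (intro onorm_bound) auto
  next
    fix t :: real assume "t \<in> {0..1}"
    then show "z + t *\<^sub>R (y - z) \<in> closed_segment z y"
      unfolding closed_segment_def by (auto intro!: exI[of _ t] simp: algebra_simps)
  qed auto
  then show ?thesis
    by (simp add: power2_eq_square mult_ac)
qed

text \<open>After subtraction of the linear and quadratic Taylor terms along the ray, the mean value
  theorem applies to the rest: \<open>gradient_linearization\<close> bounds its derivative. The
  constant is not optimized.\<close>

lemma second_order_upper_bound:
  fixes f :: "'a::real_inner \<Rightarrow> real"
  assumes f: "\<And>z. z \<in> ball a \<epsilon> \<Longrightarrow> GDERIV f z :> g z"
    and g: "\<And>z. z \<in> ball a \<epsilon> \<Longrightarrow> (g has_derivative A z) (at z)"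
    and A: "\<And>y z v. y \<in> ball a \<epsilon> \<Longrightarrow> z \<in> ball a \<epsilon> \<Longrightarrow>
      norm (A y v - A z v) \<le> M * norm (y - z) * norm v"
    and M: "M \<ge> 0" and x: "x \<in> ball a \<epsilon>" and xv: "x + v \<in> ball a \<epsilon>"
  shows "f (x + v) \<le> f x + g x \<bullet> v + 1 / 2 * (v \<bullet> A x v) + M * (norm v)^3"
proof -
  have seg: "x + t *\<^sub>R v \<in> ball a \<epsilon>" if "t \<in> {0..1}" for t
  proof -
    have "x + t *\<^sub>R v = (1 - t) *\<^sub>R x + t *\<^sub>R (x + v)"
      by (simp add: algebra_simps)
    then show ?thesis
      using convexD_alt[OF convex_ball x xv, of t] that by simp
  qed
  have lin: "linear (A x)"
    using g[OF x] has_derivative_linear by blast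
  let ?\<psi> = "\<lambda>t. f (x + t *\<^sub>R v) - t * (g x \<bullet> v) - t\<^sup>2 / 2 * (v \<bullet> A x v)"
  let ?c = "\<lambda>t::real. x + t *\<^sub>R v"
  have *: "((\<lambda>t. f (?c t)) has_derivative (\<lambda>h. (h *\<^sub>R v) \<bullet> g (?c t))) (at t)"
    if "t \<in> {0..1}" for t
  proof (rule has_derivative_compose[of ?c "\<lambda>h. h *\<^sub>R v", where g = f and g' = "\<lambda>h. h \<bullet> g (?c t)"])
    show "(?c has_derivative (\<lambda>h. h *\<^sub>R v)) (at t)"
      by (auto intro!: derivative_eq_intros)
    show "(f has_derivative (\<lambda>h. h \<bullet> g (?c t))) (at (?c t))"
      using f[OF seg[OF that]] unfolding gderiv_def .
  qed
  have "\<exists>t>0. t < 1 \<and> ?\<psi> 1 - ?\<psi> 0 = (1 - 0) * (v \<bullet> g (?c t) - g x \<bullet> v - t * (v \<bullet> A x v))"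
  proof (rule MVT2)
    fix t :: real assume t: "0 \<le> t" "t \<le> 1"
    show "DERIV ?\<psi> t :> v \<bullet> g (?c t) - g x \<bullet> v - t * (v \<bullet> A x v)"
      unfolding has_field_derivative_def
      by (rule derivative_eq_intros * refl | use t in \<open>force simp: fun_eq_iff algebra_simps\<close>)+
  qed simp
  then obtain t where t: "0 < t" "t < 1"
    and eq: "?\<psi> 1 - ?\<psi> 0 = v \<bullet> g (?c t) - g x \<bullet> v - t * (v \<bullet> A x v)"
    by auto
  have "norm (g (?c t) - g x - A x (?c t - x)) \<le> M * (norm (?c t - x))\<^sup>2"
    by (rule gradient_linearization[of a \<epsilon> g A M, OF g A M]) (use seg t x in auto)
  also have "A x (?c t - x) = t *\<^sub>R A x v"
    by (simp add: linear_cmul[OF lin])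
  also have "M * (norm (?c t - x))\<^sup>2 \<le> M * (norm v)\<^sup>2"
    using t M by (intro mult_left_mono power_mono) (auto intro: mult_left_le_one_le)
  finally have "v \<bullet> (g (?c t) - g x - t *\<^sub>R A x v) \<le> norm v * (M * (norm v)\<^sup>2)"
    by (meson norm_cauchy_schwarz norm_ge_zero mult_left_mono order_trans)
  then show ?thesis
    using eq by (simp add: inner_diff_right inner_commute power2_eq_square power3_eq_cube mult_ac)
qed

text \<open>The square root lies below its tangents; unlike a Hessian bound this holds even where the
  segment passes close to the origin.\<close>

lemma norm_add_le_tangent:
  fixes a v :: "'a::real_inner"
  assumes "a \<noteq> 0"
  shows "norm (a + v) \<le> norm a + sgn a \<bullet> v + (norm v)\<^sup>2 / (2 * norm a)"
proof -
  let ?b = "norm a + sgn a \<bullet> v + (norm v)\<^sup>2 / (2 * norm a)"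
  have sq: "(norm (a + v))\<^sup>2 = (norm a)\<^sup>2 + 2 * (a \<bullet> v) + (norm v)\<^sup>2"
    by (simp add: power2_norm_eq_inner inner_simps inner_commute)
  have b: "2 * norm a * ?b = (norm a)\<^sup>2 + (norm (a + v))\<^sup>2"
    using assms unfolding sq by (simp add: sgn_div_norm field_simps power2_eq_square)
  have "2 * norm a * norm (a + v) \<le> 2 * norm a * ?b"
    unfolding b by (rule sum_squares_bound)
  then show ?thesis
    using assms by (simp add: mult_le_cancel_left)
qed

text \<open>Product rule for \<open>inverse (norm y) *\<^sub>R y\<close>. The result is the
  orthogonal projection onto the complement of the line of \<open>y\<close>, divided by
  \<open>norm y\<close>: the second derivative of the norm.\<close>

lemma has_derivative_sgn:
  fixes y :: "'a::real_inner"
  assumes "y \<noteq> 0"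
  shows "(sgn has_derivative (\<lambda>h. (h - (sgn y \<bullet> h) *\<^sub>R sgn y) /\<^sub>R norm y)) (at y)"
proof -
  have "((\<lambda>y. inverse (norm y) *\<^sub>R y) has_derivative
      (\<lambda>h. inverse (norm y) *\<^sub>R h + - (inverse (norm y) * (h \<bullet> sgn y) * inverse (norm y)) *\<^sub>R y)) (at y)"
    by (rule has_derivative_scaleR[OF Deriv.has_derivative_inverse[OF _ has_derivative_norm] has_derivative_ident])
       (use assms in auto)
  then show ?thesis
    unfolding sgn_div_norm
    by (rule has_derivative_eq_rhs) (auto simp: fun_eq_iff algebra_simps inner_commute)
qed

lemma norm_sgn_diff_le:
  fixes y z :: "'a::real_inner"
  assumes "y \<noteq> 0" "z \<noteq> 0"
  shows "norm (sgn y - sgn z) \<le> 2 * norm (y - z) / norm y"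
proof -
  \<comment> \<open>Scaling the difference by the length of \<open>y\<close> alone leaves only
    \<open>norm y\<close> in the denominator.\<close>
  have "norm y *\<^sub>R (sgn y - sgn z) = (y - z) + (norm z - norm y) *\<^sub>R sgn z"
    using assms by (simp add: sgn_div_norm algebra_simps)
  also have "norm \<dots> \<le> norm (y - z) + \<bar>norm z - norm y\<bar> * norm (sgn z)"
    by (metis norm_scaleR norm_triangle_ineq)
  also have "\<dots> \<le> 2 * norm (y - z)"
    using norm_triangle_ineq3[of z y] assms by (simp add: norm_sgn norm_minus_commute)
  finally have "norm y * norm (sgn y - sgn z) \<le> 2 * norm (y - z)"
    by simp
  then show ?thesis
    using assms by (simp add: field_simps)
qed

text \<open>The map is \<open>u y /\<^sub>R norm y\<close> with \<open>u y\<close> the projected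
  vector. The change of the reciprocal contributes 2, as \<open>norm (u y)\<close> is at most
  \<open>2 * norm v\<close>, and the change of \<open>u\<close> contributes 4; together the factor
  6.\<close>

lemma sgn_derivative_lipschitz:
  fixes y z v :: "'a::real_inner"
  assumes m: "m > 0" and y: "m \<le> norm y" and z: "m \<le> norm z"
  shows "norm ((v - (sgn y \<bullet> v) *\<^sub>R sgn y) /\<^sub>R norm y - (v - (sgn z \<bullet> v) *\<^sub>R sgn z) /\<^sub>R norm z)
    \<le> 6 / m\<^sup>2 * norm (y - z) * norm v"
proof -
  have nz: "y \<noteq> 0" "z \<noteq> 0" using m y z by auto
  define u where "u = (\<lambda>y. v - (sgn y \<bullet> v) *\<^sub>R sgn y)"
  have u: "norm (u y) \<le> 2 * norm v" for y :: 'a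
  proof -
    have "norm ((sgn y \<bullet> v) *\<^sub>R sgn y) \<le> norm (sgn y) * norm v * norm (sgn y)"
      by (simp add: Cauchy_Schwarz_ineq2 mult_right_mono)
    also have "\<dots> \<le> norm v" by (simp add: norm_sgn)
    finally show ?thesis unfolding u_def using norm_triangle_ineq4[of v "(sgn y \<bullet> v) *\<^sub>R sgn y"] by simp
  qed
  have s: "norm (sgn y - sgn z) \<le> 2 * norm (y - z) / m"
    using norm_sgn_diff_le[OF nz] y m by (smt (verit) frac_le norm_ge_zero)
  have "u y - u z = ((sgn z - sgn y) \<bullet> v) *\<^sub>R sgn z - (sgn y \<bullet> v) *\<^sub>R (sgn y - sgn z)"
    unfolding u_def by (simp add: inner_diff_left algebra_simps)
  also have "norm \<dots> \<le> norm (sgn z - sgn y) * norm v * norm (sgn z)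
      + norm (sgn y) * norm v * norm (sgn y - sgn z)"
    by (rule order_trans[OF norm_triangle_ineq4])
       (auto intro!: add_mono mult_right_mono Cauchy_Schwarz_ineq2)
  also have "\<dots> = 2 * (norm (sgn y - sgn z) * norm v)"
    using nz by (simp add: norm_sgn norm_minus_commute)
  also have "\<dots> \<le> 2 * (2 * norm (y - z) / m * norm v)"
    using s by (intro mult_left_mono mult_right_mono) auto
  finally have d: "norm (u y - u z) \<le> 4 / m * norm (y - z) * norm v" by simp
  have i: "\<bar>inverse (norm y) - inverse (norm z)\<bar> \<le> norm (y - z) / m\<^sup>2"
  proof -
    have "\<bar>inverse (norm y) - inverse (norm z)\<bar> = \<bar>norm y - norm z\<bar> / (norm y * norm z)"
      using nz by (simp add: divide_inverse[symmetric] diff_frac_eq abs_divide abs_mult abs_minus_commute inverse_eq_divide)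
    also have "\<dots> \<le> norm (y - z) / m\<^sup>2"
      unfolding power2_eq_square using m y z
      by (intro frac_le mult_mono norm_triangle_ineq3) auto
    finally show ?thesis .
  qed
  have "u y /\<^sub>R norm y - u z /\<^sub>R norm z
      = (inverse (norm y) - inverse (norm z)) *\<^sub>R u y + inverse (norm z) *\<^sub>R (u y - u z)"
    by (simp add: algebra_simps)
  also have "norm \<dots> \<le> norm (y - z) / m\<^sup>2 * (2 * norm v) + inverse m * (4 / m * norm (y - z) * norm v)"
  proof (intro order_trans[OF norm_triangle_ineq] add_mono)
    show "norm ((inverse (norm y) - inverse (norm z)) *\<^sub>R u y) \<le> norm (y - z) / m\<^sup>2 * (2 * norm v)"
      unfolding norm_scaleR by (intro mult_mono i u) auto
    show "norm (inverse (norm z) *\<^sub>R (u y - u z)) \<le> inverse m * (4 / m * norm (y - z) * norm v)"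
      unfolding norm_scaleR using z m by (intro mult_mono d) (auto simp: le_imp_inverse_le)
  qed
  also have "\<dots> = 6 / m\<^sup>2 * norm (y - z) * norm v"
    using m by (simp add: field_simps power2_eq_square)
  finally show ?thesis unfolding u_def .
qed

section \<open>Group soft thresholding\<close>

text \<open>Cancels a factor that may be zero; several norm bounds below are read off from a
  quadratic inequality this way.\<close>

lemma le_if_square_le:
  fixes a b :: real
  assumes "a * a \<le> b * a" "b \<ge> 0"
  shows "a \<le> b"
  using assms by (cases "a \<le> 0") auto

section \<open>Correspondence between sets of groups and sets of coordinates\<close>

locale grouping =
  fixes G :: "'g::finite \<Rightarrow> 'n::finite set"
  assumes groups: "is_grouping G"
begin

lemma group_Int: "G i \<inter> G j = (if i = j then G i else {})"
  using groups unfolding is_grouping_def disjoint_family_on_def by auto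

lemma group_Int_Union: "G i \<inter> (\<Union>j\<in>J. G j) = (if i \<in> J then G i else {})"
proof (cases "i \<in> J")
  case False
  then have "G i \<inter> G j = {}" if "j \<in> J" for j
    using that group_Int[of i j] by auto
  then show ?thesis using False by auto
qed auto

lemma group_nonempty: "G i \<noteq> {}"
  using groups unfolding is_grouping_def by auto

text \<open>Groups are nonempty, so an index set can be recovered from its union of coordinates;
  this lets the coordinate sets of the algorithm be traded for sets of indices.\<close>

lemma group_subset_iff: "G i \<subseteq> (\<Union>j\<in>J. G j) \<longleftrightarrow> i \<in> J"
  using group_Int_Union[of i J] group_nonempty[of i] by (auto split: if_splits)

lemma Union_group_mono: "(\<Union>j\<in>J. G j) \<subseteq> (\<Union>j\<in>K. G j) \<longleftrightarrow> J \<subseteq> K"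
  using group_subset_iff by (metis UN_subset_iff subset_iff)

lemma proj_group_proj_Union:
  "proj (G i) (proj (\<Union>j\<in>J. G j) x) = (if i \<in> J then proj (G i) x else 0)"
  by (simp add: group_Int_Union)

lemma proj_Union: "proj (\<Union>j\<in>J. G j) x = (\<Sum>j\<in>J. proj (G j) x)"
proof -
  have "finite J" by simp
  then show ?thesis
  proof (induction J)
    case (insert i J)
    have "proj (G i \<union> (\<Union>j\<in>J. G j)) x = proj (G i) x + proj (\<Union>j\<in>J. G j) x"
      using group_Int_Union[of i J] insert.hyps by (auto simp: vec_eq_iff)
    then show ?case using insert by simp
  qed simp
qed

lemma UN_groups: "(\<Union>j. G j) = UNIV"
  using groups unfolding is_grouping_def by auto

lemma Compl_Union_groups: "- (\<Union>j\<in>J. G j) = (\<Union>j\<in>- J. G j)"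
proof
  show "- (\<Union>j\<in>J. G j) \<subseteq> (\<Union>j\<in>- J. G j)"
    using UN_groups by blast
  show "(\<Union>j\<in>- J. G j) \<subseteq> - (\<Union>j\<in>J. G j)"
  proof
    fix c assume "c \<in> (\<Union>j\<in>- J. G j)"
    then obtain i where "i \<notin> J" "c \<in> G i" by auto
    then show "c \<in> - (\<Union>j\<in>J. G j)" using group_Int_Union[of i J] by auto
  qed
qed

lemma sum_proj: "(\<Sum>j\<in>UNIV. proj (G j) x) = x"
  using proj_Union[of UNIV x] UN_groups by (simp add: vec_eq_iff)

lemma inner_proj_Union:
  "proj (\<Union>j\<in>J. G j) x \<bullet> y = (\<Sum>j\<in>J. proj (G j) x \<bullet> proj (G j) y)"
  unfolding proj_Union inner_sum_left by (intro sum.cong refl inner_proj_left)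

lemma inner_sum_groups: "x \<bullet> y = (\<Sum>j\<in>UNIV. proj (G j) x \<bullet> proj (G j) y)"
  using inner_proj_Union[of UNIV x y] sum_proj[of x] proj_Union[of UNIV x] by simp

lemma norm_proj_Union_power2:
  "(norm (proj (\<Union>j\<in>J. G j) x))\<^sup>2 = (\<Sum>j\<in>J. (norm (proj (G j) x))\<^sup>2)"
  unfolding power2_norm_eq_inner by (subst inner_proj_left[symmetric]) (rule inner_proj_Union)

lemma vec_eq_group_iff: "x = y \<longleftrightarrow> (\<forall>i. proj (G i) x = proj (G i) y)"
  by (metis (mono_tags, lifting) sum.cong sum_proj)

end

lemma proj_sgn_proj: "proj I (sgn (proj J x)) = (if J \<subseteq> I then sgn (proj J x) else
    inverse (norm (proj J x)) *\<^sub>R proj (I \<inter> J) x)"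
  by (simp add: sgn_div_norm proj_scaleR Int_absorb1)

text \<open>The proximal map of \<open>t * norm\<close>; for vectors this is block soft
  thresholding.\<close>

definition soft :: "real \<Rightarrow> 'a::real_normed_vector \<Rightarrow> 'a" where
  "soft t v = (if norm v \<le> t then 0 else v - t *\<^sub>R sgn v)"

lemma soft_eq_0_iff:
  assumes "t \<ge> 0"
  shows "soft t v = 0 \<longleftrightarrow> norm v \<le> t"
proof (cases "norm v \<le> t")
  case False
  have "t < norm (sgn v) * norm v"
    using False assms by (auto simp: norm_sgn)
  have "v \<noteq> 0"
    using False assms by auto
  then have "v = norm v *\<^sub>R sgn v"
    by (simp add: sgn_div_norm)
  then have "v - t *\<^sub>R sgn v = (norm v - t) *\<^sub>R sgn v"
    by (metis scaleR_left_diff_distrib)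
  then show ?thesis
    using False assms by (auto simp: soft_def sgn_zero_iff)
qed (simp add: soft_def)

text \<open>Subgradient inequality of \<open>t * norm\<close> at \<open>soft t v\<close>. Below the
  threshold it is Cauchy-Schwarz; above it the residual is \<open>t *\<^sub>R sgn v\<close>, which
  is aligned with \<open>soft t v\<close>.\<close>

lemma soft_variational:
  fixes v y :: "'a::real_inner"
  assumes "t \<ge> 0"
  shows "t * norm (soft t v) + (v - soft t v) \<bullet> (y - soft t v) \<le> t * norm y"
proof (cases "norm v \<le> t")
  case True
  have "v \<bullet> y \<le> norm v * norm y" by (rule norm_cauchy_schwarz)
  also have "\<dots> \<le> t * norm y" using True by (intro mult_right_mono) auto
  finally show ?thesis using True by (simp add: soft_def)
next
  case False
  then have v: "v \<noteq> 0" "norm v > t" using assms by auto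
  have eq: "v - t *\<^sub>R sgn v = (norm v - t) *\<^sub>R sgn v"
    using v by (simp add: sgn_div_norm algebra_simps)
  have s: "sgn v \<bullet> sgn v = 1"
    using v by (simp add: norm_sgn flip: power2_norm_eq_inner)
  have n: "norm ((norm v - t) *\<^sub>R sgn v) = norm v - t"
    using v by (simp add: norm_sgn)
  have "sgn v \<bullet> y \<le> norm y"
    using norm_cauchy_schwarz[of "sgn v" y] v by (simp add: norm_sgn)
  then have "t * (sgn v \<bullet> y) \<le> t * norm y"
    using assms by (intro mult_left_mono)
  moreover have "soft t v = (norm v - t) *\<^sub>R sgn v"
    using False eq by (simp add: soft_def)
  moreover have "v - soft t v = t *\<^sub>R sgn v"
    using False by (simp add: soft_def)
  moreover have "sgn v \<bullet> soft t v = norm v - t"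
    unfolding \<open>soft t v = _\<close> inner_scaleR_right s by simp
  moreover have "norm (soft t v) = norm v - t"
    using n \<open>soft t v = _\<close> by simp
  ultimately show ?thesis
    by (simp only: inner_diff_right inner_scaleR_left right_diff_distrib)
qed

lemma proj_soft: "proj I (soft t (proj J x)) = soft t (proj J x)" if "J \<subseteq> I"
  using that by (simp add: soft_def proj_diff proj_scaleR proj_sgn_proj Int_absorb1)

lemma proj_soft_disjoint: "proj I (soft t (proj J x)) = 0" if "I \<inter> J = {}"
  using that by (simp add: soft_def proj_diff proj_scaleR sgn_div_norm)

section \<open>The regularizer and its proximal map\<close>

locale group_regularizer = grouping G for G :: "'g::finite \<Rightarrow> 'n::finite set" +
  fixes lam :: "'g \<Rightarrow> real"
  assumes lam_pos: "lam i > 0"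
begin

abbreviation r :: "real^'n \<Rightarrow> real" where "r \<equiv> group_reg G lam"

text \<open>Plays two roles: a Lipschitz constant of \<open>r\<close>, and a bound on the part of a
  gradient that stems from the regularizer.\<close>

definition lam_sum :: real where "lam_sum = (\<Sum>i\<in>UNIV. lam i)"

lemma lam_sum_pos: "lam_sum > 0"
  unfolding lam_sum_def by (intro sum_pos) (auto simp: lam_pos)

lemma group_reg_lipschitz: "r x - r y \<le> lam_sum * norm (x - y)"
proof -
  have "r x - r y = (\<Sum>i\<in>UNIV. lam i * (norm (proj (G i) x) - norm (proj (G i) y)))"
    unfolding group_reg_def by (simp add: sum_subtractf right_diff_distrib)
  also have "\<dots> \<le> (\<Sum>i\<in>UNIV. lam i * norm (x - y))"
  proof (intro sum_mono mult_left_mono)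
    fix i
    show "norm (proj (G i) x) - norm (proj (G i) y) \<le> norm (x - y)"
      using norm_triangle_ineq2[of "proj (G i) x" "proj (G i) y"] norm_proj_le[of "G i" "x - y"]
      by (simp add: proj_diff)
  qed (use lam_pos less_imp_le in auto)
  finally show ?thesis unfolding lam_sum_def by (simp add: sum_distrib_right)
qed

lemma group_reg_convex:
  assumes "0 \<le> t" "t \<le> 1"
  shows "r ((1 - t) *\<^sub>R x + t *\<^sub>R y) \<le> (1 - t) * r x + t * r y"
proof -
  have "r ((1 - t) *\<^sub>R x + t *\<^sub>R y)
      \<le> (\<Sum>i\<in>UNIV. lam i * ((1 - t) * norm (proj (G i) x) + t * norm (proj (G i) y)))"
    unfolding group_reg_def
  proof (intro sum_mono mult_left_mono)
    fix i
    show "norm (proj (G i) ((1 - t) *\<^sub>R x + t *\<^sub>R y))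
        \<le> (1 - t) * norm (proj (G i) x) + t * norm (proj (G i) y)"
      unfolding proj_add proj_scaleR using assms
      by (intro order_trans[OF norm_triangle_ineq]) simp
  qed (use lam_pos less_imp_le in auto)
  also have "\<dots> = (1 - t) * r x + t * r y"
    unfolding group_reg_def sum_distrib_left sum.distrib[symmetric]
    by (intro sum.cong refl) (simp add: algebra_simps)
  finally show ?thesis .
qed

lemma group_reg_add_proj_Union:
  "r (x + proj (\<Union>j\<in>J. G j) v) - r x
    = (\<Sum>j\<in>J. lam j * (norm (proj (G j) (x + v)) - norm (proj (G j) x)))"
proof -
  have "r (x + proj (\<Union>j\<in>J. G j) v) - r x
      = (\<Sum>j\<in>UNIV. if j \<in> J then lam j * (norm (proj (G j) (x + v)) - norm (proj (G j) x)) else 0)"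
    unfolding group_reg_def sum_subtractf[symmetric]
    by (intro sum.cong refl) (simp add: proj_add proj_group_proj_Union right_diff_distrib del: proj_proj)
  then show ?thesis by (simp add: sum.If_cases)
qed

definition prox :: "real \<Rightarrow> real^'n \<Rightarrow> real^'n" where
  "prox \<alpha> z = (\<Sum>i\<in>UNIV. soft (\<alpha> * lam i) (proj (G i) z))"

lemma proj_prox: "proj (G i) (prox \<alpha> z) = soft (\<alpha> * lam i) (proj (G i) z)"
proof -
  have "proj (G i) (prox \<alpha> z)
      = (\<Sum>j\<in>UNIV. if j = i then soft (\<alpha> * lam i) (proj (G i) z) else 0)"
    unfolding prox_def linear_sum[OF bounded_linear.linear[OF bounded_linear_proj]]
    by (intro sum.cong refl) (simp add: proj_soft proj_soft_disjoint group_Int)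
  then show ?thesis by simp
qed

text \<open>Kept group by group, because an iteration moves only some of the groups;
  \<open>prox_variational_sum\<close> adds them up.\<close>

lemma prox_variational:
  assumes "\<alpha> > 0"
  shows "\<alpha> * lam i * norm (proj (G i) (prox \<alpha> z))
      + proj (G i) (z - prox \<alpha> z) \<bullet> proj (G i) (y - prox \<alpha> z)
    \<le> \<alpha> * lam i * norm (proj (G i) y)"
  using soft_variational[of "\<alpha> * lam i" "proj (G i) z" "proj (G i) y"] assms lam_pos[of i]
  by (simp add: proj_diff proj_prox)

lemma prox_variational_sum:
  assumes "\<alpha> > 0"
  shows "\<alpha> * r (prox \<alpha> z) + (z - prox \<alpha> z) \<bullet> (y - prox \<alpha> z) \<le> \<alpha> * r y"
proof -
  have "(\<Sum>i\<in>UNIV. \<alpha> * lam i * norm (proj (G i) (prox \<alpha> z))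
      + proj (G i) (z - prox \<alpha> z) \<bullet> proj (G i) (y - prox \<alpha> z))
    \<le> (\<Sum>i\<in>UNIV. \<alpha> * lam i * norm (proj (G i) y))"
    by (intro sum_mono prox_variational assms)
  then show ?thesis
    unfolding group_reg_def inner_sum_groups[of "z - prox \<alpha> z"]
    by (simp add: sum.distrib sum_distrib_left mult.assoc)
qed

text \<open>\<open>arg_min\<close> is a choice operator, so its value is known only after
  uniqueness. The variational inequality gives minimality and uniqueness together: the objective
  exceeds its value at \<open>prox \<alpha> z\<close> by at least \<open>1 / (2 * \<alpha>)\<close>
  times the squared distance.\<close>

lemma arg_min_prox:
  assumes "\<alpha> > 0"
  shows "arg_min (\<lambda>y. 1 / (2 * \<alpha>) * (norm (y - z))\<^sup>2 + r y) (\<lambda>_. True) = prox \<alpha> z"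
proof -
  let ?p = "prox \<alpha> z" and ?h = "\<lambda>y. 1 / (2 * \<alpha>) * (norm (y - z))\<^sup>2 + r y"
  have h: "?h ?p + 1 / (2 * \<alpha>) * (norm (y - ?p))\<^sup>2 \<le> ?h y" for y
  proof -
    have "(norm (y - z))\<^sup>2 = (norm (y - ?p))\<^sup>2 + (norm (?p - z))\<^sup>2 - 2 * ((z - ?p) \<bullet> (y - ?p))"
      unfolding power2_norm_eq_inner by (simp add: inner_simps inner_commute)
    then have eq: "?h y = 1 / (2 * \<alpha>) * (norm (y - ?p))\<^sup>2 + 1 / (2 * \<alpha>) * (norm (?p - z))\<^sup>2
        + (r y - (z - ?p) \<bullet> (y - ?p) / \<alpha>)"
      using assms by (simp add: diff_divide_distrib add_divide_distrib)
    have "r ?p \<le> r y - (z - ?p) \<bullet> (y - ?p) / \<alpha>"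
      using prox_variational_sum[OF assms, of z y] assms by (simp add: field_simps)
    then show ?thesis unfolding eq by simp
  qed
  have min: "?h ?p \<le> ?h y" for y
    using h[of y] assms by (smt (verit) divide_nonneg_pos mult_nonneg_nonneg zero_le_power2)
  have uniq: "y = ?p" if "is_arg_min ?h (\<lambda>_. True) y" for y
  proof -
    have "?h y \<le> ?h ?p" using that unfolding is_arg_min_linorder by blast
    then have "1 / (2 * \<alpha>) * (norm (y - ?p))\<^sup>2 \<le> 0" using h[of y] by linarith
    then show ?thesis using assms by (simp add: mult_le_0_iff divide_le_0_iff)
  qed
  have "is_arg_min ?h (\<lambda>_. True) ?p"
    using min unfolding is_arg_min_def by (auto simp: not_less)
  then show ?thesis
    unfolding arg_min_def using uniq by (rule some_equality)
qed

end

section \<open>The composite objective\<close>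

locale composite_problem = group_regularizer G lam
  for G :: "'g::finite \<Rightarrow> 'n::finite set" and lam :: "'g \<Rightarrow> real" +
  fixes f :: "real^'n \<Rightarrow> real"
  assumes f_diff: "f differentiable (at z)"
    and f_twice_diff: "grad f differentiable (at z)"
    and f_C2: "continuous_on UNIV (hess f)"
    and f_strongly_convex: "strongly_convex f"
begin

definition F :: "real^'n \<Rightarrow> real" where "F = (\<lambda>z. f z + r z)"

lemma GDERIV_f: "GDERIV f z :> grad f z"
  by (rule GDERIV_grad[OF f_diff])

lemma has_derivative_grad_f: "(grad f has_derivative (\<lambda>h. hess f z *v h)) (at z)"
  using f_twice_diff[of z] unfolding jacobian_works hess_def .

lemma continuous_grad_f: "continuous_on UNIV (grad f)"
  using has_derivative_continuous[OF has_derivative_grad_f] by (simp add: continuous_at_imp_continuous_on)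

text \<open>Convexity bounds the difference quotients on (0, 1) by \<open>f y - f x\<close>, so the
  limit from the right suffices.\<close>

lemma f_convex_tangent: "f x + grad f x \<bullet> (y - x) \<le> f y"
proof -
  obtain m where m: "m > 0" "\<And>x y t. t \<in> {0..1} \<Longrightarrow>
     f ((1 - t) *\<^sub>R x + t *\<^sub>R y)
       \<le> (1 - t) * f x + t * f y - m / 2 * t * (1 - t) * (norm (x - y))\<^sup>2"
    using f_strongly_convex unfolding strongly_convex_def by blast
  let ?c = "\<lambda>t::real. x + t *\<^sub>R (y - x)"
  have "((\<lambda>t. f (?c t)) has_derivative (\<lambda>h. (h *\<^sub>R (y - x)) \<bullet> grad f (?c 0))) (at 0)"
  proof (rule has_derivative_compose[of ?c "\<lambda>h. h *\<^sub>R (y - x)", where g = f and g' = "\<lambda>h. h \<bullet> grad f (?c 0)"])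
    show "(?c has_derivative (\<lambda>h. h *\<^sub>R (y - x))) (at 0)"
      by (auto intro!: derivative_eq_intros)
    show "(f has_derivative (\<lambda>h. h \<bullet> grad f (?c 0))) (at (?c 0))"
      using GDERIV_f[of "?c 0"] unfolding gderiv_def .
  qed
  then have "DERIV (\<lambda>t. f (?c t)) 0 :> grad f x \<bullet> (y - x)"
    unfolding has_field_derivative_def
    by (rule has_derivative_eq_rhs) (auto simp: fun_eq_iff inner_commute)
  then have "((\<lambda>t. (f (?c t) - f x) / t) \<longlongrightarrow> grad f x \<bullet> (y - x)) (at 0)"
    by (simp add: DERIV_def)
  then have lim: "((\<lambda>t. (f (?c t) - f x) / t) \<longlongrightarrow> grad f x \<bullet> (y - x)) (at_right 0)"
    by (rule filterlim_mono[OF _ order_refl at_le]) simp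
  have "grad f x \<bullet> (y - x) \<le> f y - f x"
  proof (rule tendsto_upperbound[OF lim])
    show "\<forall>\<^sub>F t in at_right 0. (f (?c t) - f x) / t \<le> f y - f x"
      unfolding eventually_at_right_field
    proof (intro exI[of _ 1] conjI allI impI)
      fix t :: real assume t: "0 < t" "t < 1"
      have "?c t = (1 - t) *\<^sub>R x + t *\<^sub>R y" by (simp add: algebra_simps)
      then have "f (?c t) \<le> (1 - t) * f x + t * f y - m / 2 * t * (1 - t) * (norm (x - y))\<^sup>2"
        using m(2)[of t x y] t unfolding \<open>?c t = _\<close> by simp
      moreover have "0 \<le> m / 2 * t * (1 - t) * (norm (x - y))\<^sup>2"
        using m(1) t by simp
      ultimately have "f (?c t) \<le> (1 - t) * f x + t * f y"
        by linarith
      then have "f (?c t) - f x \<le> t * (f y - f x)"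
        by (simp add: left_diff_distrib right_diff_distrib)
      then show "(f (?c t) - f x) / t \<le> f y - f x" using t by (simp add: field_simps)
    qed simp
  qed simp
  then show ?thesis by simp
qed

text \<open>The midpoint of \<open>a\<close> and \<open>x\<close> cannot have a smaller value than
  \<open>a\<close>, while strong convexity puts its value below the average by \<open>m / 8\<close>
  times the squared distance; doubling gives \<open>m / 4\<close>.\<close>

lemma F_quadratic_growth:
  obtains m where "m > 0"
    "\<And>a x. is_arg_min F (\<lambda>_. True) a \<Longrightarrow> F a + m * (norm (x - a))\<^sup>2 \<le> F x"
proof -
  obtain m where m: "m > 0" "\<And>x y t. t \<in> {0..1} \<Longrightarrow>
     f ((1 - t) *\<^sub>R x + t *\<^sub>R y)
       \<le> (1 - t) * f x + t * f y - m / 2 * t * (1 - t) * (norm (x - y))\<^sup>2"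
    using f_strongly_convex unfolding strongly_convex_def by blast
  show thesis
  proof (rule that[of "m / 4"])
    fix a x assume a: "is_arg_min F (\<lambda>_. True) a"
    have "F a \<le> F ((1 - 1/2) *\<^sub>R a + (1/2) *\<^sub>R x)"
      using a unfolding is_arg_min_def by (auto simp: not_less)
    also have "\<dots> \<le> (1/2) * F a + (1/2) * F x - m / 8 * (norm (a - x))\<^sup>2"
      using m(2)[of "1/2" a x] group_reg_convex[of "1/2" a x] unfolding F_def
      by (simp add: add_divide_distrib)
    finally show "F a + m / 4 * (norm (x - a))\<^sup>2 \<le> F x" by (simp add: norm_minus_commute)
  qed (use m in auto)
qed

section \<open>The proximal gradient step\<close>

abbreviation step :: "real^'n \<Rightarrow> real \<Rightarrow> real^'n" where
  "step x \<alpha> \<equiv> pg_step f r x \<alpha>"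

lemma add_step: "\<alpha> > 0 \<Longrightarrow> x + step x \<alpha> = prox \<alpha> (x - \<alpha> *\<^sub>R grad f x)"
  using arg_min_prox[of \<alpha> "x - \<alpha> *\<^sub>R grad f x"] unfolding pg_step_def pg_update_def by simp

lemma proj_add_step_eq_0_iff:
  assumes "\<alpha> > 0"
  shows "proj (G i) (x + step x \<alpha>) = 0 \<longleftrightarrow> norm (proj (G i) (x - \<alpha> *\<^sub>R grad f x)) \<le> \<alpha> * lam i"
  using assms lam_pos[of i] by (simp add: add_step proj_prox soft_eq_0_iff)

text \<open>The variational inequality of the proximal map, tested at \<open>x\<close> itself. It
  gives the full \<open>1 / \<alpha>\<close>; comparing objective values would give only half of it,
  too little for the PG test when \<open>eta C\<close> is not below 1/2.\<close>

lemma step_variational: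
  assumes "\<alpha> > 0"
  shows "lam i * norm (proj (G i) (x + step x \<alpha>)) + (norm (proj (G i) (step x \<alpha>)))\<^sup>2 / \<alpha>
      + proj (G i) (grad f x) \<bullet> proj (G i) (step x \<alpha>)
    \<le> lam i * norm (proj (G i) x)"
proof -
  let ?s = "step x \<alpha>"
  have "\<alpha> * lam i * norm (proj (G i) (x + ?s))
      + proj (G i) (x - \<alpha> *\<^sub>R grad f x - (x + ?s)) \<bullet> proj (G i) (x - (x + ?s))
    \<le> \<alpha> * lam i * norm (proj (G i) x)"
    using prox_variational[OF assms, of i "x - \<alpha> *\<^sub>R grad f x" x] unfolding add_step[OF assms] .
  then have "\<alpha> * lam i * norm (proj (G i) (x + ?s)) + (norm (proj (G i) ?s))\<^sup>2
      + \<alpha> * (proj (G i) (grad f x) \<bullet> proj (G i) ?s) \<le> \<alpha> * lam i * norm (proj (G i) x)"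
    by (simp add: proj_diff proj_add proj_minus proj_scaleR inner_simps power2_norm_eq_inner)
  then have "\<alpha> * (lam i * norm (proj (G i) (x + ?s)) + (norm (proj (G i) ?s))\<^sup>2 / \<alpha>
      + proj (G i) (grad f x) \<bullet> proj (G i) ?s) \<le> \<alpha> * (lam i * norm (proj (G i) x))"
    using assms by (simp add: algebra_simps)
  then show ?thesis using assms by simp
qed

text \<open>The inequality of a single group is separable, so it can be summed over any chosen set
  of groups.\<close>

lemma group_reg_step_le:
  assumes "\<alpha> > 0" and I: "I = (\<Union>j\<in>J. G j)"
  shows "r (x + proj I (step x \<alpha>)) \<le> r x - (norm (proj I (step x \<alpha>)))\<^sup>2 / \<alpha>
    - grad f x \<bullet> proj I (step x \<alpha>)"
proof -
  let ?s = "step x \<alpha>"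
  have "(\<Sum>j\<in>J. lam j * (norm (proj (G j) (x + ?s)) - norm (proj (G j) x))) \<le>
      (\<Sum>j\<in>J. - ((norm (proj (G j) ?s))\<^sup>2 / \<alpha>) - proj (G j) ?s \<bullet> proj (G j) (grad f x))"
    using step_variational[OF assms(1), of _ x]
    by (intro sum_mono) (simp add: right_diff_distrib inner_commute algebra_simps)
  also have "\<dots> = - ((norm (proj I ?s))\<^sup>2 / \<alpha>) - proj I ?s \<bullet> grad f x"
    unfolding I norm_proj_Union_power2 inner_proj_Union
    by (simp add: sum_subtractf sum_negf sum_divide_distrib)
  finally show ?thesis
    using group_reg_add_proj_Union[of x J ?s] by (simp add: I inner_commute)
qed

lemma norm_step_le:
  assumes "\<alpha> > 0"
  shows "norm (step x \<alpha>) \<le> \<alpha> * (lam_sum + norm (grad f x))"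
proof -
  let ?s = "step x \<alpha>"
  have "proj UNIV ?s = ?s" by (simp add: vec_eq_iff)
  then have "(norm ?s)\<^sup>2 / \<alpha> \<le> r x - r (x + ?s) - grad f x \<bullet> ?s"
    using group_reg_step_le[OF assms UN_groups[symmetric], of x] by simp
  also have "\<dots> \<le> lam_sum * norm ?s + norm (grad f x) * norm ?s"
    using group_reg_lipschitz[of x "x + ?s"] norm_cauchy_schwarz[of "- grad f x" ?s] by simp
  also have "\<dots> = (lam_sum + norm (grad f x)) * norm ?s"
    by (rule distrib_right[symmetric])
  finally have "norm ?s * norm ?s \<le> (\<alpha> * (lam_sum + norm (grad f x))) * norm ?s"
    unfolding pos_divide_le_eq[OF assms] power2_eq_square by (simp only: mult_ac)
  then show ?thesis
    by (rule le_if_square_le) (use assms lam_sum_pos in auto)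
qed

text \<open>Tests the variational inequality at \<open>y\<close> and adds the tangent inequality of
  \<open>f\<close>; every error term then carries the factor \<open>norm (step x \<alpha>)\<close>.
  As long as the bracket stays bounded, a small step certifies near-optimality.\<close>

lemma F_gap_le_step:
  assumes "\<alpha> > 0"
  shows "F x - F y \<le> norm (step x \<alpha>) * (lam_sum + norm (x + step x \<alpha> - y) / \<alpha> + norm (grad f x))"
proof -
  let ?s = "step x \<alpha>"
  let ?w = "y - (x + ?s)"
  have "\<alpha> * r (x + ?s) + (x - \<alpha> *\<^sub>R grad f x - (x + ?s)) \<bullet> ?w \<le> \<alpha> * r y"
    using prox_variational_sum[OF assms, of "x - \<alpha> *\<^sub>R grad f x" y] unfolding add_step[OF assms] .
  moreover have "x - \<alpha> *\<^sub>R grad f x - (x + ?s) = - (\<alpha> *\<^sub>R grad f x) - ?s"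
    by simp
  ultimately have "\<alpha> * r (x + ?s) - \<alpha> * (grad f x \<bullet> ?w) - ?s \<bullet> ?w \<le> \<alpha> * r y"
    by (simp add: inner_diff_left del: add_diff_cancel_left diff_diff_eq2)
  moreover have "\<alpha> * (r (x + ?s) - grad f x \<bullet> ?w - (?s \<bullet> ?w) / \<alpha>)
      = \<alpha> * r (x + ?s) - \<alpha> * (grad f x \<bullet> ?w) - ?s \<bullet> ?w"
    using assms by (simp add: right_diff_distrib)
  ultimately have "\<alpha> * (r (x + ?s) - grad f x \<bullet> ?w - (?s \<bullet> ?w) / \<alpha>) \<le> \<alpha> * r y"
    by simp
  then have "r (x + ?s) - grad f x \<bullet> ?w - (?s \<bullet> ?w) / \<alpha> \<le> r y"
    using assms by simp
  moreover have "grad f x \<bullet> ?w = grad f x \<bullet> (y - x) - grad f x \<bullet> ?s"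
    by (simp add: inner_diff_right inner_add_right)
  moreover have "r x - r (x + ?s) \<le> lam_sum * norm ?s"
    using group_reg_lipschitz[of x "x + ?s"] by simp
  moreover have "- (grad f x \<bullet> ?s) \<le> norm (grad f x) * norm ?s"
    using norm_cauchy_schwarz[of "- grad f x" ?s] by simp
  moreover have "(?s \<bullet> ?w) / \<alpha> \<le> norm ?s * norm (x + ?s - y) / \<alpha>"
    using norm_cauchy_schwarz[of ?s ?w] assms
    by (intro divide_right_mono) (auto simp: norm_minus_commute)
  moreover note f_convex_tangent[of x y]
  ultimately have "F x - F y \<le> lam_sum * norm ?s + norm ?s * norm (x + ?s - y) / \<alpha> + norm (grad f x) * norm ?s"
    unfolding F_def by linarith
  then show ?thesis by (simp add: algebra_simps)
qed

text \<open>The partial gradient of \<open>F\<close> over the groups in \<open>J\<close> wherever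
  these are nonzero. The formula is total, with \<open>sgn 0 = 0\<close>, so it can be manipulated
  without a differentiability proof, unlike \<open>grad_on\<close>.\<close>

definition gradF :: "'g set \<Rightarrow> real^'n \<Rightarrow> real^'n" where
  "gradF J y = proj (\<Union>j\<in>J. G j) (grad f y) + (\<Sum>j\<in>J. lam j *\<^sub>R sgn (proj (G j) y))"

text \<open>Groups outside \<open>J\<close> are frozen at \<open>w\<close> and contribute constants,
  so they may vanish. With \<open>w\<close> the current point this yields \<open>grad_on\<close>;
  with \<open>w = 0\<close> it is the restriction to the subspace of \<open>J\<close>.\<close>

lemma GDERIV_F_on:
  assumes nz: "\<And>j. j \<in> J \<Longrightarrow> proj (G j) y \<noteq> 0"
    and I: "I = (\<Union>j\<in>J. G j)"
  shows "GDERIV (\<lambda>y. F (proj (- I) w + proj I y)) y :> gradF J (proj (- I) w + proj I y)"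
proof -
  let ?c = "\<lambda>y. proj (- I) w + proj I y"
  have Gc: "proj (G j) (?c y) = (if j \<in> J then proj (G j) y else proj (G j) w)" for j y
  proof (cases "j \<in> J")
    case True
    then have "G j \<inter> I = G j" "G j \<inter> - I = {}"
      using group_Int_Union[of j J] I by auto
    then show ?thesis using True by (simp add: proj_add)
  next
    case False
    then have "G j \<inter> I = {}" "G j \<inter> - I = G j"
      using group_Int_Union[of j J] I by auto
    then show ?thesis using False by (simp add: proj_add)
  qed
  note proj_der = bounded_linear_imp_has_derivative[OF bounded_linear_proj]
  have c: "(?c has_derivative proj I) (at y)"
    using has_derivative_add[OF has_derivative_const proj_der] by simp
  have "((\<lambda>y. f (?c y)) has_derivative (\<lambda>h. proj I h \<bullet> grad f (?c y))) (at y)"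
    by (rule has_derivative_compose[OF c GDERIV_f[unfolded gderiv_def]])
  moreover have "((\<lambda>y. lam j * norm (proj (G j) (?c y))) has_derivative
      (\<lambda>h. if j \<in> J then lam j * (h \<bullet> sgn (proj (G j) y)) else 0)) (at y)" for j
  proof (cases "j \<in> J")
    case True
    have "((\<lambda>y. norm (proj (G j) y)) has_derivative (\<lambda>h. proj (G j) h \<bullet> sgn (proj (G j) y))) (at y)"
      by (rule has_derivative_compose[where f = "proj (G j)" and f' = "proj (G j)" and g = norm,
            OF proj_der has_derivative_norm[OF nz[OF True]]])
    moreover have "proj (G j) h \<bullet> sgn (proj (G j) y) = h \<bullet> sgn (proj (G j) y)" for h
      unfolding inner_proj_swap[of _ h] proj_sgn_proj[of "G j" "G j"] by simp
    ultimately have "((\<lambda>y. norm (proj (G j) y)) has_derivative (\<lambda>h. h \<bullet> sgn (proj (G j) y))) (at y)"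
      by simp
    then have "((\<lambda>y. lam j * norm (proj (G j) y)) has_derivative (\<lambda>h. lam j * (h \<bullet> sgn (proj (G j) y)))) (at y)"
      by (rule has_derivative_mult_right)
    then show ?thesis unfolding Gc using True by simp
  qed (auto simp: Gc)
  then have "((\<lambda>y. r (?c y)) has_derivative
      (\<lambda>h. \<Sum>j\<in>UNIV. if j \<in> J then lam j * (h \<bullet> sgn (proj (G j) y)) else 0)) (at y)"
    unfolding group_reg_def by (intro has_derivative_sum)
  ultimately have "((\<lambda>y. F (?c y)) has_derivative (\<lambda>h. proj I h \<bullet> grad f (?c y) +
      (\<Sum>j\<in>UNIV. if j \<in> J then lam j * (h \<bullet> sgn (proj (G j) y)) else 0))) (at y)"
    unfolding F_def by (rule has_derivative_add)
  then show ?thesis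
    unfolding gderiv_def
  proof (rule has_derivative_eq_rhs)
    show "(\<lambda>h. proj I h \<bullet> grad f (?c y) + (\<Sum>j\<in>UNIV. if j \<in> J then lam j * (h \<bullet> sgn (proj (G j) y)) else 0))
      = (\<lambda>h. h \<bullet> gradF J (?c y))"
      unfolding gradF_def I[symmetric] inner_add_right inner_sum_right inner_proj_swap
      by (auto simp: sum.If_cases Gc simp del: proj_proj intro!: ext sum.cong)
  qed
qed

lemma grad_on_F:
  assumes "\<And>j. j \<in> J \<Longrightarrow> proj (G j) x \<noteq> 0" and I: "I = (\<Union>j\<in>J. G j)"
  shows "grad_on I F x = gradF J x"
  using grad_unique[OF GDERIV_F_on[OF assms(1) I, where w = x]] by (simp add: grad_on_def proj_decomp)

lemma proj_gradF:
  assumes "K \<subseteq> J"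
  shows "proj (\<Union>j\<in>K. G j) (gradF J x) = gradF K x"
proof -
  have "proj (\<Union>j\<in>K. G j) (sgn (proj (G j) x)) = (if j \<in> K then sgn (proj (G j) x) else 0)" for j
  proof (cases "j \<in> K")
    case True
    then show ?thesis using group_subset_iff[of j K] by (simp add: proj_sgn_proj)
  next
    case False
    then have "(\<Union>j\<in>K. G j) \<inter> G j = {}"
      using group_Int_Union[of j K] by (simp add: Int_commute)
    then show ?thesis
      using False by (simp add: sgn_div_norm proj_scaleR)
  qed
  moreover have "(\<Union>j\<in>K. G j) \<inter> (\<Union>j\<in>J. G j) = (\<Union>j\<in>K. G j)" using assms by blast
  ultimately have "proj (\<Union>j\<in>K. G j) (gradF J x)
     = proj (\<Union>j\<in>K. G j) (grad f x) + (\<Sum>j\<in>J. if j \<in> K then lam j *\<^sub>R sgn (proj (G j) x) else 0)"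
    unfolding gradF_def proj_add linear_sum[OF bounded_linear.linear[OF bounded_linear_proj]]
    by (auto simp: proj_scaleR intro!: sum.cong)
  moreover have "J \<inter> K = K" using assms by blast
  ultimately show ?thesis unfolding gradF_def by (simp add: sum.If_cases)
qed

lemma norm_gradF_mono: "K \<subseteq> J \<Longrightarrow> norm (gradF K x) \<le> norm (gradF J x)"
  by (metis norm_proj_le proj_gradF)

lemma norm_gradF_le: "norm (gradF J x) \<le> norm (grad f x) + lam_sum"
proof -
  have "norm (\<Sum>j\<in>J. lam j *\<^sub>R sgn (proj (G j) x)) \<le> (\<Sum>j\<in>J. lam j)"
    using lam_pos by (intro sum_norm_le) (auto simp: norm_sgn less_imp_le)
  also have "\<dots> \<le> lam_sum"
    unfolding lam_sum_def using lam_pos by (intro sum_mono2) (auto simp: less_imp_le)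
  finally show ?thesis
    unfolding gradF_def
    using norm_triangle_ineq[of "proj (\<Union>j\<in>J. G j) (grad f x)" "\<Sum>j\<in>J. lam j *\<^sub>R sgn (proj (G j) x)"]
      norm_proj_le[of "\<Union>j\<in>J. G j" "grad f x"]
    by linarith
qed

lemma inner_gradF:
  assumes "v = proj (\<Union>j\<in>J. G j) v"
  shows "gradF J x \<bullet> v = grad f x \<bullet> v + (\<Sum>j\<in>J. lam j * (sgn (proj (G j) x) \<bullet> proj (G j) v))"
proof -
  have "sgn (proj (G j) x) \<bullet> v = sgn (proj (G j) x) \<bullet> proj (G j) v" for j
    by (metis inner_proj_swap proj_sgn_proj subset_refl)
  then show ?thesis
    unfolding gradF_def inner_add_left inner_sum_left
    by (simp add: inner_proj_swap assms[symmetric])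
qed

text \<open>By convexity of the norm the directional derivative of \<open>F\<close> along the step
  is at most the change of \<open>r\<close> plus the linear change of \<open>f\<close>, hence at
  most minus the squared length over \<alpha>; Cauchy-Schwarz does the rest. It turns a large CG
  step measure into a large gradient.\<close>

lemma norm_proj_step_le_gradF:
  assumes "\<alpha> > 0" and nz: "\<And>j. j \<in> J \<Longrightarrow> proj (G j) x \<noteq> 0" and I: "I = (\<Union>j\<in>J. G j)"
  shows "norm (proj I (step x \<alpha>)) \<le> \<alpha> * norm (gradF J x)"
proof -
  let ?s = "proj I (step x \<alpha>)"
  have idem: "?s = proj (\<Union>j\<in>J. G j) ?s" using I by simp
  have "lam j * (sgn (proj (G j) x) \<bullet> proj (G j) ?s)
      \<le> lam j * (norm (proj (G j) (x + step x \<alpha>)) - norm (proj (G j) x))"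
    if "j \<in> J" for j
  proof (intro mult_left_mono)
    have "proj (G j) ?s = proj (G j) (step x \<alpha>)"
      unfolding I proj_group_proj_Union if_P[OF that] ..
    moreover have "norm (proj (G j) x) = sgn (proj (G j) x) \<bullet> proj (G j) x"
      using nz[OF that] unfolding sgn_div_norm inner_scaleR_left power2_norm_eq_inner[symmetric]
      by (simp add: power2_eq_square)
    moreover have "sgn (proj (G j) x) \<bullet> proj (G j) (x + step x \<alpha>) \<le> norm (proj (G j) (x + step x \<alpha>))"
      using norm_cauchy_schwarz[of "sgn (proj (G j) x)"] nz[OF that] by (simp add: norm_sgn)
    ultimately show "sgn (proj (G j) x) \<bullet> proj (G j) ?s \<le> norm (proj (G j) (x + step x \<alpha>)) - norm (proj (G j) x)"
      by (simp add: proj_add inner_add_right)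
  qed (simp add: lam_pos less_imp_le)
  then have "gradF J x \<bullet> ?s \<le> grad f x \<bullet> ?s
      + (\<Sum>j\<in>J. lam j * (norm (proj (G j) (x + step x \<alpha>)) - norm (proj (G j) x)))"
    unfolding inner_gradF[OF idem] by (intro add_left_mono sum_mono)
  also have "\<dots> \<le> - ((norm ?s)\<^sup>2 / \<alpha>)"
    using group_reg_step_le[OF assms(1) I, of x] group_reg_add_proj_Union[of x J "step x \<alpha>"]
    by (simp add: I[symmetric])
  finally have "(norm ?s)\<^sup>2 / \<alpha> \<le> norm (gradF J x) * norm ?s"
    using norm_cauchy_schwarz[of "- gradF J x" ?s] by simp
  then have "norm ?s * norm ?s \<le> (\<alpha> * norm (gradF J x)) * norm ?s"
    unfolding pos_divide_le_eq[OF assms(1)] power2_eq_square by (simp only: mult_ac)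
  then show ?thesis
    by (rule le_if_square_le) (use assms in auto)
qed

text \<open>Sums the one-sided bound \<open>norm_add_le_tangent\<close> over the groups. Only the
  groups at \<open>x\<close> must stay away from zero; \<open>v\<close> may have any length.\<close>

lemma group_reg_quadratic_bound:
  assumes x: "\<And>j. j \<in> J \<Longrightarrow> \<delta> \<le> norm (proj (G j) x)" and \<delta>: "\<delta> > 0"
    and v: "v = proj (\<Union>j\<in>J. G j) v"
  shows "r (x + v) \<le> r x + (gradF J x - grad f x) \<bullet> v + lam_sum / (2 * \<delta>) * (norm v)\<^sup>2"
proof -
  have "r (x + v) - r x = (\<Sum>j\<in>J. lam j * (norm (proj (G j) (x + v)) - norm (proj (G j) x)))"
    using group_reg_add_proj_Union[of x J v] v by simp
  also have "\<dots> \<le> (\<Sum>j\<in>J. lam j * (sgn (proj (G j) x) \<bullet> proj (G j) v + (norm v)\<^sup>2 / (2 * \<delta>)))"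
  proof (intro sum_mono mult_left_mono)
    fix j assume j: "j \<in> J"
    have "norm (proj (G j) x + proj (G j) v)
        \<le> norm (proj (G j) x) + sgn (proj (G j) x) \<bullet> proj (G j) v
          + (norm (proj (G j) v))\<^sup>2 / (2 * norm (proj (G j) x))"
      using x[OF j] \<delta> by (intro norm_add_le_tangent) auto
    moreover have "(norm (proj (G j) v))\<^sup>2 / (2 * norm (proj (G j) x)) \<le> (norm v)\<^sup>2 / (2 * \<delta>)"
      using x[OF j] \<delta> by (intro frac_le power_mono norm_proj_le) auto
    ultimately show "norm (proj (G j) (x + v)) - norm (proj (G j) x)
        \<le> sgn (proj (G j) x) \<bullet> proj (G j) v + (norm v)\<^sup>2 / (2 * \<delta>)"
      by (simp add: proj_add)
  qed (simp add: lam_pos less_imp_le)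
  also have "\<dots> = (gradF J x - grad f x) \<bullet> v + (\<Sum>j\<in>J. lam j) * ((norm v)\<^sup>2 / (2 * \<delta>))"
    unfolding inner_diff_left inner_gradF[OF v]
    unfolding distrib_left sum.distrib sum_distrib_right by simp
  also have "(\<Sum>j\<in>J. lam j) * ((norm v)\<^sup>2 / (2 * \<delta>)) \<le> lam_sum * ((norm v)\<^sup>2 / (2 * \<delta>))"
    unfolding lam_sum_def using lam_pos \<delta> by (intro mult_right_mono sum_mono2) (auto simp: less_imp_le)
  finally show ?thesis by simp
qed

end

section \<open>Index sets and searches\<close>

text \<open>Descent comes from the reference direction, whose step length along a nonzero
  \<open>- g\<close> is at least \<open>1 / b\<close>. The length bound comes from the model not
  increasing, which puts the curvature along \<open>d\<close> at or below
  \<open>- 2 * (g \<bullet> d)\<close>.\<close>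

lemma cg_direction_bounds:
  assumes d: "cg_direction C I g H \<mu> d" and g: "proj I g = g"
    and H: "\<And>v. proj I v = v \<Longrightarrow> a * (norm v)\<^sup>2 \<le> v \<bullet> (H *v v) \<and> v \<bullet> (H *v v) \<le> b * (norm v)\<^sup>2"
    and a: "0 < a"
  shows "g \<bullet> d \<le> - (norm g)\<^sup>2 / b" and "norm d \<le> 2 / a * norm g"
proof -
  show "g \<bullet> d \<le> - (norm g)\<^sup>2 / b"
  proof (cases "g = 0")
    case False
    then have n: "0 < (norm g)\<^sup>2" by simp
    have lo: "0 < g \<bullet> (H *v g)"
      using H[OF g] mult_pos_pos[OF a n] by linarith
    have hi: "g \<bullet> (H *v g) \<le> b * (norm g)\<^sup>2"
      using H[OF g] by blast
    then have b: "0 < b"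
      using lo n by (metis less_le_trans zero_less_mult_pos2)
    have "(norm g)\<^sup>2 / b \<le> ((norm g)\<^sup>2 / (g \<bullet> (H *v g))) * (norm g)\<^sup>2"
    proof -
      have "(norm g)\<^sup>2 * (g \<bullet> (H *v g)) \<le> (norm g)\<^sup>2 * (b * (norm g)\<^sup>2)"
        using hi by (intro mult_left_mono) auto
      then show ?thesis
        using lo b by (simp add: divide_simps mult_ac)
    qed
    moreover have "g \<bullet> d \<le> - (((norm g)\<^sup>2 / (g \<bullet> (H *v g))) * (norm g)\<^sup>2)"
      using d by (simp add: cg_direction_def reference_direction_def power2_norm_eq_inner)
    ultimately show ?thesis by simp
  qed (simp)
next
  have "proj I d = d" and "quad_model g H d \<le> quad_model g H 0"
    using d unfolding cg_direction_def by auto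
  then have "a * (norm d)\<^sup>2 \<le> d \<bullet> (H *v d)" "g \<bullet> d + 1 / 2 * (d \<bullet> (H *v d)) \<le> 0"
    using H by (auto simp: quad_model_def)
  moreover have "- (g \<bullet> d) \<le> norm g * norm d"
    using norm_cauchy_schwarz[of "- g" d] by simp
  ultimately have "a * (norm d)\<^sup>2 \<le> 2 * (norm g * norm d)" by linarith
  then have "norm d * norm d \<le> (2 / a * norm g) * norm d"
    using a by (simp add: field_simps power2_eq_square)
  then show "norm d \<le> 2 / a * norm g"
    by (rule le_if_square_le) (use a in auto)
qed

text \<open>In \<open>ereal\<close> the infimum over the empty set is \<infinity>, which the real
  bound excludes; over a nonempty finite set the infimum is attained.\<close>

lemma INF_le_finiteD:
  fixes f :: "'a \<Rightarrow> ereal"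
  assumes "finite A" "(INF i\<in>A. f i) \<le> ereal t"
  obtains i where "i \<in> A" "f i \<le> ereal t"
proof (cases "A = {}")
  case True
  then show thesis using assms by (simp add: top_ereal_def)
next
  case False
  then have "Inf (f ` A) \<in> f ` A"
    using assms(1) by (simp add: Min_Inf[symmetric] del: Min_Inf)
  then show thesis using assms(2) that by auto
qed

text \<open>\<open>LEAST\<close> over the reals is informative only if a least root exists. The
  intermediate value theorem gives a root, \<open>far\<close> puts every nonnegative root beyond
  \<open>T\<close>, and compactness gives a smallest one.\<close>

lemma less_group_tau:
  assumes T: "0 \<le> T"
    and far: "\<And>t. 0 \<le> t \<Longrightarrow> t \<le> T \<Longrightarrow> radius C G F Icg x i < norm (proj (G i) (x + t *\<^sub>R d))"
  shows "ereal T < group_tau C G F Icg x d i"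
proof (cases "\<exists>t\<ge>0. norm (proj (G i) (x + t *\<^sub>R d)) \<le> radius C G F Icg x i")
  case True
  let ?h = "\<lambda>t. norm (proj (G i) (x + t *\<^sub>R d))" and ?\<rho> = "radius C G F Icg x i"
  let ?P = "\<lambda>t. t > 0 \<and> ?h t = ?\<rho>"
  obtain b where b: "b \<ge> 0" "?h b \<le> ?\<rho>" using True by blast
  have cont: "continuous_on UNIV ?h"
    by (intro continuous_on_norm bounded_linear.continuous_on[OF bounded_linear_proj]
        continuous_intros)
  have "\<exists>t\<ge>0. t \<le> b \<and> ?h t = ?\<rho>"
  proof (rule IVT2')
    show "continuous_on {0..b} ?h" by (rule continuous_on_subset[OF cont]) simp
    show "?\<rho> \<le> ?h 0" using far[of 0] T by simp
  qed (use b in auto)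
  moreover have large: "t > T" if "0 \<le> t" "?h t = ?\<rho>" for t
    using far[of t] that by fastforce
  ultimately obtain t0 where t0: "t0 > T" "?h t0 = ?\<rho>" by blast
  \<comment> \<open>Cutting at the root \<open>t0\<close> makes the root set compact; no smaller
    root is lost, since none lies between 0 and \<open>T\<close>.\<close>
  let ?S = "{t \<in> {T..t0}. ?h t = ?\<rho>}"
  have "closed {t. ?h t = ?\<rho>}"
    using continuous_closed_preimage_constant[OF cont closed_UNIV, of ?\<rho>] by simp
  then have "compact ({T..t0} \<inter> {t. ?h t = ?\<rho>})"
    by (intro compact_Int_closed) auto
  moreover have "{T..t0} \<inter> {t. ?h t = ?\<rho>} = ?S" by blast
  ultimately have "compact ?S" by (simp only:)
  moreover have "?S \<noteq> {}" using t0 by auto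
  ultimately obtain t1 where t1: "t1 \<in> ?S" "\<And>t. t \<in> ?S \<Longrightarrow> t1 \<le> t"
    using compact_attains_inf by meson
  have "?P t1" using t1(1) large[of t1] T by auto
  moreover have "t1 \<le> t" if "?P t" for t
  proof (cases "t \<le> t0")
    case True then show ?thesis using that large[of t] t1(2)[of t] by auto
  qed (use t1(1) in auto)
  ultimately have "(LEAST t. ?P t) = t1" by (rule Least_equality)
  moreover have "T < t1" using t1(1) large[of t1] T by auto
  ultimately show ?thesis unfolding group_tau_def if_P[OF True] by simp
next
  case False
  then show ?thesis unfolding group_tau_def if_not_P[OF False] by simp
qed

text \<open>A value shrinks only while it exceeds a fixed threshold, so only finitely many values occur.\<close>

lemma eventually_constant_shrinking:
  fixes \<alpha> :: "nat \<Rightarrow> real"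
  assumes pos: "0 < \<alpha> 0" and \<zeta>: "0 < \<zeta>" "\<zeta> < 1" and c: "c > 0"
    and step: "\<And>k. \<alpha> (Suc k) = \<alpha> k \<or> \<alpha> (Suc k) = \<zeta> * \<alpha> k \<and> \<alpha> k > c"
  obtains K where "\<And>k. k \<ge> K \<Longrightarrow> \<alpha> k = \<alpha> K"
proof -
  obtain n where n: "\<zeta> ^ n < c / \<alpha> 0"
    using real_arch_pow_inv[of "c / \<alpha> 0" \<zeta>] \<zeta> c pos by auto
  \<comment> \<open>The exponent counts the shrinkings. At \<open>m = n\<close> the value is below
    \<open>c\<close>, which forbids another one.\<close>
  have "\<exists>m\<le>n. \<alpha> k = \<alpha> 0 * \<zeta> ^ m" for k
  proof (induction k)
    case (Suc k)
    then obtain m where m: "m \<le> n" "\<alpha> k = \<alpha> 0 * \<zeta> ^ m" by blast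
    show ?case
    proof (cases "\<alpha> (Suc k) = \<alpha> k")
      case False
      then have s: "\<alpha> (Suc k) = \<zeta> * \<alpha> k" "\<alpha> k > c" using step by auto
      have "m \<noteq> n" using s(2) m(2) n pos by (auto simp: field_simps)
      then show ?thesis using s m by (intro exI[of _ "Suc m"]) auto
    qed (use m in auto)
  qed (auto intro!: exI[of _ 0])
  then have "range \<alpha> \<subseteq> (\<lambda>m. \<alpha> 0 * \<zeta> ^ m) ` {..n}" by (fastforce simp: image_iff)
  then have fin: "finite (range \<alpha>)" by (rule finite_subset) simp
  then have "Min (range \<alpha>) \<in> range \<alpha>" by (intro Min_in) auto
  then obtain K where K: "\<alpha> K = Min (range \<alpha>)" by force
  have apos: "\<alpha> k > 0" for k
  proof (induction k)
    case (Suc k) then show ?case using step[of k] \<zeta> by auto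
  qed (use pos in auto)
  have "\<alpha> (Suc k) \<le> \<alpha> k" for k
    using step[of k] \<zeta> apos[of k] by auto
  then have "antimono \<alpha>" by (simp add: decseq_SucI)
  then have "\<alpha> k = \<alpha> K" if "k \<ge> K" for k
    using that fin K by (metis Min_le antimonoD antisym rangeI)
  then show thesis by (rule that)
qed

lemma (in grouping) Union_group_Diff: "(\<Union>i\<in>A. G i) - (\<Union>i\<in>B. G i) = (\<Union>i\<in>A - B. G i)"
proof -
  have "c \<notin> (\<Union>i\<in>B. G i)" if "c \<in> G i" "i \<notin> B" for c i
    using that group_Int_Union[of i B] by auto
  then show ?thesis by blast
qed

section \<open>The algorithm's coordinate sets and thresholds in terms of groups\<close>

context composite_problem
begin

text \<open>Uses \<open>gradF {i}\<close> in place of \<open>grad_on (G i) F\<close>: the two agree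
  wherever the first condition holds.\<close>

definition cg_bar_index :: "algo_params \<Rightarrow> real^'n \<Rightarrow> real^'n \<Rightarrow> 'g set" where
  "cg_bar_index C x s = {i. proj (G i) x \<noteq> 0 \<and> proj (G i) (x + s) \<noteq> 0 \<and>
     kappa1 C * norm (gradF {i} x) \<le> norm (proj (G i) x)}"

definition cg_index :: "algo_params \<Rightarrow> real^'n \<Rightarrow> real^'n \<Rightarrow> 'g set" where
  "cg_index C x s = {i \<in> cg_bar_index C x s.
     kappa2 C * norm (gradF (cg_bar_index C x s) x) powr pexp C \<le> norm (proj (G i) x)}"

lemma cg_bar_set_eq: "cg_bar_set C G F x s = (\<Union>i\<in>cg_bar_index C x s. G i)"
proof -
  have "grad_on (G i) F x = gradF {i} x" if "proj (G i) x \<noteq> 0" for i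
    using that by (intro grad_on_F) auto
  then have "{G i | i. proj (G i) x \<noteq> 0 \<and> proj (G i) (x + s) \<noteq> 0 \<and>
      norm (proj (G i) x) \<ge> kappa1 C * norm (grad_on (G i) F x)} = G ` cg_bar_index C x s"
    unfolding cg_bar_index_def by auto
  then show ?thesis unfolding cg_bar_set_def by simp
qed

lemma cg_set_eq: "cg_set C G F x s = (\<Union>i\<in>cg_index C x s. G i)"
proof -
  let ?B = "cg_bar_index C x s"
  have g: "grad_on (cg_bar_set C G F x s) F x = gradF ?B x"
    by (intro grad_on_F cg_bar_set_eq) (auto simp: cg_bar_index_def)
  have "{G i | i. i \<in> ?B \<and> norm (proj (G i) x) < kappa2 C * norm (gradF ?B x) powr pexp C}
      = G ` (?B - cg_index C x s)"
    unfolding cg_index_def by (auto simp: not_le)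
  then have "small_set C G F x s = (\<Union>i\<in>?B - cg_index C x s. G i)"
    unfolding small_set_def g unfolding cg_bar_set_eq group_subset_iff by simp
  moreover have "?B - (?B - cg_index C x s) = cg_index C x s"
    unfolding cg_index_def by auto
  ultimately show ?thesis
    unfolding cg_set_def cg_bar_set_eq using Union_group_Diff[of ?B "?B - cg_index C x s"] by simp
qed

lemma cg_indexD:
  assumes "i \<in> cg_index C x s"
  shows "proj (G i) x \<noteq> 0"
    and "kappa2 C * norm (gradF (cg_bar_index C x s) x) powr pexp C \<le> norm (proj (G i) x)"
  using assms unfolding cg_index_def cg_bar_index_def by auto

lemma union_of_groups_obtain:
  assumes "union_of_groups G I" "I \<subseteq> cg_set C G F x s"
  obtains J where "I = (\<Union>j\<in>J. G j)" "J \<subseteq> cg_index C x s"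
  using assms unfolding union_of_groups_def cg_set_eq by (metis Union_group_mono)

lemma radius_le: "radius C G F Icg x i \<le> sin (theta C) * norm (proj (G i) x)"
  unfolding radius_def by simp

text \<open>The ball of a group has radius at most \<open>sin (theta C)\<close> times the norm of
  the group, so a move shorter than the remaining fraction \<open>1 - sin (theta C)\<close> cannot
  reach it.\<close>

lemma less_min_tau:
  assumes T: "0 \<le> T" and \<theta>: "0 < sin (theta C)"
    and d: "\<And>i. G i \<subseteq> I \<Longrightarrow> T * norm d < (1 - sin (theta C)) * norm (proj (G i) x)"
  shows "ereal T < min_tau C G F Icg I x d"
proof (rule ccontr)
  assume "\<not> ?thesis"
  then have "(INF i\<in>{i. G i \<subseteq> I}. group_tau C G F Icg x d i) \<le> ereal T"
    unfolding min_tau_def by simp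
  then obtain i where i: "G i \<subseteq> I" "group_tau C G F Icg x d i \<le> ereal T"
    by (rule INF_le_finiteD[rotated]) auto
  have "radius C G F Icg x i < norm (proj (G i) (x + t *\<^sub>R d))" if t: "0 \<le> t" "t \<le> T" for t
  proof -
    have "norm (proj (G i) (t *\<^sub>R d)) \<le> t * norm d"
      using norm_proj_le[of "G i" "t *\<^sub>R d"] t by simp
    also have "\<dots> \<le> T * norm d" using t by (intro mult_right_mono) auto
    finally have "norm (proj (G i) (t *\<^sub>R d)) < (1 - sin (theta C)) * norm (proj (G i) x)"
      using d[OF i(1)] by linarith
    then have "sin (theta C) * norm (proj (G i) x) < norm (proj (G i) (x + t *\<^sub>R d))"
      using norm_diff_ineq[of "proj (G i) x" "proj (G i) (t *\<^sub>R d)"]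
      by (simp add: proj_add left_diff_distrib)
    then show ?thesis using radius_le[of C Icg x i] by linarith
  qed
  then have "ereal T < group_tau C G F Icg x d i" by (intro less_group_tau T)
  then show False using i(2) by simp
qed

text \<open>Over finitely many groups the minimum is attained, so a step size at or beyond
  \<open>min_tau\<close> truncates at least one group.\<close>

lemma cut_point_zero_group:
  assumes "min_tau C G F Icg I x d \<le> ereal t"
  obtains i where "G i \<subseteq> I" "proj (G i) (cut_point C G F Icg I x d t) = 0"
proof -
  obtain i where i: "G i \<subseteq> I" "group_tau C G F Icg x d i \<le> ereal t"
    using assms unfolding min_tau_def by (rule INF_le_finiteD[rotated]) auto
  then have "G i \<inter> - \<Union>{G i | i. G i \<subseteq> I \<and> ereal t \<ge> group_tau C G F Icg x d i} = {}"
    by blast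
  then have "proj (G i) (cut_point C G F Icg I x d t) = 0"
    unfolding cut_point_def by simp
  then show thesis using that i by blast
qed

lemma proj_cg_trial_disjoint:
  assumes d: "proj I d = d" and S: "S \<inter> I = {}"
  shows "proj S (cg_trial C G F Icg I x d j) = proj S x"
proof -
  have "proj S d = 0"
    using d S by (metis proj_empty proj_proj)
  moreover have "S \<inter> - \<Union>{G i | i. G i \<subseteq> I \<and> ereal t \<ge> group_tau C G F Icg x d i} = S" for t
    using S by blast
  ultimately show ?thesis
    unfolding cg_trial_def cut_point_def by (simp add: proj_add proj_scaleR)
qed

end

section \<open>Global convergence\<close>

text \<open>\<open>s\<close> and \<open>K_cg\<close> are parameters tied down by equations, so that
  the locale matches the local definitions of the theorem. The assumptions are those of global
  convergence; further ones are added where the behavior near \<open>x_star\<close> is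
  studied.\<close>

locale composite_run = composite_problem G lam f
  for G :: "'g::finite \<Rightarrow> 'n::finite set" and lam :: "'g \<Rightarrow> real" and f :: "real^'n \<Rightarrow> real" +
  fixes C :: algo_params
    and x :: "nat \<Rightarrow> real^'n"
    and \<alpha> :: "nat \<Rightarrow> real"
    and I :: "nat \<Rightarrow> 'n set"
    and H :: "nat \<Rightarrow> real^'n^'n"
    and \<mu> :: "nat \<Rightarrow> real"
    and d :: "nat \<Rightarrow> real^'n"
    and \<mu>_min \<mu>_max :: real
    and x_star :: "real^'n"
    and s :: "nat \<Rightarrow> real^'n"
    and K_cg :: "nat set"
  assumes params: "valid_params C"
    and run: "algorithm_run C G f r x \<alpha> I H \<mu> d"
    and s_eq: "s k = pg_step f r (x k) (\<alpha> k)"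
    and K_cg_iff: "k \<in> K_cg \<longleftrightarrow> chi_pg C G F (x k) (s k) \<le> chi_cg C G F (x k) (s k)"
    and chi_pos: "max (chi_cg C G F (x k) (s k)) (chi_pg C G F (x k) (s k)) > 0"
    and mu_min: "0 < \<mu>_min"
    and mu_le: "\<mu>_min \<le> \<mu>_max"
    and H_bounds: "k \<in> K_cg \<Longrightarrow> proj (I k) v = v \<Longrightarrow>
          \<mu>_min * (norm v)\<^sup>2 \<le> v \<bullet> (H k *v v) \<and> v \<bullet> (H k *v v) \<le> \<mu>_max * (norm v)\<^sup>2"
    and x_star: "is_arg_min F (\<lambda>_. True) x_star"
begin

abbreviation "J_cg k \<equiv> cg_index C (x k) (s k)"

lemma param_bounds:
  shows "0 < phi C" "0 < xi C" "xi C < 1" "0 < eta C" "eta C < 1" "0 < zeta C" "zeta C < 1"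
    "0 < kappa1 C" "0 < kappa2 C" "0 < pexp C" "0 < sin (theta C)" "sin (theta C) < 1"
    "1 \<le> qexp C"
proof -
  have "0 < theta C" "theta C < pi / 2"
    using params unfolding valid_params_def by auto
  then show "0 < sin (theta C)" "sin (theta C) < 1"
    using sin_gt_zero[of "theta C"] sin_monotone_2pi[of "theta C" "pi / 2"] by auto
qed (use params in \<open>auto simp: valid_params_def\<close>)

lemma cg_step:
  "k \<in> K_cg \<Longrightarrow> cg_iteration C G F (x k) (s k) (\<alpha> k) (I k) (H k) (\<mu> k) (d k) (x (Suc k)) (\<alpha> (Suc k))"
  using run unfolding algorithm_run_def Let_def F_def[symmetric] s_eq[symmetric] K_cg_iff
  by presburger

lemma pg_step:
  "k \<notin> K_cg \<Longrightarrow> pg_iteration C G F (x k) (s k) (\<alpha> k) (I k) (x (Suc k)) (\<alpha> (Suc k))"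
  using run unfolding algorithm_run_def Let_def F_def[symmetric] s_eq[symmetric] K_cg_iff
  by presburger

lemma alpha_bounds: "0 < \<alpha> k" "\<alpha> k \<le> 1"
proof (induction k)
  case (Suc k)
  have "\<alpha> (Suc k) = \<alpha> k \<or> \<alpha> (Suc k) = zeta C * \<alpha> k"
    using cg_step[of k] pg_step[of k] unfolding cg_iteration_def pg_iteration_def
    by (cases "k \<in> K_cg") (auto split: if_splits)
  moreover have "zeta C * \<alpha> k \<le> 1 * 1"
    using Suc param_bounds by (intro mult_mono) auto
  ultimately show "0 < \<alpha> (Suc k)" "\<alpha> (Suc k) \<le> 1"
    using Suc param_bounds by auto
qed (use run in \<open>auto simp: algorithm_run_def\<close>)

text \<open>Groups in the CG set are nonzero, so \<open>grad_on\<close> is given by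
  \<open>gradF\<close>; positivity of the larger step measure makes \<open>J\<close>
  nonempty.\<close>

lemma cg_groups:
  assumes "k \<in> K_cg"
  obtains J where "I k = (\<Union>j\<in>J. G j)" "J \<subseteq> J_cg k" "J \<noteq> {}" "grad_on (I k) F (x k) = gradF J (x k)"
proof -
  have it: "union_of_groups G (I k)" "I k \<subseteq> cg_set C G F (x k) (s k)"
    "norm (proj (I k) (s k)) \<ge> phi C * chi_cg C G F (x k) (s k)"
    using cg_step[OF assms] unfolding cg_iteration_def by auto
  obtain J where J: "I k = (\<Union>j\<in>J. G j)" "J \<subseteq> J_cg k"
    using union_of_groups_obtain[OF it(1,2)] .
  have "0 < chi_cg C G F (x k) (s k)"
    using chi_pos[of k] assms K_cg_iff by auto
  then have "0 < phi C * chi_cg C G F (x k) (s k)"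
    using param_bounds by simp
  then have "proj (I k) (s k) \<noteq> 0"
    using it(3) by auto
  then have "J \<noteq> {}"
    using J(1) by auto
  moreover have "grad_on (I k) F (x k) = gradF J (x k)"
    using J cg_indexD(1) by (intro grad_on_F) auto
  ultimately show thesis using that J by blast
qed

lemma cg_direction_props:
  assumes "k \<in> K_cg" and J: "I k = (\<Union>j\<in>J. G j)" "grad_on (I k) F (x k) = gradF J (x k)"
  shows "gradF J (x k) \<bullet> d k \<le> - (norm (gradF J (x k)))\<^sup>2 / \<mu>_max"
    and "norm (d k) \<le> 2 / \<mu>_min * norm (gradF J (x k))"
    and "proj (I k) (d k) = d k"
proof -
  have d: "cg_direction C (I k) (gradF J (x k)) (H k) (\<mu> k) (d k)"
    using cg_step[OF assms(1)] unfolding cg_iteration_def J(2) by blast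
  have g: "proj (I k) (gradF J (x k)) = gradF J (x k)"
    unfolding J(1) by (rule proj_gradF) simp
  show "gradF J (x k) \<bullet> d k \<le> - (norm (gradF J (x k)))\<^sup>2 / \<mu>_max"
    "norm (d k) \<le> 2 / \<mu>_min * norm (gradF J (x k))"
    using cg_direction_bounds[OF d g H_bounds[OF assms(1)] mu_min] by auto
  show "proj (I k) (d k) = d k"
    using d unfolding cg_direction_def by blast
qed

lemma cg_trial_obtain:
  assumes "k \<in> K_cg"
  obtains j where "cg_accept C G F (cg_set C G F (x k) (s k)) (I k) (x k) (d k) j"
    "\<And>i. i < j \<Longrightarrow> \<not> cg_accept C G F (cg_set C G F (x k) (s k)) (I k) (x k) (d k) i"
    "x (Suc k) = cg_trial C G F (cg_set C G F (x k) (s k)) (I k) (x k) (d k) j"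
  using cg_step[OF assms] that unfolding cg_iteration_def cg_search_def by blast

lemma F_decreasing: "F (x (Suc k)) \<le> F (x k)"
proof (cases "k \<in> K_cg")
  case True
  obtain J where J: "I k = (\<Union>j\<in>J. G j)" "grad_on (I k) F (x k) = gradF J (x k)"
    using cg_groups[OF True] by metis
  have "gradF J (x k) \<bullet> d k \<le> 0"
    using cg_direction_props(1)[OF True J] mu_min mu_le
    by (smt (verit) divide_minus_left divide_nonneg_pos zero_le_power2)
  then have "eta C * xi C ^ j * (gradF J (x k) \<bullet> d k) \<le> 0" for j
    using param_bounds by (simp add: mult_nonneg_nonpos)
  then have "F (x k) + eta C * xi C ^ j * (gradF J (x k) \<bullet> d k) \<le> F (x k)" for j
    by (simp add: mult.assoc)
  then show ?thesis
    using cg_trial_obtain[OF True] J(2) unfolding cg_accept_def cg_trial_def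
    by (smt (verit, best))
next
  case False
  then obtain j where "F (x (Suc k)) \<le> F (x k) - eta C * xi C ^ j * (1 / \<alpha> k) * (norm (proj (I k) (s k)))\<^sup>2"
    using pg_step[OF False] unfolding pg_iteration_def pg_accept_def by auto
  moreover have "0 \<le> eta C * xi C ^ j * (1 / \<alpha> k) * (norm (proj (I k) (s k)))\<^sup>2"
    using param_bounds alpha_bounds[of k] by simp
  ultimately show ?thesis by linarith
qed

lemma decseq_F: "decseq (\<lambda>k. F (x k))"
  by (rule decseq_SucI) (rule F_decreasing)

lemma F_x_star_le: "F x_star \<le> F y"
  using x_star unfolding is_arg_min_linorder by blast

text \<open>Quadratic growth bounds the level set of \<open>F (x 0)\<close>, which the iterates
  never leave.\<close>

lemma bounded_iterates:
  obtains B where "\<And>k. norm (x k) \<le> B"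
proof -
  obtain m where m: "m > 0" "\<And>y. F x_star + m * (norm (y - x_star))\<^sup>2 \<le> F y"
    using F_quadratic_growth x_star by metis
  have "norm (x k) \<le> norm x_star + sqrt ((F (x 0) - F x_star) / m)" for k
  proof -
    have "m * (norm (x k - x_star))\<^sup>2 \<le> F (x 0) - F x_star"
      using m(2)[of "x k"] decseqD[OF decseq_F, of 0 k] by simp
    then have "norm (x k - x_star) \<le> sqrt ((F (x 0) - F x_star) / m)"
      using m(1) by (intro real_le_rsqrt) (simp add: field_simps)
    then show ?thesis using norm_triangle_sub[of "x k" x_star] by linarith
  qed
  then show thesis by (rule that)
qed

lemma bounded_gradients:
  obtains B where "\<And>k. norm (grad f (x k)) \<le> B"
proof -
  obtain R where R: "\<And>k. norm (x k) \<le> R" using bounded_iterates by blast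
  have "bounded (grad f ` cball 0 R)"
    by (intro compact_imp_bounded compact_continuous_image continuous_on_subset[OF continuous_grad_f]) auto
  then obtain B where "\<forall>z\<in>cball 0 R. norm (grad f z) \<le> B"
    unfolding bounded_iff by auto
  then show thesis using that[of B] R by simp
qed

text \<open>Trial points may leave the initial level set, so the curvature constant \<open>M\<close>
  of \<open>f\<close> is taken on a ball that contains all iterates and all moves from them of
  length at most \<open>D\<close>.\<close>

lemma trial_bounds:
  obtains D M where "D > 0" "M > 0"
    "\<And>k. norm (s k) \<le> D" "\<And>k. k \<in> K_cg \<Longrightarrow> norm (d k) \<le> D"
    "\<And>k. norm (grad f (x k)) \<le> D" "\<And>k. norm (x k) \<le> D"
    "\<And>k v. norm v \<le> D \<Longrightarrow> f (x k + v) \<le> f (x k) + grad f (x k) \<bullet> v + M * (norm v)\<^sup>2"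
proof -
  obtain R where R: "\<And>k. norm (x k) \<le> R" using bounded_iterates by blast
  obtain B where B: "\<And>k. norm (grad f (x k)) \<le> B" using bounded_gradients by blast
  have B0: "B \<ge> 0" using B[of 0] by (meson norm_ge_zero order_trans)
  have R0: "R \<ge> 0" using R[of 0] by (meson norm_ge_zero order_trans)
  \<comment> \<open>\<open>W\<close> bounds every CG direction: gradients over groups are at most
    \<open>B + lam_sum\<close>, and a direction is at most \<open>2 / \<mu>_min\<close> times as
    long.\<close>
  define W where "W = 2 / \<mu>_min * (B + lam_sum)"
  define D where "D = B + R + lam_sum + W"
  have D2: "0 \<le> W"
    unfolding W_def using mu_min B0 lam_sum_pos by simp
  obtain M where M: "M > 0" "\<And>y v. norm y \<le> R + D \<Longrightarrow> norm (y + v) \<le> R + D \<Longrightarrow>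
      f (y + v) \<le> f y + grad f y \<bullet> v + M * (norm v)\<^sup>2"
    using quadratic_upper_bound_on_cball[of f "grad f" "hess f" "R + D"] GDERIV_f has_derivative_grad_f f_C2
    by metis
  show thesis
  proof (rule that[of D M])
    show "D > 0" unfolding D_def using D2 B0 R0 lam_sum_pos by linarith
    show "M > 0" by fact
    fix k
    have "norm (s k) \<le> \<alpha> k * (lam_sum + norm (grad f (x k)))"
      unfolding s_eq by (rule norm_step_le) (rule alpha_bounds)
    also have "\<dots> \<le> 1 * (lam_sum + B)"
      using alpha_bounds[of k] B[of k] lam_sum_pos by (intro mult_mono) auto
    finally show "norm (s k) \<le> D" unfolding D_def using D2 R0 by simp
    show "norm (grad f (x k)) \<le> D" using B[of k] D2 R0 lam_sum_pos unfolding D_def by linarith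
    show "norm (x k) \<le> D" using R[of k] D2 B0 lam_sum_pos unfolding D_def by linarith
    show "norm (d k) \<le> D" if k: "k \<in> K_cg"
    proof -
      obtain J where J: "I k = (\<Union>j\<in>J. G j)" "grad_on (I k) F (x k) = gradF J (x k)"
        using cg_groups[OF k] by metis
      have "norm (gradF J (x k)) \<le> B + lam_sum"
        using norm_gradF_le[of J "x k"] B[of k] by linarith
      then have "2 / \<mu>_min * norm (gradF J (x k)) \<le> W"
        unfolding W_def using mu_min by (intro mult_left_mono) auto
      then show ?thesis
        using cg_direction_props(2)[OF k J] B0 R0 lam_sum_pos unfolding D_def by linarith
    qed
    show "f (x k + v) \<le> f (x k) + grad f (x k) \<bullet> v + M * (norm v)\<^sup>2" if "norm v \<le> D" for v
      using that R[of k] norm_triangle_ineq[of "x k" v] norm_ge_zero[of v] by (intro M(2)) linarith+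
  qed
qed

lemma pg_iterate:
  assumes "k \<notin> K_cg" "\<alpha> (Suc k) = \<alpha> k"
  shows "x (Suc k) = x k + proj (I k) (s k)"
    and "F (x (Suc k)) \<le> F (x k) - eta C / \<alpha> k * (norm (proj (I k) (s k)))\<^sup>2"
proof -
  obtain j where j: "pg_accept C F (I k) (x k) (s k) (\<alpha> k) j"
    "x (Suc k) = x k + xi C ^ j *\<^sub>R proj (I k) (s k)"
    "\<alpha> (Suc k) = (if j = 0 then \<alpha> k else zeta C * \<alpha> k)"
    using pg_step[OF assms(1)] unfolding pg_iteration_def by blast
  \<comment> \<open>A backtracked PG iteration would have shrunk \<alpha> strictly.\<close>
  have "j = 0"
    using j(3) assms(2) alpha_bounds[of k] param_bounds by (auto split: if_splits)
  then show "x (Suc k) = x k + proj (I k) (s k)"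
    "F (x (Suc k)) \<le> F (x k) - eta C / \<alpha> k * (norm (proj (I k) (s k)))\<^sup>2"
    using j by (auto simp: pg_accept_def)
qed

text \<open>If \<open>\<alpha> k * M\<close> is at most \<open>1 - eta C\<close>, the full PG step
  passes the test, so \<alpha> shrinks only while it exceeds \<open>(1 - eta C) / M\<close>.\<close>

lemma alpha_eventually_constant:
  obtains K where "\<And>k. k \<ge> K \<Longrightarrow> \<alpha> k = \<alpha> K"
proof -
  obtain D M where M: "M > 0" "\<And>k. norm (s k) \<le> D"
    "\<And>k v. norm v \<le> D \<Longrightarrow> f (x k + v) \<le> f (x k) + grad f (x k) \<bullet> v + M * (norm v)\<^sup>2"
    using trial_bounds by metis
  have step: "\<alpha> (Suc k) = \<alpha> k \<or> \<alpha> (Suc k) = zeta C * \<alpha> k \<and> \<alpha> k > (1 - eta C) / M" for k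
  proof (cases "k \<in> K_cg")
    case True then show ?thesis using cg_step[OF True] unfolding cg_iteration_def by blast
  next
    case False
    let ?s = "proj (I k) (s k)"
    obtain j where j: "\<And>i. i < j \<Longrightarrow> \<not> pg_accept C F (I k) (x k) (s k) (\<alpha> k) i"
      "\<alpha> (Suc k) = (if j = 0 then \<alpha> k else zeta C * \<alpha> k)"
      using pg_step[OF False] unfolding pg_iteration_def by blast
    have "\<alpha> k > (1 - eta C) / M" if "j > 0"
    proof (rule ccontr)
      assume "\<not> ?thesis"
      then have "\<alpha> k * M \<le> 1 - eta C" using M(1) by (simp add: field_simps)
      then have le: "M \<le> (1 - eta C) / \<alpha> k"
        using alpha_bounds[of k] by (simp add: field_simps)
      obtain J where "I k = (\<Union>j\<in>J. G j)"
        using pg_step[OF False] unfolding pg_iteration_def union_of_groups_def by blast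
      then have "r (x k + ?s) \<le> r (x k) - (norm ?s)\<^sup>2 / \<alpha> k - grad f (x k) \<bullet> ?s"
        unfolding s_eq by (intro group_reg_step_le alpha_bounds)
      moreover have "f (x k + ?s) \<le> f (x k) + grad f (x k) \<bullet> ?s + M * (norm ?s)\<^sup>2"
        using norm_proj_le[of "I k" "s k"] M(2)[of k] by (intro M(3)) linarith
      moreover have "M * (norm ?s)\<^sup>2 \<le> (1 - eta C) / \<alpha> k * (norm ?s)\<^sup>2"
        using le by (intro mult_right_mono) auto
      ultimately have "pg_accept C F (I k) (x k) (s k) (\<alpha> k) 0"
        unfolding pg_accept_def F_def by (simp add: left_diff_distrib diff_divide_distrib)
      then show False using j(1)[of 0] that by blast
    qed
    then show ?thesis using j(2) by auto
  qed
  have "\<exists>K. \<forall>k\<ge>K. \<alpha> k = \<alpha> K"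
    using eventually_constant_shrinking[of \<alpha> "zeta C" "(1 - eta C) / M", OF _ _ _ _ step]
      alpha_bounds[of 0] param_bounds M(1) by (metis diff_gt_0_iff_gt divide_pos_pos)
  then show thesis using that by blast
qed

section \<open>Decrease of \<open>F\<close> or of the number of nonzero groups\<close>

definition nonzero_groups :: "nat \<Rightarrow> 'g set" where
  "nonzero_groups k = {i. proj (G i) (x k) \<noteq> 0}"

text \<open>A CG iteration moves only groups in the CG set, and these are nonzero already.\<close>

lemma cg_trial_nonzero_groups:
  assumes "k \<in> K_cg"
  shows "nonzero_groups (Suc k) \<subseteq> nonzero_groups k"
proof -
  obtain J where J: "I k = (\<Union>j\<in>J. G j)" "J \<subseteq> J_cg k" "grad_on (I k) F (x k) = gradF J (x k)"
    using cg_groups[OF assms] by metis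
  have "proj (G i) (x (Suc k)) = 0" if "proj (G i) (x k) = 0" for i
  proof -
    have "i \<notin> J" using that J(2) cg_indexD(1) by blast
    then have "G i \<inter> I k = {}" using J(1) group_Int_Union[of i J] by simp
    then show ?thesis
      using cg_trial_obtain[OF assms] proj_cg_trial_disjoint[OF cg_direction_props(3)[OF assms J(1,3)]] that
      by metis
  qed
  then show ?thesis unfolding nonzero_groups_def by blast
qed

text \<open>In the CG case either the search truncates a group, or backtracking stops with a step
  size bounded below and the Armijo test gives a fixed decrease. No constant depends on
  \<open>k\<close>.\<close>

lemma sufficient_progress:
  assumes \<delta>: "\<delta> > 0"
  obtains c where "c > 0"
    "\<And>k. \<delta> \<le> norm (s k) \<Longrightarrow> \<alpha> (Suc k) = \<alpha> k \<Longrightarrow>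
      F (x (Suc k)) \<le> F (x k) - c \<or> nonzero_groups (Suc k) \<subset> nonzero_groups k"
proof -
  obtain D M where DM: "D > 0" "M > 0" "\<And>k. k \<in> K_cg \<Longrightarrow> norm (d k) \<le> D"
    "\<And>k v. norm v \<le> D \<Longrightarrow> f (x k + v) \<le> f (x k) + grad f (x k) \<bullet> v + M * (norm v)\<^sup>2"
    using trial_bounds by metis
  note pb = param_bounds
  \<comment> \<open>The larger of the two step measures is at least \<open>\<delta> / 2\<close>, and
    \<open>I k\<close> keeps the fraction \<open>phi C\<close> of it.\<close>
  define \<epsilon> where "\<epsilon> = phi C * (\<delta> / 2)"
  have \<epsilon>: "\<epsilon> > 0" unfolding \<epsilon>_def using \<delta> pb by simp
  \<comment> \<open>Lower bound for the groups in the CG set: they survived the test against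
    \<open>kappa2 C\<close> times a power of a gradient norm that is at least \<epsilon>.\<close>
  define \<omega> where "\<omega> = kappa2 C * \<epsilon> powr pexp C"
  have \<omega>: "\<omega> > 0" unfolding \<omega>_def using \<epsilon> pb by simp
  have mm: "\<mu>_max > 0" using mu_min mu_le by simp
  \<comment> \<open>Curvature of \<open>f\<close> plus that of the regularizer at distance \<omega>
    from its kinks.\<close>
  define Q where "Q = M + lam_sum / (2 * \<omega>)"
  have Q: "Q > 0" unfolding Q_def using DM \<omega> lam_sum_pos by (simp add: add_pos_pos)
  \<comment> \<open>The three bounds keep the step size at most 1, keep every group outside its ball
    (strictly, by the factor 2), and let the curvature term fit into the slack of the Armijo
    test.\<close>
  define t0 where "t0 = min 1 (min ((1 - sin (theta C)) * \<omega> / (2 * D)) ((1 - eta C) * (\<epsilon>\<^sup>2 / \<mu>_max) / (Q * D\<^sup>2)))"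
  have t0: "t0 > 0" "t0 \<le> 1" unfolding t0_def using \<omega> DM pb \<epsilon> mm Q by auto
  \<comment> \<open>Guaranteed decrease of a PG step, where \<open>\<alpha> k\<close> is at most 1,
    and of an Armijo step, where backtracking falls below \<open>t0\<close> by at most a factor
    \<open>xi C\<close>.\<close>
  define c where "c = min (eta C * \<epsilon>\<^sup>2) (eta C * (xi C * t0) * (\<epsilon>\<^sup>2 / \<mu>_max))"
  have c: "c > 0" unfolding c_def using pb \<epsilon> t0 mm by simp
  show thesis
  proof (rule that[OF c])
    fix k assume s: "\<delta> \<le> norm (s k)" and ak: "\<alpha> (Suc k) = \<alpha> k"
    have chi: "norm (s k) \<le> chi_cg C G F (x k) (s k) + chi_pg C G F (x k) (s k)"
      using norm_triangle_ineq[of "proj (- cg_set C G F (x k) (s k)) (s k)" "proj (cg_set C G F (x k) (s k)) (s k)"]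
      by (simp add: proj_decomp chi_cg_def chi_pg_def pg_set_def)
    show "F (x (Suc k)) \<le> F (x k) - c \<or> nonzero_groups (Suc k) \<subset> nonzero_groups k"
    proof (cases "k \<in> K_cg")
      case False
      have "\<delta> / 2 \<le> chi_pg C G F (x k) (s k)"
        using chi s False K_cg_iff[of k] by simp
      then have "\<epsilon> \<le> phi C * chi_pg C G F (x k) (s k)"
        unfolding \<epsilon>_def using pb by (intro mult_left_mono) auto
      also have "\<dots> \<le> norm (proj (I k) (s k))"
        using pg_step[OF False] unfolding pg_iteration_def by blast
      finally have "\<epsilon>\<^sup>2 \<le> (norm (proj (I k) (s k)))\<^sup>2"
        using \<epsilon> by (intro power_mono) auto
      moreover have "eta C \<le> eta C / \<alpha> k"
        using pb alpha_bounds[of k] by (simp add: le_divide_eq mult_le_cancel_left1)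
      ultimately have "eta C * \<epsilon>\<^sup>2 \<le> eta C / \<alpha> k * (norm (proj (I k) (s k)))\<^sup>2"
        using pb by (intro mult_mono) auto
      moreover have "c \<le> eta C * \<epsilon>\<^sup>2" unfolding c_def by simp
      ultimately show ?thesis
        using pg_iterate(2)[OF False ak] by linarith
    next
      case True
      obtain J where J: "I k = (\<Union>j\<in>J. G j)" "J \<subseteq> J_cg k" "grad_on (I k) F (x k) = gradF J (x k)"
        using cg_groups[OF True] by metis
      let ?g = "gradF J (x k)" and ?Icg = "cg_set C G F (x k) (s k)"
      note dir = cg_direction_props[OF True J(1,3)]
      have nz: "proj (G j) (x k) \<noteq> 0" if "j \<in> J" for j
        using that J(2) cg_indexD(1) by blast
      have "\<delta> / 2 \<le> chi_cg C G F (x k) (s k)"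
        using chi s True K_cg_iff[of k] by simp
      then have "\<epsilon> \<le> phi C * chi_cg C G F (x k) (s k)"
        unfolding \<epsilon>_def using pb by (intro mult_left_mono) auto
      also have "\<dots> \<le> norm (proj (I k) (s k))"
        using cg_step[OF True] unfolding cg_iteration_def by blast
      also have "\<dots> \<le> \<alpha> k * norm ?g"
        unfolding s_eq using nz J(1) alpha_bounds by (intro norm_proj_step_le_gradF) auto
      also have "\<dots> \<le> norm ?g"
        using alpha_bounds[of k] by (intro mult_left_le_one_le) auto
      finally have g: "\<epsilon> \<le> norm ?g" .
      have far: "\<omega> \<le> norm (proj (G j) (x k))" if "j \<in> J" for j
      proof -
        have j: "j \<in> J_cg k" using that J(2) by blast
        have "J \<subseteq> cg_bar_index C (x k) (s k)" using J(2) unfolding cg_index_def by blast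
        then have "\<epsilon> \<le> norm (gradF (cg_bar_index C (x k) (s k)) (x k))"
          using g norm_gradF_mono order_trans by blast
        then have "\<omega> \<le> kappa2 C * norm (gradF (cg_bar_index C (x k) (s k)) (x k)) powr pexp C"
          unfolding \<omega>_def using \<epsilon> pb by (intro mult_left_mono powr_mono2) auto
        then show ?thesis using cg_indexD(2)[OF j] by linarith
      qed
      have dD: "norm (d k) \<le> D" using DM(3) True .
      have "\<epsilon>\<^sup>2 / \<mu>_max \<le> (norm ?g)\<^sup>2 / \<mu>_max"
        using g \<epsilon> mm by (intro divide_right_mono power_mono) auto
      then have gd: "\<epsilon>\<^sup>2 / \<mu>_max \<le> - (?g \<bullet> d k)"
        using dir(1) by simp
      \<comment> \<open>Every step size up to \<open>t0\<close> passes: no ball is reached, so the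
        Armijo branch of the test applies.\<close>
      have accept: "cg_accept C G F ?Icg (I k) (x k) (d k) j" if j: "xi C ^ j \<le> t0" for j
      proof -
        let ?t = "xi C ^ j"
        have t: "0 < ?t" "?t \<le> 1"
          using zero_less_power[OF pb(2)] order_trans[OF j t0(2)] by blast+
        have "ereal ?t < min_tau C G F ?Icg (I k) (x k) (d k)"
        proof (rule less_min_tau)
          fix i assume "G i \<subseteq> I k"
          then have "i \<in> J" unfolding J(1) group_subset_iff .
          then have i: "\<omega> \<le> norm (proj (G i) (x k))" by (rule far)
          have "?t * norm (d k) \<le> t0 * D"
            using j dD t0 t by (intro mult_mono) auto
          also have "\<dots> \<le> (1 - sin (theta C)) * \<omega> / (2 * D) * D"
            unfolding t0_def using DM(1) by (intro mult_right_mono) auto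
          also have "\<dots> < (1 - sin (theta C)) * \<omega>" using DM(1) \<omega> pb by simp
          also have "\<dots> \<le> (1 - sin (theta C)) * norm (proj (G i) (x k))"
            using i pb by (intro mult_left_mono) auto
          finally show "?t * norm (d k) < (1 - sin (theta C)) * norm (proj (G i) (x k))" .
        qed (use t pb in auto)
        moreover have "F (x k + ?t *\<^sub>R d k) \<le> F (x k) + eta C * ?t * (?g \<bullet> d k)"
        proof -
          let ?v = "?t *\<^sub>R d k"
          have v: "?v = proj (\<Union>j\<in>J. G j) ?v"
            using dir(3) J(1) by (simp add: proj_scaleR)
          have "norm ?v \<le> 1 * D"
            using t dD unfolding norm_scaleR by (intro mult_mono) auto
          then have "f (x k + ?v) \<le> f (x k) + grad f (x k) \<bullet> ?v + M * (norm ?v)\<^sup>2"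
            by (intro DM(4)) simp
          moreover have "r (x k + ?v) \<le> r (x k) + (?g - grad f (x k)) \<bullet> ?v + lam_sum / (2 * \<omega>) * (norm ?v)\<^sup>2"
            by (rule group_reg_quadratic_bound[OF far \<omega> v])
          ultimately have "F (x k + ?v) \<le> F (x k) + ?g \<bullet> ?v + Q * (norm ?v)\<^sup>2"
            unfolding F_def Q_def inner_diff_left distrib_right by linarith
          moreover have "Q * (norm ?v)\<^sup>2 \<le> ?t * (- ((1 - eta C) * (?g \<bullet> d k)))"
          proof -
            have "Q * (norm ?v)\<^sup>2 = ?t * (?t * (Q * (norm (d k))\<^sup>2))"
              by (simp add: power_mult_distrib power2_eq_square)
            also have "?t * (Q * (norm (d k))\<^sup>2) \<le> t0 * (Q * D\<^sup>2)"
              using j dD t0 t Q by (intro mult_mono power_mono) auto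
            also have "t0 * (Q * D\<^sup>2) \<le> (1 - eta C) * (\<epsilon>\<^sup>2 / \<mu>_max) / (Q * D\<^sup>2) * (Q * D\<^sup>2)"
              unfolding t0_def using Q DM(1) by (intro mult_right_mono) auto
            also have "\<dots> = (1 - eta C) * (\<epsilon>\<^sup>2 / \<mu>_max)" using Q DM(1) by simp
            also have "\<dots> \<le> (1 - eta C) * (- (?g \<bullet> d k))"
              using gd pb by (intro mult_left_mono) auto
            finally show ?thesis using t by simp
          qed
          ultimately show ?thesis by (simp add: algebra_simps)
        qed
        ultimately show ?thesis unfolding cg_accept_def J(3) by (simp add: not_le[symmetric])
      qed
      obtain j where j: "cg_accept C G F ?Icg (I k) (x k) (d k) j"
        "\<And>i. i < j \<Longrightarrow> \<not> cg_accept C G F ?Icg (I k) (x k) (d k) i"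
        "x (Suc k) = cg_trial C G F ?Icg (I k) (x k) (d k) j"
        using cg_trial_obtain[OF True] by blast
      \<comment> \<open>The rejected index before \<open>j\<close> has a step size above
        \<open>t0\<close>; for \<open>j = 0\<close> the step size is 1.\<close>
      have xij: "xi C * t0 \<le> xi C ^ j"
      proof (cases j)
        case 0
        have "xi C * t0 \<le> 1 * 1" using pb t0 by (intro mult_mono) auto
        then show ?thesis using 0 by simp
      next
        case (Suc i)
        then have "t0 < xi C ^ i" using j(2)[of i] accept[of i] by force
        then show ?thesis using Suc pb by simp
      qed
      show ?thesis
      proof (cases "min_tau C G F ?Icg (I k) (x k) (d k) \<le> ereal (xi C ^ j)")
        case cut: True
        then obtain i where i: "G i \<subseteq> I k" "proj (G i) (x (Suc k)) = 0"
          using cut_point_zero_group[OF cut] j(3) unfolding cg_trial_def by auto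
        then have "i \<in> J" unfolding J(1) group_subset_iff by blast
        then have "proj (G i) (x k) \<noteq> 0" by (rule nz)
        then have "i \<in> nonzero_groups k" "i \<notin> nonzero_groups (Suc k)"
          using i unfolding nonzero_groups_def by auto
        then show ?thesis using cg_trial_nonzero_groups[OF True] by blast
      next
        case nocut: False
        have "F (x (Suc k)) \<le> F (x k) + eta C * xi C ^ j * (?g \<bullet> d k)"
          using j(1,3) nocut unfolding cg_accept_def cg_trial_def J(3) by simp
        moreover have "eta C * (xi C * t0) * (\<epsilon>\<^sup>2 / \<mu>_max) \<le> eta C * xi C ^ j * (- (?g \<bullet> d k))"
          using xij gd pb mm \<epsilon> t0 by (intro mult_mono) auto
        moreover have "c \<le> eta C * (xi C * t0) * (\<epsilon>\<^sup>2 / \<mu>_max)" unfolding c_def by simp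
        ultimately show ?thesis by (simp add: algebra_simps)
      qed
    qed
  qed
qed

section \<open>Convergence of values and of iterates\<close>

lemma F_tendsto: "(\<lambda>k. F (x k)) \<longlonglongrightarrow> F x_star"
proof -
  obtain l where l: "(\<lambda>k. F (x k)) \<longlonglongrightarrow> l" "\<And>k. l \<le> F (x k)"
    using decseq_convergent[OF decseq_F, of "F x_star"] F_x_star_le by blast
  have "F x_star \<le> l"
    using l(1) F_x_star_le by (intro tendsto_lowerbound[OF l(1)]) auto
  moreover have "\<not> F x_star < l"
  proof
    assume less: "F x_star < l"
    obtain D M where D: "D > 0" "\<And>k. norm (s k) \<le> D" "\<And>k. norm (x k) \<le> D" "\<And>k. norm (grad f (x k)) \<le> D"
      using trial_bounds by metis
    obtain K where K: "\<And>k. k \<ge> K \<Longrightarrow> \<alpha> k = \<alpha> K" using alpha_eventually_constant by blast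
    \<comment> \<open>Uniform bound of the bracket in \<open>F_gap_le_step\<close>; the denominator
      is fixed because \<alpha> no longer changes.\<close>
    define E where "E = lam_sum + (D + D + norm x_star) / \<alpha> K + D"
    have E: "E > 0" unfolding E_def using lam_sum_pos D(1) alpha_bounds[of K] by (simp add: add_pos_nonneg)
    have far: "(l - F x_star) / E \<le> norm (s k)" if "k \<ge> K" for k
    proof -
      have "l - F x_star \<le> F (x k) - F x_star" using l(2) by simp
      also have "\<dots> \<le> norm (s k) * (lam_sum + norm (x k + s k - x_star) / \<alpha> k + norm (grad f (x k)))"
        unfolding s_eq by (rule F_gap_le_step) (rule alpha_bounds)
      also have "\<dots> \<le> norm (s k) * E"
      proof (intro mult_left_mono)
        have "norm (x k + s k - x_star) \<le> D + D + norm x_star"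
          using norm_triangle_ineq4[of "x k + s k" x_star] norm_triangle_ineq[of "x k" "s k"] D(2,3)[of k]
          by linarith
        then show "lam_sum + norm (x k + s k - x_star) / \<alpha> k + norm (grad f (x k)) \<le> E"
          unfolding E_def K[OF that] using alpha_bounds[of K] D(4)[of k]
          by (intro add_mono divide_right_mono) auto
      qed simp
      finally show ?thesis using E by (simp add: divide_le_eq)
    qed
    have "(l - F x_star) / E > 0" using less E by simp
    then obtain c where c: "c > 0" "\<And>k. (l - F x_star) / E \<le> norm (s k) \<Longrightarrow> \<alpha> (Suc k) = \<alpha> k \<Longrightarrow>
      F (x (Suc k)) \<le> F (x k) - c \<or> nonzero_groups (Suc k) \<subset> nonzero_groups k"
      using sufficient_progress by blast
    have "(\<lambda>k. F (x k) - F (x (Suc k))) \<longlonglongrightarrow> l - l"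
      by (intro tendsto_diff l(1) LIMSEQ_Suc)
    then have "\<forall>\<^sub>F k in sequentially. F (x k) - F (x (Suc k)) < c"
      using c(1) by (intro order_tendstoD(2)) auto
    then obtain K' where K': "\<And>k. k \<ge> K' \<Longrightarrow> F (x k) - F (x (Suc k)) < c"
      unfolding eventually_sequentially by blast
    let ?K = "max K K'"
    have drop: "nonzero_groups (Suc k) \<subset> nonzero_groups k" if "k \<ge> ?K" for k
    proof -
      have "\<alpha> (Suc k) = \<alpha> k" using K[of k] K[of "Suc k"] that by simp
      then show ?thesis using c(2)[OF far, of k] K'[of k] that by force
    qed
    \<comment> \<open>Each strict inclusion costs at least one group, so it cannot recur
      forever.\<close>
    have "card (nonzero_groups (?K + n)) + n \<le> card (nonzero_groups ?K)" for n
    proof (induction n)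
      case (Suc n)
      have "card (nonzero_groups (Suc (?K + n))) < card (nonzero_groups (?K + n))"
        by (intro psubset_card_mono drop) auto
      then show ?case using Suc by simp
    qed simp
    from this[of "Suc (card (nonzero_groups ?K))"] show False by simp
  qed
  ultimately have "l = F x_star" by simp
  then show ?thesis using l(1) by simp
qed

text \<open>Quadratic growth turns convergence of values into convergence of points.\<close>

lemma x_tendsto: "x \<longlonglongrightarrow> x_star"
proof -
  obtain m where m: "m > 0" "\<And>y. F x_star + m * (norm (y - x_star))\<^sup>2 \<le> F y"
    using F_quadratic_growth x_star by metis
  have "(\<lambda>k. (F (x k) - F x_star) / m) \<longlonglongrightarrow> (F x_star - F x_star) / m"
    by (intro tendsto_divide tendsto_diff F_tendsto tendsto_const) (use m in auto)
  then have "(\<lambda>k. sqrt ((F (x k) - F x_star) / m)) \<longlonglongrightarrow> sqrt 0"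
    by (intro tendsto_real_sqrt) simp
  then have lim: "(\<lambda>k. sqrt ((F (x k) - F x_star) / m)) \<longlonglongrightarrow> 0" by simp
  have "norm (x k - x_star) \<le> sqrt ((F (x k) - F x_star) / m)" for k
    using m(2)[of "x k"] m(1) by (intro real_le_rsqrt) (simp add: field_simps)
  then have "(\<lambda>k. x k - x_star) \<longlonglongrightarrow> 0"
    by (intro Lim_null_comparison[OF _ lim]) auto
  then show ?thesis by (simp add: LIM_zero_iff)
qed

end

section \<open>The reduced problem and identification of the support\<close>

context composite_problem
begin

text \<open>The derivative of \<open>gradF J\<close> composed with the projection onto the subspace
  of \<open>J\<close>. Through this composition the map lives on an open set of the full space, and
  derivatives along a subspace are avoided.\<close>

definition reduced_hess :: "'g set \<Rightarrow> real^'n \<Rightarrow> real^'n \<Rightarrow> real^'n" where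
  "reduced_hess J y v = proj (\<Union>j\<in>J. G j) (hess f (proj (\<Union>j\<in>J. G j) y) *v proj (\<Union>j\<in>J. G j) v)
     + (\<Sum>j\<in>J. lam j *\<^sub>R ((proj (G j) v - (sgn (proj (G j) y) \<bullet> proj (G j) v) *\<^sub>R sgn (proj (G j) y))
          /\<^sub>R norm (proj (G j) y)))"

lemma gradF_proj_Union:
  "gradF J (proj (\<Union>j\<in>J. G j) y)
    = proj (\<Union>j\<in>J. G j) (grad f (proj (\<Union>j\<in>J. G j) y)) + (\<Sum>j\<in>J. lam j *\<^sub>R sgn (proj (G j) y))"
  unfolding gradF_def by (intro arg_cong2[where f = plus] refl sum.cong) (simp add: group_Int_Union)

lemma has_derivative_gradF_proj:
  assumes nz: "\<And>j. j \<in> J \<Longrightarrow> proj (G j) y \<noteq> 0"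
  shows "((\<lambda>y. gradF J (proj (\<Union>j\<in>J. G j) y)) has_derivative reduced_hess J y) (at y)"
proof -
  let ?P = "proj (\<Union>j\<in>J. G j)"
  note proj_der = bounded_linear_imp_has_derivative[OF bounded_linear_proj]
  have "((\<lambda>y. grad f (?P y)) has_derivative (\<lambda>v. hess f (?P y) *v ?P v)) (at y)"
    by (rule has_derivative_compose[where f = ?P and f' = ?P, OF proj_der has_derivative_grad_f])
  then have "((\<lambda>y. ?P (grad f (?P y))) has_derivative (\<lambda>v. ?P (hess f (?P y) *v ?P v))) (at y)"
    by (rule bounded_linear.has_derivative[OF bounded_linear_proj])
  moreover have "((\<lambda>y. \<Sum>j\<in>J. lam j *\<^sub>R sgn (proj (G j) y)) has_derivative
      (\<lambda>v. \<Sum>j\<in>J. lam j *\<^sub>R ((proj (G j) v - (sgn (proj (G j) y) \<bullet> proj (G j) v) *\<^sub>R sgn (proj (G j) y))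
          /\<^sub>R norm (proj (G j) y)))) (at y)"
  proof (rule has_derivative_sum)
    fix j assume j: "j \<in> J"
    show "((\<lambda>y. lam j *\<^sub>R sgn (proj (G j) y)) has_derivative
      (\<lambda>v. lam j *\<^sub>R ((proj (G j) v - (sgn (proj (G j) y) \<bullet> proj (G j) v) *\<^sub>R sgn (proj (G j) y))
          /\<^sub>R norm (proj (G j) y)))) (at y)"
      by (rule has_derivative_scaleR_right)
         (rule has_derivative_compose[where f = "proj (G j)" and f' = "proj (G j)", OF proj_der
            has_derivative_sgn[OF nz[OF j]]])
  qed
  ultimately show ?thesis
    unfolding gradF_proj_Union reduced_hess_def by (rule has_derivative_add)
qed

text \<open>The smooth part contributes \<open>M\<close>; \<open>sgn_derivative_lipschitz\<close>
  contributes the rest, weighted by the \<open>lam j\<close>.\<close>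

lemma reduced_hess_lipschitz:
  assumes M: "norm (hess f (proj (\<Union>j\<in>J. G j) y) - hess f (proj (\<Union>j\<in>J. G j) z)) \<le> M * norm (y - z)"
    and m: "m > 0" "\<And>j. j \<in> J \<Longrightarrow> m \<le> norm (proj (G j) y)" "\<And>j. j \<in> J \<Longrightarrow> m \<le> norm (proj (G j) z)"
  shows "norm (reduced_hess J y v - reduced_hess J z v) \<le> (M + lam_sum * (6 / m\<^sup>2)) * norm (y - z) * norm v"
proof -
  let ?P = "proj (\<Union>j\<in>J. G j)"
  define T where "T = (\<lambda>j y. (proj (G j) v - (sgn (proj (G j) y) \<bullet> proj (G j) v) *\<^sub>R sgn (proj (G j) y))
          /\<^sub>R norm (proj (G j) y))"
  have "reduced_hess J y v - reduced_hess J z v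
      = ?P ((hess f (?P y) - hess f (?P z)) *v ?P v) + (\<Sum>j\<in>J. lam j *\<^sub>R (T j y - T j z))"
    unfolding reduced_hess_def T_def
    by (simp add: matrix_vector_mult_diff_rdistrib proj_diff sum_subtractf scaleR_diff_right)
  also have "norm \<dots> \<le> norm (?P ((hess f (?P y) - hess f (?P z)) *v ?P v))
      + norm (\<Sum>j\<in>J. lam j *\<^sub>R (T j y - T j z))"
    by (rule norm_triangle_ineq)
  also have "\<dots> \<le> M * norm (y - z) * norm v + lam_sum * (6 / m\<^sup>2 * norm (y - z) * norm v)"
  proof (rule add_mono)
    have "norm (?P ((hess f (?P y) - hess f (?P z)) *v ?P v))
        \<le> norm (hess f (?P y) - hess f (?P z)) * norm (?P v)"
      by (rule order_trans[OF norm_proj_le norm_matrix_vector_mult_le])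
    also have "\<dots> \<le> (M * norm (y - z)) * norm v"
      using M by (intro mult_mono norm_proj_le) (auto intro: order_trans[OF norm_ge_zero])
    finally show "norm (?P ((hess f (?P y) - hess f (?P z)) *v ?P v)) \<le> M * norm (y - z) * norm v" .
    have "norm (lam j *\<^sub>R (T j y - T j z)) \<le> lam j * (6 / m\<^sup>2 * norm (y - z) * norm v)" if "j \<in> J" for j
    proof -
      have "norm (T j y - T j z) \<le> 6 / m\<^sup>2 * norm (proj (G j) y - proj (G j) z) * norm (proj (G j) v)"
        unfolding T_def by (intro sgn_derivative_lipschitz m that)
      also have "\<dots> \<le> 6 / m\<^sup>2 * norm (y - z) * norm v"
        unfolding proj_diff[symmetric] by (intro mult_mono norm_proj_le) auto
      finally have "lam j * norm (T j y - T j z) \<le> lam j * (6 / m\<^sup>2 * norm (y - z) * norm v)"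
        using lam_pos[of j] by (intro mult_left_mono) auto
      then show ?thesis using lam_pos[of j] by simp
    qed
    then have "norm (\<Sum>j\<in>J. lam j *\<^sub>R (T j y - T j z)) \<le> (\<Sum>j\<in>J. lam j * (6 / m\<^sup>2 * norm (y - z) * norm v))"
      by (intro sum_norm_le)
    also have "\<dots> \<le> (\<Sum>j\<in>UNIV. lam j * (6 / m\<^sup>2 * norm (y - z) * norm v))"
      using lam_pos by (intro sum_mono2) (auto simp: less_imp_le)
    also have "\<dots> = lam_sum * (6 / m\<^sup>2 * norm (y - z) * norm v)"
      unfolding lam_sum_def by (rule sum_distrib_right[symmetric])
    finally show "norm (\<Sum>j\<in>J. lam j *\<^sub>R (T j y - T j z)) \<le> lam_sum * (6 / m\<^sup>2 * norm (y - z) * norm v)" .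
  qed
  also have "\<dots> = (M + lam_sum * (6 / m\<^sup>2)) * norm (y - z) * norm v"
    unfolding distrib_right mult.assoc ..
  finally show ?thesis .
qed

lemma hess_on_reduced:
  assumes U: "U = (\<Union>j\<in>J. G j)" and y: "proj (- U) y = 0"
    and nz: "\<And>j. j \<in> J \<Longrightarrow> proj (G j) y \<noteq> 0"
  shows "hess_on U F y *v v = reduced_hess J y v"
proof -
  let ?\<phi> = "\<lambda>z. F (proj (- U) y + proj U z)"
  let ?N = "\<Inter>j\<in>J. {z. proj (G j) z \<noteq> 0}"
  have "open {z. proj (G j) z \<noteq> 0}" for j
  proof -
    have "continuous_on UNIV (proj (G j))"
      by (intro linear_continuous_on bounded_linear_proj)
    then have "open (proj (G j) -` (- {0}))"
      by (intro open_vimage) auto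
    then show ?thesis by (simp add: vimage_def)
  qed
  then have "open ?N" by (intro open_INT) auto
  moreover have "y \<in> ?N" using nz by blast
  moreover have "grad ?\<phi> z = gradF J (proj U z)" if "z \<in> ?N" for z
    using grad_unique[OF GDERIV_F_on[OF _ U, where y = z and w = y]] that y by auto
  ultimately have "(grad ?\<phi> has_derivative reduced_hess J y) (at y)"
    by (intro has_derivative_transform_within_open[OF has_derivative_gradF_proj[OF nz, folded U]]) (auto simp: U)
  moreover from this have "(grad ?\<phi> has_derivative (\<lambda>h. jacobian (grad ?\<phi>) (at y) *v h)) (at y)"
    unfolding jacobian_works[symmetric] by (rule differentiableI)
  ultimately have "reduced_hess J y = (\<lambda>h. jacobian (grad ?\<phi>) (at y) *v h)"
    by (rule has_derivative_unique)
  then show ?thesis unfolding hess_on_def hess_def by metis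
qed

end

context composite_run
begin

section \<open>Optimality at the minimizer\<close>

definition S_star :: "'g set" where "S_star = {i. proj (G i) x_star \<noteq> 0}"

definition U_star :: "'n set" where "U_star = (\<Union>i\<in>S_star. G i)"

lemma proj_U_star: "proj U_star x_star = x_star"
proof -
  have "proj (G i) (proj U_star x_star) = proj (G i) x_star" for i
    unfolding U_star_def proj_group_proj_Union by (simp add: S_star_def)
  then show ?thesis using vec_eq_group_iff by blast
qed

lemma x_star_nz: "i \<in> S_star \<Longrightarrow> proj (G i) x_star \<noteq> 0"
  unfolding S_star_def by blast

lemma GDERIV_reduced:
  assumes "\<And>j. j \<in> S_star \<Longrightarrow> proj (G j) y \<noteq> 0"
  shows "GDERIV (\<lambda>y. F (proj U_star y)) y :> gradF S_star (proj U_star y)"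
  using GDERIV_F_on[OF assms U_star_def, where w = 0] by simp

text \<open>\<open>F\<close> need not be differentiable at \<open>x_star\<close>, but
  \<open>F\<close> after projection onto the support is, and \<open>x_star\<close> still minimizes
  it; Fermat's rule is applied to this composition.\<close>

lemma gradF_x_star: "gradF S_star x_star = 0"
proof -
  have "((\<lambda>y. F (proj U_star y)) has_derivative (\<lambda>h. h \<bullet> gradF S_star x_star)) (at x_star)"
    using GDERIV_reduced[OF x_star_nz] unfolding gderiv_def proj_U_star .
  then have "(\<lambda>h. h \<bullet> gradF S_star x_star) = (\<lambda>h. 0)"
    by (rule has_derivative_local_min) (simp add: proj_U_star F_x_star_le)
  then show ?thesis by (metis inner_eq_zero_iff)
qed

lemma grad_x_star:
  assumes "i \<in> S_star"
  shows "proj (G i) (grad f x_star) = - lam i *\<^sub>R sgn (proj (G i) x_star)"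
proof -
  have "gradF {i} x_star = proj (\<Union>j\<in>{i}. G j) (gradF S_star x_star)"
    using assms by (intro proj_gradF[symmetric]) auto
  also have "\<dots> = 0"
    unfolding gradF_x_star by simp
  finally have "proj (G i) (grad f x_star) + lam i *\<^sub>R sgn (proj (G i) x_star) = 0"
    by (simp add: gradF_def)
  then show ?thesis by (simp add: eq_neg_iff_add_eq_0)
qed

lemma grad_tendsto: "(\<lambda>k. grad f (x k)) \<longlonglongrightarrow> grad f x_star"
  using continuous_grad_f x_tendsto continuous_on_tendsto_compose[of UNIV "grad f"] by auto

lemma gradF_tendsto:
  assumes "J \<subseteq> S_star"
  shows "(\<lambda>k. gradF J (x k)) \<longlonglongrightarrow> 0"
proof -
  have "(\<lambda>k. gradF J (x k)) \<longlonglongrightarrow> gradF J x_star"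
    unfolding gradF_def
    by (intro tendsto_add tendsto_proj grad_tendsto tendsto_sum tendsto_scaleR tendsto_const
        tendsto_sgn x_tendsto) (use assms x_star_nz in auto)
  moreover have "gradF J x_star = 0"
    using proj_gradF[OF assms, of x_star] gradF_x_star by simp
  ultimately show ?thesis by simp
qed

text \<open>On a ball so small that the support groups stay away from zero, both the smooth part and
  the norms have Lipschitz second derivatives.\<close>

lemma reduced_problem_smooth:
  assumes "\<exists>\<epsilon>>0. \<exists>M. M-lipschitz_on (ball x_star \<epsilon>) (hess f)"
  obtains \<epsilon> M where "\<epsilon> > 0" "M \<ge> 0"
    "\<And>y j. y \<in> ball x_star \<epsilon> \<Longrightarrow> j \<in> S_star \<Longrightarrow> proj (G j) y \<noteq> 0"
    "\<And>y z v. y \<in> ball x_star \<epsilon> \<Longrightarrow> z \<in> ball x_star \<epsilon> \<Longrightarrow>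
      norm (reduced_hess S_star y v - reduced_hess S_star z v) \<le> M * norm (y - z) * norm v"
proof -
  obtain e L where e: "e > 0" "L-lipschitz_on (ball x_star e) (hess f)" using assms by blast
  \<comment> \<open>At most half the smallest support norm, so points within \<open>m\<close> of
    \<open>x_star\<close> keep norm at least \<open>m\<close> in each support group; the entry 1
    covers an empty support.\<close>
  define m where "m = Min (insert 1 ((\<lambda>i. norm (proj (G i) x_star) / 2) ` S_star))"
  have m: "m > 0" "\<And>i. i \<in> S_star \<Longrightarrow> 2 * m \<le> norm (proj (G i) x_star)"
  proof -
    show "m > 0" unfolding m_def using x_star_nz by (subst Min_gr_iff) auto
    fix i assume "i \<in> S_star"
    then have "m \<le> norm (proj (G i) x_star) / 2" unfolding m_def by (intro Min_le) auto
    then show "2 * m \<le> norm (proj (G i) x_star)" by simp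
  qed
  have far: "m \<le> norm (proj (G i) y)" if "y \<in> ball x_star (min e m)" "i \<in> S_star" for y i
  proof -
    have "norm (proj (G i) (x_star - y)) \<le> norm (x_star - y)" by (rule norm_proj_le)
    also have "\<dots> < m" using that by (simp add: dist_norm)
    finally show ?thesis
      using m(2)[OF that(2)] norm_triangle_ineq2[of "proj (G i) x_star" "proj (G i) y"]
      by (simp add: proj_diff)
  qed
  show thesis
  proof (rule that[of "min e m" "L + lam_sum * (6 / m\<^sup>2)"])
    show "min e m > 0" using e m by simp
    show "L + lam_sum * (6 / m\<^sup>2) \<ge> 0"
      using lipschitz_on_nonneg[OF e(2)] lam_sum_pos by simp
    show "proj (G j) y \<noteq> 0" if "y \<in> ball x_star (min e m)" "j \<in> S_star" for y j
      using far[OF that] m(1) by auto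
    fix y z v assume y: "y \<in> ball x_star (min e m)" and z: "z \<in> ball x_star (min e m)"
    show "norm (reduced_hess S_star y v - reduced_hess S_star z v)
        \<le> (L + lam_sum * (6 / m\<^sup>2)) * norm (y - z) * norm v"
    proof (rule reduced_hess_lipschitz[of S_star, folded U_star_def])
      have U: "proj U_star w \<in> ball x_star e" if "w \<in> ball x_star (min e m)" for w
      proof -
        have "norm (proj U_star (x_star - w)) \<le> norm (x_star - w)" by (rule norm_proj_le)
        then show ?thesis using that by (simp add: proj_diff proj_U_star dist_norm)
      qed
      have "norm (hess f (proj U_star y) - hess f (proj U_star z)) \<le> L * norm (proj U_star (y - z))"
        using lipschitz_onD[OF e(2) U[OF y] U[OF z]] by (simp add: dist_norm proj_diff)
      also have "\<dots> \<le> L * norm (y - z)"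
        using lipschitz_on_nonneg[OF e(2)] by (intro mult_left_mono norm_proj_le)
      finally show "norm (hess f (proj U_star y) - hess f (proj U_star z)) \<le> L * norm (y - z)" .
    qed (use m far y z in auto)
  qed
qed

text \<open>At \<open>x_star\<close> the thresholding tests are strict: in a vanishing group the
  argument has norm below \<open>a * lam i\<close>, in a support group its norm is the group norm
  plus \<open>a * lam i\<close>. Strict inequalities pass to the iterates, and the remaining CG
  conditions hold because the reduced gradients tend to 0.\<close>

lemma eventually_support_identified:
  assumes nondegenerate: "\<And>i. proj (G i) x_star = 0 \<Longrightarrow> norm (proj (G i) (grad f x_star)) < lam i"
  shows "\<forall>\<^sub>F k in sequentially. cg_set C G F (x k) (s k) = U_star \<and>
    (\<forall>i. i \<notin> S_star \<longrightarrow> proj (G i) (x k + s k) = 0)"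
proof -
  obtain K where K: "\<And>k. k \<ge> K \<Longrightarrow> \<alpha> k = \<alpha> K" using alpha_eventually_constant by blast
  define a where "a = \<alpha> K"
  have a: "a > 0" unfolding a_def by (rule alpha_bounds)
  \<comment> \<open>A single final value of \<alpha> makes the argument of the proximal map
    converge.\<close>
  have ev_a: "\<forall>\<^sub>F k in sequentially. \<alpha> k = a"
    unfolding a_def eventually_sequentially using K by blast
  have z: "(\<lambda>k. norm (proj (G i) (x k - a *\<^sub>R grad f (x k)))) \<longlonglongrightarrow> norm (proj (G i) (x_star - a *\<^sub>R grad f x_star))" for i
    by (intro tendsto_norm tendsto_proj tendsto_diff tendsto_scaleR tendsto_const x_tendsto grad_tendsto)
  have px: "(\<lambda>k. norm (proj (G i) (x k))) \<longlonglongrightarrow> norm (proj (G i) x_star)" for i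
    by (intro tendsto_norm tendsto_proj x_tendsto)
  have out: "\<forall>\<^sub>F k in sequentially. \<forall>i. i \<notin> S_star \<longrightarrow> proj (G i) (x k + s k) = 0"
  proof (rule eventually_all_finite)
    fix i
    show "\<forall>\<^sub>F k in sequentially. i \<notin> S_star \<longrightarrow> proj (G i) (x k + s k) = 0"
    proof (cases "i \<in> S_star")
      case False
      then have 0: "proj (G i) x_star = 0" unfolding S_star_def by simp
      have "norm (proj (G i) (x_star - a *\<^sub>R grad f x_star)) < a * lam i"
        using nondegenerate[OF 0] a by (simp add: proj_diff proj_scaleR 0)
      from order_tendstoD(2)[OF z this] ev_a show ?thesis
        by eventually_elim (use a in \<open>simp add: s_eq proj_add_step_eq_0_iff\<close>)
    qed simp
  qed
  have inn: "\<forall>\<^sub>F k in sequentially. \<forall>i\<in>S_star. proj (G i) (x k) \<noteq> 0 \<and> proj (G i) (x k + s k) \<noteq> 0 \<and>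
      kappa1 C * norm (gradF {i} (x k)) \<le> norm (proj (G i) (x k)) \<and>
      kappa2 C * norm (gradF S_star (x k)) powr pexp C \<le> norm (proj (G i) (x k))"
  proof (rule eventually_ball_finite)
    show "\<forall>i\<in>S_star. \<forall>\<^sub>F k in sequentially. proj (G i) (x k) \<noteq> 0 \<and> proj (G i) (x k + s k) \<noteq> 0 \<and>
      kappa1 C * norm (gradF {i} (x k)) \<le> norm (proj (G i) (x k)) \<and>
      kappa2 C * norm (gradF S_star (x k)) powr pexp C \<le> norm (proj (G i) (x k))"
    proof
      fix i assume i: "i \<in> S_star"
      let ?p = "proj (G i) x_star"
      have p: "0 < norm ?p" using x_star_nz[OF i] by simp
      have "proj (G i) (x_star - a *\<^sub>R grad f x_star) = (1 + a * lam i / norm ?p) *\<^sub>R ?p"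
        unfolding proj_diff proj_scaleR grad_x_star[OF i] sgn_div_norm
        by (simp add: scaleR_add_left divide_inverse mult.assoc)
      then have "norm (proj (G i) (x_star - a *\<^sub>R grad f x_star)) = \<bar>1 + a * lam i / norm ?p\<bar> * norm ?p"
        by (simp only: norm_scaleR)
      also have "\<dots> = (1 + a * lam i / norm ?p) * norm ?p"
        using a lam_pos[of i] by (simp add: add_nonneg_nonneg less_imp_le)
      also have "\<dots> = norm ?p + a * lam i"
        using p by (simp add: distrib_right)
      finally have "a * lam i < norm (proj (G i) (x_star - a *\<^sub>R grad f x_star))"
        using p by simp
      note 1 = order_tendstoD(1)[OF z this]
      \<comment> \<open>Half the limiting norm separates the group norm from the two gradient terms
        that tend to 0.\<close>
      have "0 < norm ?p / 2" "norm ?p / 2 < norm ?p" using p by auto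
      note 2 = order_tendstoD(1)[OF px this(2)]
      have "(\<lambda>k. kappa1 C * norm (gradF {i} (x k))) \<longlonglongrightarrow> kappa1 C * norm (0::real^'n)"
        by (intro tendsto_mult tendsto_const tendsto_norm gradF_tendsto) (use i in auto)
      then have "(\<lambda>k. kappa1 C * norm (gradF {i} (x k))) \<longlonglongrightarrow> 0" by simp
      note 3 = order_tendstoD(2)[OF this \<open>0 < norm ?p / 2\<close>]
      have "(\<lambda>k. norm (gradF S_star (x k)) powr pexp C) \<longlonglongrightarrow> 0 powr pexp C"
        using param_bounds
        by (intro tendsto_powr' tendsto_norm_zero gradF_tendsto tendsto_const) auto
      then have "(\<lambda>k. kappa2 C * norm (gradF S_star (x k)) powr pexp C) \<longlonglongrightarrow> kappa2 C * (0 powr pexp C)"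
        by (intro tendsto_mult tendsto_const)
      then have "(\<lambda>k. kappa2 C * norm (gradF S_star (x k)) powr pexp C) \<longlonglongrightarrow> 0" by simp
      note 4 = order_tendstoD(2)[OF this \<open>0 < norm ?p / 2\<close>]
      from 1 2 3 4 ev_a
      show "\<forall>\<^sub>F k in sequentially. proj (G i) (x k) \<noteq> 0 \<and> proj (G i) (x k + s k) \<noteq> 0 \<and>
        kappa1 C * norm (gradF {i} (x k)) \<le> norm (proj (G i) (x k)) \<and>
        kappa2 C * norm (gradF S_star (x k)) powr pexp C \<le> norm (proj (G i) (x k))"
      proof eventually_elim
        case (elim k)
        then have "proj (G i) (x k + s k) \<noteq> 0"
          using a by (simp add: s_eq proj_add_step_eq_0_iff)
        then show ?case using elim p by force
      qed
    qed
  qed simp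
  from out inn show ?thesis
  proof eventually_elim
    case (elim k)
    have bar: "cg_bar_index C (x k) (s k) = S_star"
      using elim unfolding cg_bar_index_def by blast
    have "J_cg k = S_star"
      using elim unfolding cg_index_def bar by blast
    then have "cg_set C G F (x k) (s k) = U_star"
      unfolding cg_set_eq U_star_def by simp
    then show ?case using elim by blast
  qed
qed

lemma eventually_subspace:
  assumes nondegenerate: "\<And>i. proj (G i) x_star = 0 \<Longrightarrow> norm (proj (G i) (grad f x_star)) < lam i"
    and I_full: "\<forall>\<^sub>F k in sequentially.
          I k = (if k \<in> K_cg then cg_set C G F (x k) (s k) else pg_set C G F (x k) (s k))"
  shows "\<forall>\<^sub>F k in sequentially. k \<in> K_cg \<and> proj (- U_star) (x k) = 0 \<and> I k = U_star
    \<and> cg_set C G F (x k) (s k) = U_star"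
proof -
  obtain K where K: "\<And>k. k \<ge> K \<Longrightarrow> \<alpha> k = \<alpha> K" using alpha_eventually_constant by blast
  obtain N where N: "\<And>k. k \<ge> N \<Longrightarrow> cg_set C G F (x k) (s k) = U_star"
    "\<And>k i. k \<ge> N \<Longrightarrow> i \<notin> S_star \<Longrightarrow> proj (G i) (x k + s k) = 0"
    "\<And>k. k \<ge> N \<Longrightarrow> I k = (if k \<in> K_cg then cg_set C G F (x k) (s k) else pg_set C G F (x k) (s k))"
    using eventually_conj[OF eventually_support_identified[OF nondegenerate] I_full]
    unfolding eventually_sequentially by blast
  define M where "M = max K N"
  have Uc: "- U_star = (\<Union>i\<in>- S_star. G i)"
    unfolding U_star_def by (rule Compl_Union_groups)
  have Ik: "I k = (if k \<in> K_cg then U_star else - U_star)" if "k \<ge> M" for k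
    using N(1,3)[of k] that unfolding M_def pg_set_def by simp
  have ps: "proj (- U_star) (x k + s k) = 0" if "k \<ge> M" for k
    unfolding Uc proj_Union using N(2)[of k] that unfolding M_def by (intro sum.neutral) auto
  have stay: "proj (- U_star) (x (Suc k)) = proj (- U_star) (x k)" if k: "k \<ge> M" "k \<in> K_cg" for k
  proof -
    obtain J where J: "I k = (\<Union>j\<in>J. G j)" "grad_on (I k) F (x k) = gradF J (x k)"
      using cg_groups[OF k(2)] by metis
    have "- U_star \<inter> I k = {}" using Ik[OF k(1)] k(2) by simp
    then show ?thesis
      using cg_trial_obtain[OF k(2)] proj_cg_trial_disjoint[OF cg_direction_props(3)[OF k(2) J]] by metis
  qed
  \<comment> \<open>On the subspace \<open>chi_pg\<close> is 0, and a tie of the two measures counts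
    as CG.\<close>
  have zero_cg: "k \<in> K_cg" if k: "k \<ge> M" "proj (- U_star) (x k) = 0" for k
  proof -
    have "proj (- U_star) (s k) = 0" using ps[OF k(1)] k(2) by (simp add: proj_add)
    then have "chi_pg C G F (x k) (s k) = 0"
      using N(1)[of k] k(1) unfolding chi_pg_def pg_set_def M_def by simp
    then show ?thesis unfolding K_cg_iff by (simp add: chi_cg_def)
  qed
  have keep: "proj (- U_star) (x k) = 0" if "proj (- U_star) (x k0) = 0" "k0 \<ge> M" "k \<ge> k0" for k0 k
    using that(3)
  proof (induction k rule: dec_induct)
    case (step n)
    then have "n \<in> K_cg" using zero_cg[of n] that(2) by simp
    then show ?case using stay[of n] step that(2) by simp
  qed (rule that(1))
  have "\<exists>k0\<ge>M. proj (- U_star) (x k0) = 0"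
  proof (cases "\<exists>k\<ge>M. k \<notin> K_cg")
    case True
    then obtain k where k: "k \<ge> M" "k \<notin> K_cg" by blast
    \<comment> \<open>An unchanged \<alpha> means a full PG step over the whole complement of the
      support, so the vanishing of \<open>x k + s k\<close> there carries over to the next
      iterate.\<close>
    have "\<alpha> (Suc k) = \<alpha> k" using K[of k] K[of "Suc k"] k(1) unfolding M_def by simp
    then have "x (Suc k) = x k + proj (- U_star) (s k)"
      using pg_iterate(1)[OF k(2)] Ik[OF k(1)] k(2) by simp
    then have "proj (- U_star) (x (Suc k)) = proj (- U_star) (x k + s k)"
      by (simp add: proj_add)
    then show ?thesis using ps[OF k(1)] k(1) by (intro exI[of _ "Suc k"]) simp
  next
    case False
    \<comment> \<open>Without any PG iteration the part off the support is constant; it also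
      converges to that of \<open>x_star\<close>, which is 0, so it is 0 already.\<close>
    have "proj (- U_star) (x k) = proj (- U_star) (x M)" if "k \<ge> M" for k
      using that
    proof (induction k rule: dec_induct)
      case (step n)
      then show ?case using False stay[of n] by simp
    qed simp
    then have "\<forall>\<^sub>F k in sequentially. proj (- U_star) (x k) = proj (- U_star) (x M)"
      unfolding eventually_sequentially by blast
    then have "(\<lambda>k. proj (- U_star) (x k)) \<longlonglongrightarrow> proj (- U_star) (x M)"
      by (rule tendsto_eventually)
    moreover have "(\<lambda>k. proj (- U_star) (x k)) \<longlonglongrightarrow> proj (- U_star) x_star"
      by (intro tendsto_proj x_tendsto)
    ultimately have "proj (- U_star) (x M) = proj (- U_star) x_star"
      by (rule LIMSEQ_unique)
    also have "\<dots> = proj (- U_star) (proj U_star x_star)"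
      unfolding proj_U_star ..
    also have "\<dots> = 0" by simp
    finally show ?thesis by blast
  qed
  then obtain k0 where k0: "k0 \<ge> M" "proj (- U_star) (x k0) = 0" by blast
  show ?thesis
    unfolding eventually_sequentially
  proof (intro exI[of _ k0] allI impI)
    fix k assume k: "k \<ge> k0"
    then have z: "proj (- U_star) (x k) = 0" using keep[OF k0(2,1)] by blast
    have "k \<ge> M" using k k0 by simp
    then show "k \<in> K_cg \<and> proj (- U_star) (x k) = 0 \<and> I k = U_star \<and> cg_set C G F (x k) (s k) = U_star"
      using z zero_cg[of k] Ik[of k] N(1)[of k] unfolding M_def by simp
  qed
qed

end

section \<open>The inexact Newton phase\<close>

context composite_run
begin

text \<open>The inexactness of the Newton system, normalised so that the residual is at most
  \<open>newton_error k\<close> times the norm of the gradient.\<close>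

definition newton_error :: "nat \<Rightarrow> real" where
  "newton_error k = \<mu> k * norm (gradF S_star (x k)) powr (qexp C - 1)"

lemma grad_on_U_star:
  assumes "k \<in> K_cg" "I k = U_star"
  shows "grad_on (I k) F (x k) = gradF S_star (x k)"
proof -
  obtain J where J: "I k = (\<Union>j\<in>J. G j)" "grad_on (I k) F (x k) = gradF J (x k)"
    using cg_groups[OF assms(1)] by metis
  have "J = S_star"
    using J(1) assms(2) Union_group_mono[of J S_star] Union_group_mono[of S_star J]
    unfolding U_star_def by simp
  then show ?thesis using J(2) by simp
qed

lemma inexact_newton_residual:
  assumes "k \<in> K_cg" "I k = U_star"
  shows "0 < \<mu> k" "\<mu> k \<le> 1"
    and "norm (H k *v d k + gradF S_star (x k)) \<le> newton_error k * norm (gradF S_star (x k))"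
proof -
  note g = grad_on_U_star[OF assms]
  show "0 < \<mu> k" "\<mu> k \<le> 1"
    using cg_step[OF assms(1)] unfolding cg_iteration_def by auto
  have "norm (H k *v d k + gradF S_star (x k)) \<le> \<mu> k * norm (gradF S_star (x k)) powr qexp C"
    using cg_step[OF assms(1)] unfolding cg_iteration_def cg_direction_def g by blast
  \<comment> \<open>Valid for a zero gradient as well, where both sides are 0.\<close>
  also have "norm (gradF S_star (x k)) powr qexp C
      = norm (gradF S_star (x k)) powr (qexp C - 1) * norm (gradF S_star (x k))"
    using powr_mult_base[of "norm (gradF S_star (x k))" "qexp C - 1"] by (simp add: mult.commute)
  finally show "norm (H k *v d k + gradF S_star (x k)) \<le> newton_error k * norm (gradF S_star (x k))"
    unfolding newton_error_def by (simp add: mult.assoc)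
qed

context
  assumes hess_lipschitz: "\<exists>\<epsilon>>0. \<exists>M. M-lipschitz_on (ball x_star \<epsilon>) (hess f)"
    and nondegenerate:
      "\<And>i. proj (G i) x_star = 0 \<Longrightarrow> norm (proj (G i) (grad f x_star)) < lam i"
    and eta_half: "eta C \<in> {0<..<1 / 2}"
    and I_full: "\<forall>\<^sub>F k in sequentially.
          I k = (if k \<in> K_cg then cg_set C G F (x k) (s k) else pg_set C G F (x k) (s k))"
    and H_hess: "\<forall>\<^sub>F k in sequentially. k \<in> K_cg \<longrightarrow> H k = hess_on (I k) F (x k)"
    and accuracy: "qexp C \<in> {1<..2} \<or>
          qexp C = 1 \<and> (\<mu> \<longlongrightarrow> 0) (inf sequentially (principal K_cg))"
begin

lemma eventually_in_subspace:
  "\<forall>\<^sub>F k in sequentially. k \<in> K_cg \<and> proj (- U_star) (x k) = 0 \<and> I k = U_star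
    \<and> cg_set C G F (x k) (s k) = U_star"
  by (rule eventually_subspace) (fact nondegenerate I_full)+

lemma eventually_newton:
  "\<forall>\<^sub>F k in sequentially. k \<in> K_cg \<and> proj (- U_star) (x k) = 0 \<and> I k = U_star \<and>
     (\<forall>v. H k *v v = reduced_hess S_star (x k) v)"
proof -
  obtain \<epsilon> where \<epsilon>: "\<epsilon> > 0" "\<And>y j. y \<in> ball x_star \<epsilon> \<Longrightarrow> j \<in> S_star \<Longrightarrow> proj (G j) y \<noteq> 0"
    by (rule reduced_problem_smooth[OF hess_lipschitz]) blast
  have "\<forall>\<^sub>F k in sequentially. x k \<in> ball x_star \<epsilon>"
    using x_tendsto \<epsilon>(1) by (auto simp: tendsto_iff dist_commute)
  with eventually_in_subspace H_hess show ?thesis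
  proof eventually_elim
    case (elim k)
    then have "H k = hess_on U_star F (x k)" by simp
    then show ?case
      using elim hess_on_reduced[OF U_star_def, of "x k"] \<epsilon>(2)[of "x k"] by simp
  qed
qed

lemma newton_error_tendsto: "newton_error \<longlonglongrightarrow> 0"
proof -
  have g: "(\<lambda>k. norm (gradF S_star (x k))) \<longlonglongrightarrow> 0"
    by (intro tendsto_norm_zero gradF_tendsto) simp
  have mu: "\<forall>\<^sub>F k in sequentially. 0 < \<mu> k \<and> \<mu> k \<le> 1 \<and> k \<in> K_cg"
    using eventually_in_subspace by eventually_elim (use inexact_newton_residual in blast)
  from accuracy show ?thesis
  proof
    assume q: "qexp C \<in> {1<..2}"
    have "(\<lambda>k. norm (gradF S_star (x k)) powr (qexp C - 1)) \<longlonglongrightarrow> 0 powr (qexp C - 1)"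
      using q by (intro tendsto_powr' g tendsto_const) auto
    then have lim: "(\<lambda>k. norm (gradF S_star (x k)) powr (qexp C - 1)) \<longlonglongrightarrow> 0" by simp
    have "\<forall>\<^sub>F k in sequentially. norm (newton_error k) \<le> norm (gradF S_star (x k)) powr (qexp C - 1)"
      using mu by eventually_elim (auto simp: newton_error_def abs_mult intro: mult_left_le_one_le)
    then show ?thesis by (rule Lim_null_comparison[OF _ lim])
  next
    assume q: "qexp C = 1 \<and> (\<mu> \<longlongrightarrow> 0) (inf sequentially (principal K_cg))"
    \<comment> \<open>All late indices lie in \<open>K_cg\<close>, so the limit along
      \<open>K_cg\<close> is the ordinary limit.\<close>
    have "sequentially \<le> principal K_cg"
      unfolding le_principal using mu by eventually_elim blast
    then have lim: "\<mu> \<longlonglongrightarrow> 0" using q by (simp add: inf_absorb1)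
    \<comment> \<open>Only an inequality although the exponent is 0, because \<open>0 powr 0\<close>
      is 0.\<close>
    have "\<forall>\<^sub>F k in sequentially. norm (newton_error k) \<le> \<mu> k"
      using mu by eventually_elim (use q in \<open>auto simp: newton_error_def\<close>)
    then show ?thesis by (rule Lim_null_comparison[OF _ lim])
  qed
qed

lemma d_tendsto: "d \<longlonglongrightarrow> 0"
proof -
  have "(\<lambda>k. 2 / \<mu>_min * norm (gradF S_star (x k))) \<longlonglongrightarrow> 2 / \<mu>_min * 0"
    by (intro tendsto_mult tendsto_const tendsto_norm_zero gradF_tendsto) simp
  then have lim: "(\<lambda>k. 2 / \<mu>_min * norm (gradF S_star (x k))) \<longlonglongrightarrow> 0" by simp
  have "\<forall>\<^sub>F k in sequentially. norm (d k) \<le> 2 / \<mu>_min * norm (gradF S_star (x k))"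
    using eventually_in_subspace
  proof eventually_elim
    case (elim k)
    then show ?case using cg_direction_props(2)[of k S_star] grad_on_U_star[of k] U_star_def by simp
  qed
  then show ?thesis by (rule Lim_null_comparison[OF _ lim])
qed

text \<open>Substituting the Newton residual into the second-order expansion leaves half of the
  slope along \<open>d k\<close> plus errors of smaller order than the squared gradient norm. The
  slope is at most a fixed negative multiple of that square, so the margin
  \<open>1 / 2 - eta C\<close> absorbs the errors.\<close>

lemma eventually_unit_step:
  "\<forall>\<^sub>F k in sequentially. x (Suc k) = x k + d k"
proof -
  obtain \<epsilon> M where \<epsilon>: "\<epsilon> > 0" "M \<ge> 0"
    "\<And>y j. y \<in> ball x_star \<epsilon> \<Longrightarrow> j \<in> S_star \<Longrightarrow> proj (G j) y \<noteq> 0"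
    "\<And>y z v. y \<in> ball x_star \<epsilon> \<Longrightarrow> z \<in> ball x_star \<epsilon> \<Longrightarrow>
      norm (reduced_hess S_star y v - reduced_hess S_star z v) \<le> M * norm (y - z) * norm v"
    by (rule reduced_problem_smooth[OF hess_lipschitz]) blast
  let ?g = "\<lambda>k. gradF S_star (x k)"
  define b where "b = 2 / \<mu>_min"
  have b: "b > 0" unfolding b_def using mu_min by simp
  have mm: "\<mu>_max > 0" using mu_min mu_le by simp
  have xb: "\<forall>\<^sub>F k in sequentially. x k \<in> ball x_star \<epsilon>"
    using x_tendsto \<epsilon>(1) by (auto simp: tendsto_iff dist_commute)
  have "(\<lambda>k. x k + d k) \<longlonglongrightarrow> x_star + 0"
    by (intro tendsto_add x_tendsto d_tendsto)
  then have xdb: "\<forall>\<^sub>F k in sequentially. x k + d k \<in> ball x_star \<epsilon>"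
    using \<epsilon>(1) by (auto simp: tendsto_iff dist_commute)
  \<comment> \<open>The coefficients of the squared gradient norm that come from the residual and
    from the cubic Taylor term.\<close>
  have "(\<lambda>k. 1 / 2 * b * newton_error k + M * b ^ 3 * norm (?g k)) \<longlonglongrightarrow> 1 / 2 * b * 0 + M * b ^ 3 * 0"
    by (intro tendsto_add tendsto_mult tendsto_const newton_error_tendsto tendsto_norm_zero gradF_tendsto) simp
  then have "(\<lambda>k. 1 / 2 * b * newton_error k + M * b ^ 3 * norm (?g k)) \<longlonglongrightarrow> 0" by simp
  moreover have "0 < (1 / 2 - eta C) / \<mu>_max" using eta_half mm by simp
  ultimately have small: "\<forall>\<^sub>F k in sequentially. 1 / 2 * b * newton_error k + M * b ^ 3 * norm (?g k) < (1 / 2 - eta C) / \<mu>_max"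
    by (rule order_tendstoD(2))
  \<comment> \<open>Directions tend to 0 while the support groups keep a positive norm, so the unit
    step reaches no ball.\<close>
  have nocut: "\<forall>\<^sub>F k in sequentially. \<forall>i\<in>S_star. norm (d k) < (1 - sin (theta C)) * norm (proj (G i) (x k))"
  proof (rule eventually_ball_finite)
    show "\<forall>i\<in>S_star. \<forall>\<^sub>F k in sequentially. norm (d k) < (1 - sin (theta C)) * norm (proj (G i) (x k))"
    proof
      fix i assume i: "i \<in> S_star"
      have "(\<lambda>k. (1 - sin (theta C)) * norm (proj (G i) (x k)) - norm (d k))
          \<longlonglongrightarrow> (1 - sin (theta C)) * norm (proj (G i) x_star) - 0"
        by (intro tendsto_diff tendsto_mult tendsto_const tendsto_norm tendsto_proj x_tendsto
            tendsto_norm_zero d_tendsto)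
      moreover have "0 < (1 - sin (theta C)) * norm (proj (G i) x_star) - 0"
        using x_star_nz[OF i] param_bounds by simp
      ultimately have "\<forall>\<^sub>F k in sequentially. 0 < (1 - sin (theta C)) * norm (proj (G i) (x k)) - norm (d k)"
        by (rule order_tendstoD(1))
      then show "\<forall>\<^sub>F k in sequentially. norm (d k) < (1 - sin (theta C)) * norm (proj (G i) (x k))"
        by eventually_elim simp
    qed
  qed simp
  from eventually_newton eventually_in_subspace xb xdb small nocut show ?thesis
  proof eventually_elim
    case (elim k)
    then have k: "k \<in> K_cg" and Ik: "I k = U_star" by auto
    have J: "I k = (\<Union>j\<in>S_star. G j)" "grad_on (I k) F (x k) = gradF S_star (x k)"
      using Ik grad_on_U_star[OF k Ik] unfolding U_star_def by auto
    note dir = cg_direction_props[OF k J]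
    have db: "norm (d k) \<le> b * norm (?g k)" using dir(2) unfolding b_def .
    have ne: "0 \<le> newton_error k"
      unfolding newton_error_def using inexact_newton_residual(1)[OF k Ik] by simp
    have xU: "proj U_star (x k) = x k"
      using proj_decomp[of U_star "x k"] elim by simp
    have dU: "proj U_star (d k) = d k" using dir(3) Ik by simp
    have "F (proj U_star (x k + d k)) \<le> F (proj U_star (x k)) + gradF S_star (proj U_star (x k)) \<bullet> d k
        + 1 / 2 * (d k \<bullet> reduced_hess S_star (x k) (d k)) + M * norm (d k) ^ 3"
    proof (rule second_order_upper_bound[of x_star \<epsilon> "\<lambda>y. F (proj U_star y)" "\<lambda>y. gradF S_star (proj U_star y)"])
      fix z assume z: "z \<in> ball x_star \<epsilon>"
      show "GDERIV (\<lambda>y. F (proj U_star y)) z :> gradF S_star (proj U_star z)"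
        using \<epsilon>(3)[OF z] by (rule GDERIV_reduced)
      show "((\<lambda>y. gradF S_star (proj U_star y)) has_derivative reduced_hess S_star z) (at z)"
        unfolding U_star_def using \<epsilon>(3)[OF z] by (rule has_derivative_gradF_proj)
    qed (use \<epsilon> elim in auto)
    then have 1: "F (x k + d k) \<le> F (x k) + ?g k \<bullet> d k + 1 / 2 * (d k \<bullet> (H k *v d k)) + M * norm (d k) ^ 3"
      using elim by (simp add: proj_add xU dU)
    let ?\<rho> = "H k *v d k + ?g k"
    \<comment> \<open>Inexact Newton identity: the curvature along \<open>d k\<close> is minus the
      slope, up to the residual.\<close>
    have "d k \<bullet> (H k *v d k) = - (?g k \<bullet> d k) + d k \<bullet> ?\<rho>"
      by (simp add: inner_add_right inner_commute)
    moreover have "d k \<bullet> ?\<rho> \<le> b * newton_error k * (norm (?g k))\<^sup>2"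
    proof -
      have "d k \<bullet> ?\<rho> \<le> norm (d k) * norm ?\<rho>" by (rule norm_cauchy_schwarz)
      also have "\<dots> \<le> (b * norm (?g k)) * (newton_error k * norm (?g k))"
        using b by (intro mult_mono db inexact_newton_residual(3)[OF k Ik]) auto
      finally show ?thesis by (simp add: power2_eq_square mult_ac)
    qed
    moreover have "M * norm (d k) ^ 3 \<le> M * b ^ 3 * norm (?g k) * (norm (?g k))\<^sup>2"
    proof -
      have "M * norm (d k) ^ 3 \<le> M * (b * norm (?g k)) ^ 3"
        using \<epsilon>(2) by (intro mult_left_mono power_mono db) auto
      then show ?thesis by (simp add: power2_eq_square power3_eq_cube mult_ac)
    qed
    ultimately have "F (x k + d k) \<le> F (x k) + 1 / 2 * (?g k \<bullet> d k)
        + (1 / 2 * b * newton_error k + M * b ^ 3 * norm (?g k)) * (norm (?g k))\<^sup>2"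
      using 1 unfolding distrib_right by linarith
    also have "(1 / 2 * b * newton_error k + M * b ^ 3 * norm (?g k)) * (norm (?g k))\<^sup>2
        \<le> (1 / 2 - eta C) / \<mu>_max * (norm (?g k))\<^sup>2"
      using elim by (intro mult_right_mono) auto
    also have "\<dots> = (1 / 2 - eta C) * ((norm (?g k))\<^sup>2 / \<mu>_max)" by simp
    also have "\<dots> \<le> (1 / 2 - eta C) * (- (?g k \<bullet> d k))"
      using dir(1) eta_half by (intro mult_left_mono) auto
    finally have armijo: "F (x k + d k) \<le> F (x k) + eta C * (?g k \<bullet> d k)"
      by (simp add: algebra_simps)
    have "ereal 1 < min_tau C G F (cg_set C G F (x k) (s k)) (I k) (x k) (d k)"
    proof (rule less_min_tau)
      fix i assume "G i \<subseteq> I k"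
      then have "i \<in> S_star" unfolding J(1) group_subset_iff .
      then show "1 * norm (d k) < (1 - sin (theta C)) * norm (proj (G i) (x k))"
        using elim by simp
    qed (use param_bounds in auto)
    then have nocut: "\<not> min_tau C G F (cg_set C G F (x k) (s k)) (I k) (x k) (d k) \<le> ereal (xi C ^ 0)"
      unfolding power_0 not_le .
    then have acc: "cg_accept C G F (cg_set C G F (x k) (s k)) (I k) (x k) (d k) 0"
      unfolding cg_accept_def J(2) if_not_P[OF nocut] using armijo by simp
    obtain j where j: "\<And>i. i < j \<Longrightarrow> \<not> cg_accept C G F (cg_set C G F (x k) (s k)) (I k) (x k) (d k) i"
      "x (Suc k) = cg_trial C G F (cg_set C G F (x k) (s k)) (I k) (x k) (d k) j"
      using cg_trial_obtain[OF k] by blast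
    have "j = 0" using j(1)[of 0] acc by blast
    then show ?case using j(2) unfolding cg_trial_def by (simp add: if_not_P[OF nocut, simplified])
  qed
qed

text \<open>The error after the step, multiplied by the Hessian, is the linearization error of the
  gradient between \<open>x k\<close> and \<open>x_star\<close> plus the Newton residual; the lower
  bound on \<open>H k\<close> removes the Hessian. The second estimate holds because the reduced
  gradient is at most a multiple of the distance.\<close>

lemma newton_rate:
  obtains a b where "a \<ge> 0" "b \<ge> 0"
    "\<forall>\<^sub>F k in sequentially. norm (x (Suc k) - x_star)
      \<le> a * (norm (x k - x_star))\<^sup>2 + b * newton_error k * norm (x k - x_star)"
    "\<forall>\<^sub>F k in sequentially. newton_error k \<le> (b * norm (x k - x_star)) powr (qexp C - 1)"
proof -
  obtain \<epsilon> M where \<epsilon>: "\<epsilon> > 0" "M \<ge> 0"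
    "\<And>y j. y \<in> ball x_star \<epsilon> \<Longrightarrow> j \<in> S_star \<Longrightarrow> proj (G j) y \<noteq> 0"
    "\<And>y z v. y \<in> ball x_star \<epsilon> \<Longrightarrow> z \<in> ball x_star \<epsilon> \<Longrightarrow>
      norm (reduced_hess S_star y v - reduced_hess S_star z v) \<le> M * norm (y - z) * norm v"
    by (rule reduced_problem_smooth[OF hess_lipschitz]) blast
  let ?g = "\<lambda>y. gradF S_star (proj U_star y)" and ?A = "reduced_hess S_star"
  have der: "(?g has_derivative ?A z) (at z)" if "z \<in> ball x_star \<epsilon>" for z
    unfolding U_star_def using \<epsilon>(3)[OF that] by (rule has_derivative_gradF_proj)
  have x_in: "x_star \<in> ball x_star \<epsilon>" using \<epsilon>(1) by simp
  have g0: "?g x_star = 0" unfolding proj_U_star by (rule gradF_x_star)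
  note lin = gradient_linearization[of x_star \<epsilon> ?g ?A M, OF der \<epsilon>(4) \<epsilon>(2)]
  have "bounded_linear (?A x_star)" using der[OF x_in] by (rule has_derivative_bounded_linear)
  then obtain B where B: "B > 0" "\<And>v. norm (?A x_star v) \<le> norm v * B"
    using bounded_linear.pos_bounded by blast
  \<comment> \<open>Growth constant of the reduced gradient near \<open>x_star\<close>: the linear
    part there plus the quadratic remainder, one factor of which is at most \<epsilon>.\<close>
  define b0 where "b0 = B + M * \<epsilon>"
  have b0: "b0 > 0" unfolding b0_def using B(1) \<epsilon> by (simp add: add_pos_nonneg)
  have g_le: "norm (?g y) \<le> b0 * norm (y - x_star)" if y: "y \<in> ball x_star \<epsilon>" for y
  proof -
    have "norm (?g y) \<le> norm (?g y - ?g x_star - ?A x_star (y - x_star)) + norm (?A x_star (y - x_star))"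
      unfolding g0 using norm_triangle_ineq[of "?g y - 0 - ?A x_star (y - x_star)" "?A x_star (y - x_star)"] by simp
    also have "\<dots> \<le> M * (norm (y - x_star))\<^sup>2 + norm (y - x_star) * B"
      by (intro add_mono lin y x_in B(2))
    also have "M * (norm (y - x_star))\<^sup>2 \<le> M * (norm (y - x_star) * \<epsilon>)"
      unfolding power2_eq_square using y \<epsilon> by (intro mult_left_mono) (auto simp: dist_norm norm_minus_commute)
    finally show ?thesis unfolding b0_def by (simp add: algebra_simps)
  qed
  have xb: "\<forall>\<^sub>F k in sequentially. x k \<in> ball x_star \<epsilon>"
    using x_tendsto \<epsilon>(1) by (auto simp: tendsto_iff dist_commute)
  show thesis
  \<comment> \<open>One constant serves both estimates: \<open>b0 / \<mu>_min\<close> for the new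
    error and \<open>b0\<close> for the gradient.\<close>
  proof (rule that[of "M / \<mu>_min" "max b0 (b0 / \<mu>_min)"])
    show "0 \<le> M / \<mu>_min" "0 \<le> max b0 (b0 / \<mu>_min)" using \<epsilon> mu_min b0 by auto
    have *: "proj U_star (x k) = x k" if "proj (- U_star) (x k) = 0" for k
      using proj_decomp[of U_star "x k"] that by simp
    show "\<forall>\<^sub>F k in sequentially. norm (x (Suc k) - x_star)
      \<le> M / \<mu>_min * (norm (x k - x_star))\<^sup>2 + max b0 (b0 / \<mu>_min) * newton_error k * norm (x k - x_star)"
      using eventually_newton eventually_unit_step xb
    proof eventually_elim
      case (elim k)
      then have k: "k \<in> K_cg" and Ik: "I k = U_star" by auto
      have xU: "proj U_star (x k) = x k" using * elim by blast
      let ?e = "x k - x_star" and ?v = "x (Suc k) - x_star"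
      have gx: "?g (x k) = gradF S_star (x k)" unfolding xU ..
      have dU: "proj U_star (d k) = d k"
        using cg_direction_props(3)[OF k _ grad_on_U_star[OF k Ik]] Ik unfolding U_star_def by simp
      have v: "?v = ?e + d k" using elim by simp
      have vU: "proj (I k) ?v = ?v"
        unfolding v Ik by (simp add: proj_add proj_diff xU dU proj_U_star)
      have linA: "linear (?A (x k))" using der[of "x k"] elim has_derivative_linear by blast
      have "?A (x k) (x_star - x k) = - ?A (x k) ?e"
        using linear_neg[OF linA, of ?e] by simp
      then have "norm (?A (x k) ?e - ?g (x k)) = norm (?g x_star - ?g (x k) - ?A (x k) (x_star - x k))"
        unfolding g0 by simp
      also have "\<dots> \<le> M * (norm (x_star - x k))\<^sup>2"
        by (rule lin) (use elim x_in in auto)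
      finally have 1: "norm (?A (x k) ?e - ?g (x k)) \<le> M * (norm ?e)\<^sup>2"
        by (simp add: norm_minus_commute)
      have ne: "0 \<le> newton_error k"
        unfolding newton_error_def using inexact_newton_residual(1)[OF k Ik] by simp
      have "norm (H k *v d k + gradF S_star (x k)) \<le> newton_error k * norm (gradF S_star (x k))"
        by (rule inexact_newton_residual(3)[OF k Ik])
      also have "\<dots> \<le> newton_error k * (b0 * norm ?e)"
        using g_le[of "x k"] elim ne unfolding gx by (intro mult_left_mono) auto
      finally have 2: "norm (H k *v d k + gradF S_star (x k)) \<le> newton_error k * (b0 * norm ?e)" .
      \<comment> \<open>Subtracting and adding the gradient at \<open>x k\<close> splits the image
        of the new error into the two parts just bounded.\<close>
      have "H k *v ?v = (?A (x k) ?e - ?g (x k)) + (H k *v d k + gradF S_star (x k))"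
        unfolding v gx using elim by (simp add: matrix_vector_right_distrib)
      then have Hv: "norm (H k *v ?v) \<le> M * (norm ?e)\<^sup>2 + newton_error k * (b0 * norm ?e)"
        by (simp only:) (intro order_trans[OF norm_triangle_ineq] add_mono 1 2)
      have "\<mu>_min * (norm ?v)\<^sup>2 \<le> ?v \<bullet> (H k *v ?v)"
        using H_bounds[OF k vU] by blast
      also have "\<dots> \<le> norm ?v * norm (H k *v ?v)" by (rule norm_cauchy_schwarz)
      finally have "norm ?v * norm ?v \<le> (norm (H k *v ?v) / \<mu>_min) * norm ?v"
        using mu_min by (simp add: field_simps power2_eq_square)
      then have "norm ?v \<le> norm (H k *v ?v) / \<mu>_min"
        by (rule le_if_square_le) (use mu_min in auto)
      also have "\<dots> \<le> (M * (norm ?e)\<^sup>2 + newton_error k * (b0 * norm ?e)) / \<mu>_min"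
        using Hv mu_min by (intro divide_right_mono) auto
      also have "\<dots> = M / \<mu>_min * (norm ?e)\<^sup>2 + b0 / \<mu>_min * (newton_error k * norm ?e)"
        by (simp add: add_divide_distrib mult_ac)
      also have "b0 / \<mu>_min * (newton_error k * norm ?e) \<le> max b0 (b0 / \<mu>_min) * (newton_error k * norm ?e)"
        using ne by (intro mult_right_mono) auto
      finally show ?case by (simp add: mult.assoc)
    qed
    show "\<forall>\<^sub>F k in sequentially. newton_error k \<le> (max b0 (b0 / \<mu>_min) * norm (x k - x_star)) powr (qexp C - 1)"
      using eventually_newton xb
    proof eventually_elim
      case (elim k)
      then have k: "k \<in> K_cg" and Ik: "I k = U_star" by auto
      have xU: "proj U_star (x k) = x k" using * elim by blast
      have "norm (gradF S_star (x k)) \<le> b0 * norm (x k - x_star)"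
        using g_le[of "x k"] elim unfolding xU by blast
      also have "\<dots> \<le> max b0 (b0 / \<mu>_min) * norm (x k - x_star)"
        by (intro mult_right_mono) auto
      finally have "norm (gradF S_star (x k)) powr (qexp C - 1)
          \<le> (max b0 (b0 / \<mu>_min) * norm (x k - x_star)) powr (qexp C - 1)"
        using param_bounds by (intro powr_mono2) auto
      moreover have "newton_error k \<le> norm (gradF S_star (x k)) powr (qexp C - 1)"
        unfolding newton_error_def using inexact_newton_residual[OF k Ik]
        by (intro mult_left_le_one_le) auto
      ultimately show ?case by linarith
    qed
  qed
qed

text \<open>In \<open>newton_rate\<close> the total factor in front of the distance tends to
  0.\<close>

lemma superlinear_rate:
  "(\<lambda>k. norm (x (Suc k) - x_star)) \<in> o(\<lambda>k. norm (x k - x_star))"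
proof (rule landau_o.smallI)
  fix c :: real assume c: "c > 0"
  obtain a b where ab: "\<forall>\<^sub>F k in sequentially. norm (x (Suc k) - x_star)
      \<le> a * (norm (x k - x_star))\<^sup>2 + b * newton_error k * norm (x k - x_star)"
    by (rule newton_rate)
  have "(\<lambda>k. x k - x_star) \<longlonglongrightarrow> 0"
    using x_tendsto by (simp add: LIM_zero_iff)
  then have "(\<lambda>k. a * norm (x k - x_star) + b * newton_error k) \<longlonglongrightarrow> a * 0 + b * 0"
    by (intro tendsto_add tendsto_mult tendsto_const newton_error_tendsto tendsto_norm_zero)
  then have "\<forall>\<^sub>F k in sequentially. a * norm (x k - x_star) + b * newton_error k < c"
    using c by (intro order_tendstoD(2)) auto
  with ab show "\<forall>\<^sub>F k in sequentially. norm (norm (x (Suc k) - x_star)) \<le> c * norm (norm (x k - x_star))"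
  proof eventually_elim
    case (elim k)
    have "norm (x (Suc k) - x_star) \<le> (a * norm (x k - x_star) + b * newton_error k) * norm (x k - x_star)"
      using elim(1) by (simp add: distrib_right power2_eq_square mult.assoc)
    also have "\<dots> \<le> c * norm (x k - x_star)"
      using elim(2) by (intro mult_right_mono) auto
    finally show ?case by simp
  qed
qed

text \<open>With exponent 2 the residual factor is itself at most linear in the distance.\<close>

lemma quadratic_rate:
  assumes "qexp C = 2"
  shows "(\<lambda>k. norm (x (Suc k) - x_star)) \<in> O(\<lambda>k. (norm (x k - x_star))\<^sup>2)"
proof -
  obtain a b where ab: "a \<ge> 0" "b \<ge> 0"
    "\<forall>\<^sub>F k in sequentially. norm (x (Suc k) - x_star)
      \<le> a * (norm (x k - x_star))\<^sup>2 + b * newton_error k * norm (x k - x_star)"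
    "\<forall>\<^sub>F k in sequentially. newton_error k \<le> (b * norm (x k - x_star)) powr (qexp C - 1)"
    by (rule newton_rate)
  show ?thesis
  proof (rule bigoI[where c = "a + b * b"])
    show "\<forall>\<^sub>F k in sequentially. norm (norm (x (Suc k) - x_star)) \<le> (a + b * b) * norm ((norm (x k - x_star))\<^sup>2)"
      using ab(3,4)
    proof eventually_elim
      case (elim k)
      have "newton_error k \<le> b * norm (x k - x_star)"
        using elim(2) ab(2) assms by simp
      then have "b * newton_error k * norm (x k - x_star) \<le> b * (b * norm (x k - x_star)) * norm (x k - x_star)"
        using ab(2) by (intro mult_right_mono mult_left_mono) auto
      then have "norm (x (Suc k) - x_star) \<le> a * (norm (x k - x_star))\<^sup>2 + b * (b * norm (x k - x_star)) * norm (x k - x_star)"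
        using elim(1) by linarith
      then show ?case by (simp add: algebra_simps power2_eq_square)
    qed
  qed
qed

end
end

theorem theorem4p3:
  fixes f :: "real^'n \<Rightarrow> real"
    and G :: "'g::finite \<Rightarrow> 'n set"
    and lam :: "'g \<Rightarrow> real"
    and C :: algo_params
    and x :: "nat \<Rightarrow> real^'n"
    and \<alpha> :: "nat \<Rightarrow> real"
    and I :: "nat \<Rightarrow> 'n set"
    and H :: "nat \<Rightarrow> real^'n^'n"
    and \<mu> :: "nat \<Rightarrow> real"
    and d :: "nat \<Rightarrow> real^'n"
    and L_f L \<mu>_min \<mu>_max :: real
    and x_star :: "real^'n"
    and r F :: "real^'n \<Rightarrow> real"
    and s :: "nat \<Rightarrow> real^'n"
    and K_cg :: "nat set"
  defines "r \<equiv> group_reg G lam"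
    and "F \<equiv> (\<lambda>z. f z + r z)"
    and "s \<equiv> (\<lambda>k. pg_step f r (x k) (\<alpha> k))"
    and "K_cg \<equiv> {k. chi_pg C G F (x k) (s k) \<le> chi_cg C G F (x k) (s k)}"
  assumes groups: "is_grouping G" and lam_pos: "\<And>i. lam i > 0"
    and params: "valid_params C"
    and run: "algorithm_run C G f r x \<alpha> I H \<mu> d"
    \<comment> \<open>(1)\<close>
    and f_convex: "convex_on UNIV f"
    and f_diff: "\<And>z. f differentiable (at z)"
    and f_C1: "continuous_on UNIV (grad f)"
    and grad_bounded: "\<And>z. F z \<le> F (x 0) \<Longrightarrow> norm (grad f z) \<le> L_f"
    and grad_lipschitz: "L-lipschitz_on {z. F z \<le> F (x 0)} (grad f)"
    and F_below: "bdd_below (range F)"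
    \<comment> \<open>(2)\<close>
    and chi_pos: "\<And>k. max (chi_cg C G F (x k) (s k)) (chi_pg C G F (x k) (s k)) > 0"
    \<comment> \<open>(3)\<close>
    and mu_bounds: "0 < \<mu>_min" "\<mu>_min \<le> \<mu>_max"
    and H_bounds: "\<And>k v. k \<in> K_cg \<Longrightarrow> proj (I k) v = v \<Longrightarrow>
          \<mu>_min * (norm v)\<^sup>2 \<le> v \<bullet> (H k *v v) \<and> v \<bullet> (H k *v v) \<le> \<mu>_max * (norm v)\<^sup>2"
    \<comment> \<open>(4)\<close>
    and f_twice_diff: "\<And>z. grad f differentiable (at z)"
    and f_C2: "continuous_on UNIV (hess f)"
    and f_strongly_convex: "strongly_convex f"
    and x_star: "is_arg_min F (\<lambda>_. True) x_star"
    and hess_lipschitz: "\<exists>\<epsilon>>0. \<exists>M. M-lipschitz_on (ball x_star \<epsilon>) (hess f)"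
    and nondegenerate:
      "\<And>i. proj (G i) x_star = 0 \<Longrightarrow> norm (proj (G i) (grad f x_star)) < lam i"
    \<comment> \<open>(5)\<close>
    and eta_half: "eta C \<in> {0<..<1 / 2}"
    and I_full: "\<forall>\<^sub>F k in sequentially.
          I k = (if k \<in> K_cg then cg_set C G F (x k) (s k) else pg_set C G F (x k) (s k))"
    and H_hess: "\<forall>\<^sub>F k in sequentially. k \<in> K_cg \<longrightarrow> H k = hess_on (I k) F (x k)"
    and accuracy: "qexp C \<in> {1<..2} \<or>
          qexp C = 1 \<and> (\<mu> \<longlongrightarrow> 0) (inf sequentially (principal K_cg))"
  shows "x \<longlonglongrightarrow> x_star \<and>
    (\<lambda>k. norm (x (Suc k) - x_star)) \<in> o(\<lambda>k. norm (x k - x_star)) \<and>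
    (qexp C = 2 \<longrightarrow>
      (\<lambda>k. norm (x (Suc k) - x_star)) \<in> O(\<lambda>k. (norm (x k - x_star))\<^sup>2))"
proof -
  note defs = r_def F_def s_def K_cg_def
  interpret composite_problem G lam f
    by unfold_locales (use groups lam_pos f_diff f_twice_diff f_C2 f_strongly_convex in auto)
  \<comment> \<open>\<open>F\<close> is defined in the theorem and again in the locale; the two are
    identified before facts are transferred.\<close>
  have F_eq: "F = composite_problem.F G lam f"
    unfolding composite_problem.F_def[OF composite_problem_axioms] unfolding defs ..
  interpret composite_run G lam f C x \<alpha> I H \<mu> d \<mu>_min \<mu>_max x_star s K_cg
  proof (unfold_locales, goal_cases)
    case (2)
    then show ?case using run by (simp only: defs(1))
  next
    case (3 k) then show ?case by (simp only: defs)
  next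
    case (4 k) then show ?case by (simp add: defs(4) F_eq)
  next
    case (5 k) then show ?case using chi_pos[of k] by (simp only: F_eq)
  next
    case (8 k v) then show ?case using H_bounds by blast
  next
    case 9 then show ?case using x_star by (simp only: F_eq)
  qed (use params mu_bounds in auto)
  show ?thesis
    using x_tendsto superlinear_rate quadratic_rate
      hess_lipschitz nondegenerate eta_half I_full H_hess accuracy
    unfolding F_eq by blast
qed

end
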